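(* Let $\Omega=\{0,1\}^\omega$ and let $P$ be the standard probability measure on $\Omega$. Then there exists a computable Wiener process $W:\Omega\rightharpoonup C([0,1];\mathbb{R})$ with open domain of full measure; that is, there is a computable partial function $W$ from $\Omega$ to $C([0,1];\mathbb{R})$ whose domain is an open set of $P$-measure $1$ and which is a Wiener process on $[0,1]$ over $(\Omega,P)$.
   Context: The standard probability measure on $\{0,1\}^\omega$ is the fair-coin product measure. $C([0,1];\mathbb{R})$ is the space of continuous functions with the uniform metric and its standard representation. A partial function $W:\Omega\rightharpoonup C([0,1];\mathbb{R})$ is computable (in the sense of type-two effectivity) if there is a type-two Turing machine which, on every input $\omega\in\mathrm{dom}(W)$, outputs a name of the function $W(\omega)$ (equivalently, on input $\omega\in\mathrm{dom}(W)$ and $k\in\mathbb{N}$ one can compute a rational piecewise-linear function within uniform distance $2^{-k}$ of $W(\omega)$). $W$ is a Wiener process on $[0,1]$ if, writing $W(t)$ for $\omega\mapsto W(\omega)(t)$, $W(0)=0$, the process has independent increments, and $W(t)-W(s)\sim N(0,t-s)$ (normal with mean $0$ and variance $t-s$) for $0\le s<t\le1$. *)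

theory Defs
  imports "HOL-Probability.Probability"
begin

section \<open>Type-two Turing machines\<close>

text \<open>
  A type-two machine has a one-way read-only input tape holding an infinite binary sequence,
  a fixed number of two-way infinite work tapes over a finite alphabet, and a one-way write-only
  output tape.  There are no halting states, since the result is the infinite output sequence;
  a machine that stops writing produces no result.

  States and work symbols are initial segments of the naturals; state \<open>0\<close> is initial and
  symbol \<open>0\<close> is the blank.  One application of \<open>delta\<close> maps the current state, the scanned
  input bit and the list of scanned work symbols to the next state, whether the input head advances,
  the symbol written and head movement for every work tape, and at most one output bit.  Only the
  finitely many arguments covered by \<open>valid_machine\<close> matter, so \<open>delta\<close> is a finite table.
\<close>

datatype movement = MoveLeft | Stay | MoveRight

fun offset :: "movement \<Rightarrow> int" where
  "offset MoveLeft = - 1"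
| "offset Stay = 0"
| "offset MoveRight = 1"

record type2_machine =
  n_states :: nat
  n_symbols :: nat
  n_tapes :: nat
  delta :: "nat \<Rightarrow> bool \<Rightarrow> nat list \<Rightarrow> nat \<times> bool \<times> (nat \<times> movement) list \<times> bool option"

definition valid_machine :: "type2_machine \<Rightarrow> bool" where
  "valid_machine M \<longleftrightarrow>
     0 < n_states M \<and> 0 < n_symbols M \<and>
     (\<forall>q b ss. q < n_states M \<and> length ss = n_tapes M \<and> (\<forall>s\<in>set ss. s < n_symbols M) \<longrightarrow>
        (case delta M q b ss of (q', adv, acts, out) \<Rightarrow>
           q' < n_states M \<and> length acts = n_tapes M \<and>
           (\<forall>(s, m)\<in>set acts. s < n_symbols M)))"

type_synonym tape = "(int \<Rightarrow> nat) \<times> int"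

record config =
  cur_state :: nat
  input_pos :: nat
  work_tapes :: "tape list"
  written :: "bool list"

definition scan :: "tape \<Rightarrow> nat" where
  "scan T = (case T of (cells, h) \<Rightarrow> cells h)"

definition act :: "nat \<times> movement \<Rightarrow> tape \<Rightarrow> tape" where
  "act a T = (case a of (s, m) \<Rightarrow> case T of (cells, h) \<Rightarrow> (cells(h := s), h + offset m))"

definition init_config :: "type2_machine \<Rightarrow> config" where
  "init_config M =
     \<lparr>cur_state = 0, input_pos = 0, work_tapes = replicate (n_tapes M) (\<lambda>_. 0, 0), written = []\<rparr>"

definition step :: "type2_machine \<Rightarrow> (nat \<Rightarrow> bool) \<Rightarrow> config \<Rightarrow> config" where
  "step M x c =
     (case delta M (cur_state c) (x (input_pos c)) (map scan (work_tapes c)) of (q', adv, acts, out) \<Rightarrow>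
        \<lparr>cur_state = q',
         input_pos = (if adv then Suc (input_pos c) else input_pos c),
         work_tapes = map2 act acts (work_tapes c),
         written = written c @ (case out of None \<Rightarrow> [] | Some b \<Rightarrow> [b])\<rparr>)"

definition run :: "type2_machine \<Rightarrow> (nat \<Rightarrow> bool) \<Rightarrow> nat \<Rightarrow> config" where
  "run M x n = (step M x ^^ n) (init_config M)"

definition initial_segment :: "'a list \<Rightarrow> (nat \<Rightarrow> 'a) \<Rightarrow> bool" where
  "initial_segment w p \<longleftrightarrow> w = map p [0..<length w]"

definition produces :: "type2_machine \<Rightarrow> (nat \<Rightarrow> bool) \<Rightarrow> (nat \<Rightarrow> bool) \<Rightarrow> bool" where
  "produces M x y \<longleftrightarrow>
     (\<forall>n. initial_segment (written (run M x n)) y) \<and>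
     (\<forall>m. \<exists>n. m < length (written (run M x n)))"


section \<open>The space of continuous functions on the unit interval\<close>

text \<open>Extensionality makes equality of elements agree with equality as functions on \<open>[0,1]\<close>.\<close>

definition C01 :: "(real \<Rightarrow> real) set" where
  "C01 = {f \<in> extensional {0..1}. continuous_on {0..1} f}"

definition uniform_dist :: "(real \<Rightarrow> real) \<Rightarrow> (real \<Rightarrow> real) \<Rightarrow> real" where
  "uniform_dist f g = (SUP t\<in>{0..1}. \<bar>f t - g t\<bar>)"

text \<open>
  A rational piecewise-linear function is given by its list of vertices.  Rationals are given by
  not necessarily reduced fractions: the pair \<open>(a, b)\<close> stands for \<open>a / (b + 1)\<close>.
\<close>

type_synonym fraction = "int \<times> nat"

definition frac_val :: "fraction \<Rightarrow> real" where
  "frac_val r = (case r of (a, b) \<Rightarrow> real_of_int a / real (Suc b))"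

definition polygon_code :: "(fraction \<times> fraction) list \<Rightarrow> bool" where
  "polygon_code vs \<longleftrightarrow>
     vs \<noteq> [] \<and> sorted_wrt (<) (map (frac_val \<circ> fst) vs) \<and>
     frac_val (fst (hd vs)) = 0 \<and> frac_val (fst (last vs)) = 1"

fun polygon :: "(fraction \<times> fraction) list \<Rightarrow> real \<Rightarrow> real" where
  "polygon [] t = 0"
| "polygon [v] t = frac_val (snd v)"
| "polygon (v # w # vs) t =
     (if t \<le> frac_val (fst w)
      then frac_val (snd v) + (frac_val (snd w) - frac_val (snd v)) *
             (t - frac_val (fst v)) / (frac_val (fst w) - frac_val (fst v))
      else polygon (w # vs) t)"

text \<open>Self-delimiting binary words for vertex lists.\<close>

definition enc_nat :: "nat \<Rightarrow> bool list" where
  "enc_nat n = replicate n True @ [False]"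

definition enc_fraction :: "fraction \<Rightarrow> bool list" where
  "enc_fraction r = (case r of (a, b) \<Rightarrow> (a < 0) # enc_nat (nat \<bar>a\<bar>) @ enc_nat b)"

definition enc_polygon :: "(fraction \<times> fraction) list \<Rightarrow> bool list" where
  "enc_polygon vs =
     enc_nat (length vs) @ concat (map (\<lambda>(r, s). enc_fraction r @ enc_fraction s) vs)"

text \<open>
  The standard (Cauchy) representation: a name of \<open>f\<close> is the infinite concatenation of codes of
  rational polygons, the \<open>k\<close>-th of which is within uniform distance \<open>1 / 2^k\<close> of \<open>f\<close>.
\<close>

definition names :: "(nat \<Rightarrow> bool) \<Rightarrow> (real \<Rightarrow> real) \<Rightarrow> bool" where
  "names y f \<longleftrightarrow>
     (\<exists>vs. (\<forall>k. polygon_code (vs k) \<and> uniform_dist (polygon (vs k)) f \<le> 1 / 2 ^ k) \<and>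
           (\<forall>n. initial_segment (concat (map (\<lambda>k. enc_polygon (vs k)) [0..<n])) y))"

text \<open>No requirement is imposed on the behaviour of the machine outside the domain.\<close>

definition type2_computable :: "((nat \<Rightarrow> bool) \<rightharpoonup> (real \<Rightarrow> real)) \<Rightarrow> bool" where
  "type2_computable F \<longleftrightarrow>
     (\<exists>M. valid_machine M \<and> (\<forall>x f. F x = Some f \<longrightarrow> (\<exists>y. produces M x y \<and> names y f)))"


section \<open>Fair coin measure and Wiener processes\<close>

definition coin_space :: "(nat \<Rightarrow> bool) measure" where
  "coin_space = PiM UNIV (\<lambda>_. measure_pmf (bernoulli_pmf (1 / 2)))"

definition independent_increments :: "'a measure \<Rightarrow> (real \<Rightarrow> 'a \<Rightarrow> real) \<Rightarrow> bool" where
  "independent_increments M X \<longleftrightarrow>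
     (\<forall>(n::nat) t. 0 \<le> t 0 \<and> (\<forall>i<n. t i < t (Suc i)) \<and> t n \<le> 1 \<longrightarrow>
        prob_space.indep_vars M (\<lambda>_. borel) (\<lambda>i \<omega>. X (t (Suc i)) \<omega> - X (t i) \<omega>) {..<n})"

text \<open>Note that \<open>normal_density\<close> is parametrised by the standard deviation.\<close>

definition wiener_process01 :: "'a measure \<Rightarrow> (real \<Rightarrow> 'a \<Rightarrow> real) \<Rightarrow> bool" where
  "wiener_process01 M X \<longleftrightarrow>
     prob_space M \<and>
     (\<forall>t\<in>{0..1}. X t \<in> borel_measurable M) \<and>
     (\<forall>\<omega>\<in>space M. X 0 \<omega> = 0) \<and>
     independent_increments M X \<and>
     (\<forall>s t. 0 \<le> s \<and> s < t \<and> t \<le> 1 \<longrightarrow>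
        distributed M lborel (\<lambda>\<omega>. X t \<omega> - X s \<omega>) (normal_density 0 (sqrt (t - s))))"

end

theory Submission
  imports Defs "HOL-Library.Discrete_Functions"
begin

text \<open>
  The process is the Faber--Schauder series
  \<open>\<zeta> 0 * t + (\<Sum>n. \<Sum>j<2^n. \<zeta> (2^n + j) * tent (2^n * t - j) / sqrt (2^n))\<close> with i.i.d. standard normal
  coefficients \<open>\<zeta> i = \<plusminus> quantile (V i)\<close>.  A continuous function is bounded on a compact open set of inputs;
  so for the domain to be open, all but finitely many coefficients have to obey bounds that are
  known after finitely many bits.  This is achieved by first drawing a random level \<open>m\<close> and conditioning
  on it: the seeds \<open>V i\<close> with \<open>i \<ge> m\<close> avoid a tail of probability \<open>1 / (i + 2)\<^sup>2\<close>, the seed with index \<open>m - 1\<close>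
  lies in its tail, and the previous ones are free.  The law of the level is chosen such that the
  mixture is i.i.d. uniform, and only the first \<open>m\<close> seeds impose the open condition \<open>V i < 1\<close>.

  The law of the increments is read off from their joint characteristic function, which Parseval's
  identity for the Haar basis reduces to the covariance \<open>min s t\<close>.  That a product form of the joint
  characteristic function implies independence follows from the one-dimensional uniqueness theorem.

  The coefficients are located by rational bounds, obtained from the Taylor series of the normal
  distribution function and the Leibniz series of \<open>\<pi>\<close>.  The machine reads on until these bounds are good
  enough, so no rates of convergence are needed.  It is obtained by compiling recursive functions
  into while programs and those into counter machines.
\<close>

section \<open>Counter machines\<close>

text \<open>Exact rational tests shape the construction. Level \<open>n\<close> of the series
  carries the factor \<open>1 / sqrt (2 ^ n)\<close>, so \<open>quantile V / sqrt (2 ^ n)\<close> is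
  located among grid points \<open>j / 2 ^ T\<close>, which means comparing
  \<open>quantile V\<close> with \<open>z = sqrt (2 ^ n) * j / 2 ^ T\<close>. Neither
  \<open>z\<close> nor the normalising \<open>sqrt (2 * pi)\<close> is rational. But
  \<open>(folded_cdf z)\<^sup>2 * pi\<close> is \<open>2 * z\<^sup>2\<close> times the square of a
  power series in \<open>z\<^sup>2\<close> with rational coefficients, and \<open>z\<^sup>2\<close>
  is rational. Seeds and \<open>folded_cdf z\<close> are therefore compared through their squares,
  which is faithful for nonnegative numbers: hence the folded distribution, with the sign drawn as a
  separate bit. Order relations between computed reals are confirmed in finite time only if they
  hold strictly, so the grid windows from \<open>j\<close> to \<open>j + 2\<close> are made to
  overlap; on the domain one of them is always confirmed. The decay of \<open>eps\<close> is matched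
  with the eighth moment: tails of order \<open>4 ^ (- n)\<close> at level \<open>n\<close> bound
  the coefficients by a multiple of \<open>2 ^ (n / 4)\<close>, which the factor
  \<open>2 ^ (- n / 2)\<close> outweighs.\<close>

datatype instr = INC nat | DEC nat | JZ nat nat | JMP nat | OUT bool | ADV | JF nat

type_synonym cstate = "nat \<times> (nat \<Rightarrow> nat) \<times> nat \<times> bool list"

fun exec :: "instr \<Rightarrow> (nat \<Rightarrow> bool) \<Rightarrow> cstate \<Rightarrow> cstate" where
  "exec (INC r) x (q, \<sigma>, i, w) = (Suc q, \<sigma>(r := Suc (\<sigma> r)), i, w)"
| "exec (DEC r) x (q, \<sigma>, i, w) = (Suc q, \<sigma>(r := \<sigma> r - 1), i, w)"
| "exec (JZ r t) x (q, \<sigma>, i, w) = (if \<sigma> r = 0 then t else Suc q, \<sigma>, i, w)"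
| "exec (JMP t) x (q, \<sigma>, i, w) = (t, \<sigma>, i, w)"
| "exec (OUT b) x (q, \<sigma>, i, w) = (Suc q, \<sigma>, i, w @ [b])"
| "exec ADV x (q, \<sigma>, i, w) = (Suc q, \<sigma>, Suc i, w)"
| "exec (JF t) x (q, \<sigma>, i, w) = (if x i then Suc q else t, \<sigma>, i, w)"

definition cstep :: "instr list \<Rightarrow> (nat \<Rightarrow> bool) \<Rightarrow> cstate \<Rightarrow> cstate \<Rightarrow> bool" where
  "cstep P x c c' \<longleftrightarrow> fst c < length P \<and> c' = exec (P ! fst c) x c"

abbreviation reach :: "instr list \<Rightarrow> (nat \<Rightarrow> bool) \<Rightarrow> cstate \<Rightarrow> cstate \<Rightarrow> bool" where
  "reach P x \<equiv> (cstep P x)\<^sup>*\<^sup>*"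

fun regs_below :: "nat \<Rightarrow> instr \<Rightarrow> bool" where
  "regs_below R (INC r) \<longleftrightarrow> r < R"
| "regs_below R (DEC r) \<longleftrightarrow> r < R"
| "regs_below R (JZ r t) \<longleftrightarrow> r < R"
| "regs_below R _ \<longleftrightarrow> True"

fun target_le :: "nat \<Rightarrow> instr \<Rightarrow> bool" where
  "target_le n (JZ r t) \<longleftrightarrow> t \<le> n"
| "target_le n (JMP t) \<longleftrightarrow> t \<le> n"
| "target_le n (JF t) \<longleftrightarrow> t \<le> n"
| "target_le n _ \<longleftrightarrow> True"

definition keep :: "nat list \<Rightarrow> (nat \<times> movement) list" where
  "keep ss = map (\<lambda>s. (s, Stay)) ss"

text \<open>The mark is scanned exactly when the counter is \<open>0\<close>: this is the zero test
  of \<open>JZ\<close>, and it lets \<open>DEC\<close> stop at \<open>0\<close>. Jump targets are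
  shifted by one because state \<open>0\<close> is taken by the initialisation.\<close>

fun instr_delta :: "instr \<Rightarrow> nat \<Rightarrow> bool \<Rightarrow> nat list \<Rightarrow> nat \<times> bool \<times> (nat \<times> movement) list \<times> bool option" where
  "instr_delta (INC r) q b ss = (Suc q, False, (keep ss)[r := (ss ! r, MoveRight)], None)"
| "instr_delta (DEC r) q b ss =
     (Suc q, False, (keep ss)[r := (ss ! r, if ss ! r = 1 then Stay else MoveLeft)], None)"
| "instr_delta (JZ r t) q b ss = (if ss ! r = 1 then Suc t else Suc q, False, keep ss, None)"
| "instr_delta (JMP t) q b ss = (Suc t, False, keep ss, None)"
| "instr_delta (OUT c) q b ss = (Suc q, False, keep ss, Some c)"
| "instr_delta ADV q b ss = (Suc q, True, keep ss, None)"
| "instr_delta (JF t) q b ss = (if b then Suc q else Suc t, False, keep ss, None)"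

text \<open>
  A counter is a work tape with the single mark \<open>1\<close> in cell \<open>0\<close>, its value being the head position.
  State \<open>0\<close> writes the marks and state \<open>Suc q\<close> stands for program counter \<open>q\<close>.
\<close>

definition counter_machine :: "instr list \<Rightarrow> nat \<Rightarrow> type2_machine" where
  "counter_machine P R =
     \<lparr>n_states = length P + 2, n_symbols = 2, n_tapes = R,
      delta = (\<lambda>q b ss.
        if q = 0 then (1, False, replicate R (1, Stay), None)
        else if q \<le> length P then instr_delta (P ! (q - 1)) q b ss
        else (0, False, keep ss, None))\<rparr>"

lemma keep_simps [simp]:
  "length (keep ss) = length ss"
  "i < length ss \<Longrightarrow> keep ss ! i = (ss ! i, Stay)"
  by (auto simp: keep_def)

lemma set_keep_update:
  assumes "(s, m) \<in> set ((keep ss)[r := (v, m')])" "v < N" "\<forall>s\<in>set ss. s < N"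
  shows "s < N"
  using set_update_subset_insert[of "keep ss" r "(v, m')"] assms by (auto simp: keep_def)

lemma set_keepD: "(s, m) \<in> set (keep ss) \<Longrightarrow> s \<in> set ss"
  by (auto simp: keep_def)

lemma instr_delta_valid:
  assumes "regs_below (length ss) i" "target_le n i" "q \<le> n" "\<forall>s\<in>set ss. s < N"
  shows "case instr_delta i q b ss of (q', adv, acts, out) \<Rightarrow>
           q' < n + 2 \<and> length acts = length ss \<and> (\<forall>(s, m)\<in>set acts. s < N)"
proof -
  have "v < N" if "r < length ss" "ss ! r = v" for r v using that assms(4) nth_mem by blast
  then show ?thesis
    using assms by (cases i) (auto dest: set_keepD elim!: set_keep_update split: if_splits)
qed

lemma valid_counter_machine:
  assumes "list_all (regs_below R) P" "list_all (target_le (length P)) P"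
  shows "valid_machine (counter_machine P R)"
  unfolding valid_machine_def
proof (intro conjI allI impI)
  fix q b and ss :: "nat list"
  assume *: "q < n_states (counter_machine P R) \<and> length ss = n_tapes (counter_machine P R) \<and>
    (\<forall>s\<in>set ss. s < n_symbols (counter_machine P R))"
  consider "q = 0" | "q > length P" "q \<noteq> 0" | "q \<noteq> 0" "q \<le> length P" by linarith
  then show "case delta (counter_machine P R) q b ss of (q', adv, acts, out) \<Rightarrow>
           q' < n_states (counter_machine P R) \<and> length acts = n_tapes (counter_machine P R) \<and>
           (\<forall>(s, m)\<in>set acts. s < n_symbols (counter_machine P R))"
  proof cases
    case 3
    then have "P ! (q - 1) \<in> set P" by simp
    with assms have "regs_below R (P ! (q - 1))" "target_le (length P) (P ! (q - 1))"
      by (auto simp: list_all_iff)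
    with 3 * show ?thesis
      using instr_delta_valid[of ss "P ! (q - 1)" "length P" q 2 b]
      by (auto simp: counter_machine_def)
  qed (use * in \<open>auto simp: counter_machine_def dest: set_keepD\<close>)
qed (auto simp: counter_machine_def)

definition mark :: "int \<Rightarrow> nat" where
  "mark z = (if z = 0 then 1 else 0)"

definition tapes_of :: "nat \<Rightarrow> (nat \<Rightarrow> nat) \<Rightarrow> tape list" where
  "tapes_of R \<sigma> = map (\<lambda>r. (mark, int (\<sigma> r))) [0..<R]"

definition config_of :: "nat \<Rightarrow> cstate \<Rightarrow> config" where
  "config_of R c = (case c of (q, \<sigma>, i, w) \<Rightarrow>
     \<lparr>cur_state = Suc q, input_pos = i, work_tapes = tapes_of R \<sigma>, written = w\<rparr>)"

lemma length_tapes_of [simp]: "length (tapes_of R \<sigma>) = R"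
  by (simp add: tapes_of_def)

lemma nth_tapes_of [simp]: "r < R \<Longrightarrow> tapes_of R \<sigma> ! r = (mark, int (\<sigma> r))"
  by (simp add: tapes_of_def)

lemma scan_tapes_of: "map scan (tapes_of R \<sigma>) = map (\<lambda>r. mark (int (\<sigma> r))) [0..<R]"
  by (simp add: tapes_of_def scan_def)

lemma act_mark: "act (mark h, m) (mark, h) = (mark, h + offset m)"
  by (simp add: act_def fun_upd_idem)

lemma keep_tapes_of: "map2 act (keep (map scan (tapes_of R \<sigma>))) (tapes_of R \<sigma>) = tapes_of R \<sigma>"
  by (rule nth_equalityI) (auto simp: scan_tapes_of act_mark)

lemma update_tapes_of:
  assumes "r < R" "int (\<sigma> r) + offset m = int v"
  shows "map2 act ((keep (map scan (tapes_of R \<sigma>)))[r := (map scan (tapes_of R \<sigma>) ! r, m)]) (tapes_of R \<sigma>)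
       = tapes_of R (\<sigma>(r := v))"
  using assms by (intro nth_equalityI) (auto simp: scan_tapes_of act_mark nth_list_update)

text \<open>The simulation is in lockstep, one machine step per instruction, so no intermediate
  configurations have to be described.\<close>

lemma step_config_of:
  assumes "cstep P x c c'" "list_all (regs_below R) P"
  shows "step (counter_machine P R) x (config_of R c) = config_of R c'"
proof -
  obtain q \<sigma> i w where c: "c = (q, \<sigma>, i, w)" by (cases c)
  have q: "q < length P" and c': "c' = exec (P ! q) x (q, \<sigma>, i, w)"
    using assms by (auto simp: cstep_def c)
  have rb: "regs_below R (P ! q)" using assms q by (auto simp: list_all_iff)
  have d: "delta (counter_machine P R) (Suc q) b ss = instr_delta (P ! q) (Suc q) b ss" for b ss
    using q by (simp add: counter_machine_def)
  have sc: "map scan (tapes_of R \<sigma>) ! r = mark (int (\<sigma> r))" if "r < R" for r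
    using that by (simp add: scan_tapes_of)
  show ?thesis
  proof (cases "P ! q")
    case (INC r)
    have "map2 act ((keep (map scan (tapes_of R \<sigma>)))[r := (map scan (tapes_of R \<sigma>) ! r, MoveRight)]) (tapes_of R \<sigma>)
       = tapes_of R (\<sigma>(r := Suc (\<sigma> r)))"
      using rb INC by (intro update_tapes_of) auto
    then show ?thesis using rb INC by (simp add: c c' config_of_def step_def d del: map_map)
  next
    case (DEC r)
    have "map2 act ((keep (map scan (tapes_of R \<sigma>)))[r := (map scan (tapes_of R \<sigma>) ! r,
         if map scan (tapes_of R \<sigma>) ! r = 1 then Stay else MoveLeft)]) (tapes_of R \<sigma>)
       = tapes_of R (\<sigma>(r := \<sigma> r - 1))"
      using rb DEC by (intro update_tapes_of) (auto simp: scan_def mark_def)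
    then show ?thesis using rb DEC by (simp add: c c' config_of_def step_def d del: map_map)
  next
    case (JZ r t)
    then show ?thesis using rb by (simp add: c c' config_of_def step_def d keep_tapes_of scan_def mark_def del: map_map)
  qed (simp_all add: c c' config_of_def step_def d keep_tapes_of del: map_map)
qed

lemma run_Suc: "run M x (Suc n) = step M x (run M x n)"
  by (simp add: run_def)

lemma written_step: "\<exists>u. written (step M x c) = written c @ u"
  by (auto simp: step_def split: prod.splits)

lemma written_mono: "m \<le> n \<Longrightarrow> \<exists>u. written (run M x n) = written (run M x m) @ u"
proof (induction n rule: dec_induct)
  case (step n)
  then show ?case using written_step[of M x "run M x n"] by (auto simp: run_Suc)
qed auto

lemma run_counter_machine:
  assumes "reach P x (0, \<lambda>_. 0, 0, []) c" "list_all (regs_below R) P"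
  shows "\<exists>n. run (counter_machine P R) x n = config_of R c"
  using assms(1)
proof (induction rule: rtranclp_induct)
  case base
  have "tapes_of R (\<lambda>_. 0) = map2 act (replicate R (1, Stay)) (replicate R (\<lambda>_. 0, 0))"
    by (intro nth_equalityI) (auto simp: act_def mark_def fun_eq_iff)
  \<comment> \<open>The step from state \<open>0\<close> marks the blank tapes without moving any
    head, so the simulation starts at time \<open>1\<close>.\<close>
  then have "run (counter_machine P R) x 1 = config_of R (0, \<lambda>_. 0, 0, [])"
    by (simp add: run_def step_def init_config_def counter_machine_def config_of_def)
  then show ?case by blast
next
  case (step c c')
  then obtain n where "run (counter_machine P R) x n = config_of R c" by blast
  with step_config_of[OF step(2) assms(2)] have "run (counter_machine P R) x (Suc n) = config_of R c'"
    by (simp add: run_Suc)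
  then show ?case by blast
qed

section \<open>While programs over counters\<close>

datatype com = Skip | Inc nat | Dec nat | Seq com com | While nat com

inductive big :: "com \<Rightarrow> (nat \<Rightarrow> nat) \<Rightarrow> (nat \<Rightarrow> nat) \<Rightarrow> bool" where
  Skip: "big Skip \<sigma> \<sigma>"
| Inc: "big (Inc r) \<sigma> (\<sigma>(r := Suc (\<sigma> r)))"
| Dec: "big (Dec r) \<sigma> (\<sigma>(r := \<sigma> r - 1))"
| Seq: "big c \<sigma> \<tau> \<Longrightarrow> big d \<tau> \<upsilon> \<Longrightarrow> big (Seq c d) \<sigma> \<upsilon>"
| While0: "\<sigma> r = 0 \<Longrightarrow> big (While r c) \<sigma> \<sigma>"
| WhileS: "\<sigma> r \<noteq> 0 \<Longrightarrow> big c \<sigma> \<tau> \<Longrightarrow> big (While r c) \<tau> \<upsilon> \<Longrightarrow> big (While r c) \<sigma> \<upsilon>"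

text \<open>Jump targets are absolute, so the code depends on the address \<open>a\<close> where it
  will stand. The \<open>2\<close> in the loop counts the \<open>JZ\<close> in front of the body and
  the \<open>JMP\<close> behind it.\<close>

fun code :: "nat \<Rightarrow> com \<Rightarrow> instr list" where
  "code a Skip = []"
| "code a (Inc r) = [INC r]"
| "code a (Dec r) = [DEC r]"
| "code a (Seq c d) = code a c @ code (a + length (code a c)) d"
| "code a (While r c) = JZ r (a + length (code (Suc a) c) + 2) # code (Suc a) c @ [JMP a]"

definition code_at :: "instr list \<Rightarrow> nat \<Rightarrow> instr list \<Rightarrow> bool" where
  "code_at P a C \<longleftrightarrow> (\<exists>P1 P2. P = P1 @ C @ P2 \<and> length P1 = a)"

lemma code_at_append [simp]: "code_at P a (C @ D) \<longleftrightarrow> code_at P a C \<and> code_at P (a + length C) D"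
proof
  assume "code_at P a (C @ D)"
  then obtain P1 P2 where *: "P = P1 @ (C @ D) @ P2" "length P1 = a" by (auto simp: code_at_def)
  have "P = P1 @ C @ (D @ P2)" "P = (P1 @ C) @ D @ P2" "length (P1 @ C) = a + length C" using * by auto
  then show "code_at P a C \<and> code_at P (a + length C) D" using *(2) unfolding code_at_def by blast
next
  assume "code_at P a C \<and> code_at P (a + length C) D"
  then obtain P1 P2 P3 P4 where *: "P = P1 @ C @ P2" "length P1 = a" "P = P3 @ D @ P4"
    "length P3 = a + length C" unfolding code_at_def by metis
  have "P1 @ C = P3" using * by (metis append_assoc append_eq_append_conv length_append)
  then have "P = P1 @ (C @ D) @ P4" using * by auto
  then show "code_at P a (C @ D)" using * unfolding code_at_def by blast
qed

lemma code_at_Cons: "code_at P a (i # D) \<longleftrightarrow> a < length P \<and> P ! a = i \<and> code_at P (Suc a) D"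
proof -
  have "code_at P a [i] \<longleftrightarrow> a < length P \<and> P ! a = i"
  proof
    assume "a < length P \<and> P ! a = i"
    then have "P = take a P @ [i] @ drop (Suc a) P \<and> length (take a P) = a"
      using id_take_nth_drop[of a P] by simp
    then show "code_at P a [i]" unfolding code_at_def by blast
  qed (auto simp: code_at_def nth_append)
  then show ?thesis using code_at_append[of P a "[i]" D] by simp
qed

text \<open>Only terminating commands without input or output are covered; reading, writing and the
  endless outer loop are added by hand around them in \<open>transducer_machine\<close>.\<close>

lemma code_correct:
  assumes "big c \<sigma> \<tau>" "code_at P a (code a c)"
  shows "reach P x (a, \<sigma>, i, w) (a + length (code a c), \<tau>, i, w)"
  using assms
proof (induction arbitrary: a rule: big.induct)
  case (Seq c \<sigma> \<tau> d \<upsilon>)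
  then show ?case by (fastforce simp: add.assoc intro: rtranclp_trans)
next
  case (While0 \<sigma> r c)
  then have "cstep P x (a, \<sigma>, i, w) (a + length (code a (While r c)), \<sigma>, i, w)"
    by (auto simp: cstep_def code_at_Cons)
  then show ?case by blast
next
  case (WhileS \<sigma> r c \<tau> \<upsilon>)
  let ?b = "Suc a + length (code (Suc a) c)"
  have "cstep P x (a, \<sigma>, i, w) (Suc a, \<sigma>, i, w)"
    using WhileS by (auto simp: cstep_def code_at_Cons)
  moreover have "reach P x (Suc a, \<sigma>, i, w) (?b, \<tau>, i, w)"
    using WhileS.IH(1)[of "Suc a"] WhileS.prems by (simp add: code_at_Cons)
  moreover have "cstep P x (?b, \<tau>, i, w) (a, \<tau>, i, w)"
    using WhileS by (auto simp: cstep_def code_at_Cons)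
  moreover have "reach P x (a, \<tau>, i, w) (a + length (code a (While r c)), \<upsilon>, i, w)"
    using WhileS by blast
  ultimately show ?case by (meson converse_rtranclp_into_rtranclp rtranclp_trans)
qed (auto simp: cstep_def code_at_Cons intro!: r_into_rtranclp)

lemma code_targets: "a + length (code a c) \<le> n \<Longrightarrow> list_all (target_le n) (code a c)"
  by (induction c arbitrary: a) auto

lemma code_regs: "\<exists>R. list_all (regs_below R) C"
proof (induction C)
  case (Cons i C)
  then obtain R where R: "list_all (regs_below R) C" by blast
  have mono: "regs_below R i \<Longrightarrow> R \<le> R' \<Longrightarrow> regs_below R' i" for i R R' by (cases i) auto
  obtain R' where "regs_below R' i" by (cases i) auto
  then have "list_all (regs_below (max R R')) (i # C)"
    using R by (auto simp: list_all_iff intro: mono)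
  then show ?case by blast
qed auto

section \<open>Commands that evaluate expressions into a fresh counter\<close>

lemma big_clear: "big (While r (Dec r)) \<sigma> (\<sigma>(r := 0))"
proof (induction "\<sigma> r" arbitrary: \<sigma>)
  case 0
  then show ?case using While0[of \<sigma> r] by (simp add: fun_upd_idem)
next
  case (Suc n)
  then have e: "n = (\<sigma>(r := \<sigma> r - 1)) r" by simp
  from Suc(1)[of "\<sigma>(r := \<sigma> r - 1)", OF e] have "big (While r (Dec r)) (\<sigma>(r := \<sigma> r - 1)) (\<sigma>(r := 0))"
    by simp
  from WhileS[OF _ Dec this] show ?case using Suc by auto
qed

definition move_com :: "nat \<Rightarrow> nat \<Rightarrow> com" where
  "move_com r s = While r (Seq (Dec r) (Inc s))"

lemma big_move:
  assumes "r \<noteq> s"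
  shows "big (move_com r s) \<sigma> (\<sigma>(r := 0, s := \<sigma> s + \<sigma> r))"
  unfolding move_com_def
proof (induction "\<sigma> r" arbitrary: \<sigma>)
  case 0
  then show ?case using While0[of \<sigma> r] by (simp add: fun_upd_idem)
next
  case (Suc n)
  let ?\<tau> = "\<sigma>(r := \<sigma> r - 1, s := Suc (\<sigma> s))"
  have 1: "big (Seq (Dec r) (Inc s)) \<sigma> ?\<tau>"
    using Seq[OF Dec[of r \<sigma>] Inc[of s "\<sigma>(r := \<sigma> r - 1)"]] assms by simp
  have e: "?\<tau> r = n" using Suc assms by simp
  have "?\<tau>(r := 0, s := ?\<tau> s + ?\<tau> r) = \<sigma>(r := 0, s := \<sigma> s + \<sigma> r)"
    using assms Suc(2) by (auto simp: fun_eq_iff)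
  with Suc(1)[of ?\<tau>, OF e[symmetric]] have "big (While r (Seq (Dec r) (Inc s))) ?\<tau> (\<sigma>(r := 0, s := \<sigma> s + \<sigma> r))"
    by simp
  from WhileS[OF _ 1 this] show ?case using Suc by simp
qed

text \<open>A stack discipline: counters below \<open>n\<close> hold the variables and survive;
  counters from \<open>n\<close> on are clear before and, apart from the result in \<open>n\<close>,
  clear again afterwards. This makes evaluations nestable.\<close>

definition evaluates :: "nat \<Rightarrow> ((nat \<Rightarrow> nat) \<Rightarrow> nat) \<Rightarrow> bool" where
  "evaluates n f \<longleftrightarrow> (\<exists>c. \<forall>\<sigma>. (\<forall>i\<ge>n. \<sigma> i = 0) \<longrightarrow> big c \<sigma> (\<sigma>(n := f \<sigma>)))"

lemma evaluatesI: "(\<And>\<sigma>. (\<forall>i\<ge>n. \<sigma> i = 0) \<Longrightarrow> big c \<sigma> (\<sigma>(n := f \<sigma>))) \<Longrightarrow> evaluates n f"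
  by (auto simp: evaluates_def)

lemma evaluates_zero: "evaluates n (\<lambda>_. 0)"
proof (rule evaluatesI)
  fix \<sigma> :: "nat \<Rightarrow> nat" assume "\<forall>i\<ge>n. \<sigma> i = 0"
  then have "\<sigma>(n := 0) = \<sigma>" by (auto simp: fun_eq_iff)
  then show "big Skip \<sigma> (\<sigma>(n := 0))" using Skip[of \<sigma>] by simp
qed

lemma evaluates_Suc: "evaluates n f \<Longrightarrow> evaluates n (\<lambda>\<sigma>. Suc (f \<sigma>))"
  unfolding evaluates_def
proof (elim exE)
  fix c assume *: "\<forall>\<sigma>::nat \<Rightarrow> nat. (\<forall>i\<ge>n. \<sigma> i = 0) \<longrightarrow> big c \<sigma> (\<sigma>(n := f \<sigma>))"
  show "\<exists>c. \<forall>\<sigma>. (\<forall>i\<ge>n. \<sigma> i = 0) \<longrightarrow> big c \<sigma> (\<sigma>(n := Suc (f \<sigma>)))"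
  proof (intro exI[of _ "Seq c (Inc n)"] allI impI)
    fix \<sigma> :: "nat \<Rightarrow> nat" assume "\<forall>i\<ge>n. \<sigma> i = 0"
    with * have "big c \<sigma> (\<sigma>(n := f \<sigma>))" by blast
    from Seq[OF this Inc[of n]] show "big (Seq c (Inc n)) \<sigma> (\<sigma>(n := Suc (f \<sigma>)))" by simp
  qed
qed

lemma evaluates_pred: "evaluates n f \<Longrightarrow> evaluates n (\<lambda>\<sigma>. f \<sigma> - 1)"
  unfolding evaluates_def
proof (elim exE)
  fix c assume *: "\<forall>\<sigma>::nat \<Rightarrow> nat. (\<forall>i\<ge>n. \<sigma> i = 0) \<longrightarrow> big c \<sigma> (\<sigma>(n := f \<sigma>))"
  show "\<exists>c. \<forall>\<sigma>. (\<forall>i\<ge>n. \<sigma> i = 0) \<longrightarrow> big c \<sigma> (\<sigma>(n := f \<sigma> - 1))"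
  proof (intro exI[of _ "Seq c (Dec n)"] allI impI)
    fix \<sigma> :: "nat \<Rightarrow> nat" assume "\<forall>i\<ge>n. \<sigma> i = 0"
    with * have "big c \<sigma> (\<sigma>(n := f \<sigma>))" by blast
    from Seq[OF this Dec[of n]] show "big (Seq c (Dec n)) \<sigma> (\<sigma>(n := f \<sigma> - 1))" by simp
  qed
qed

lemma big_copy:
  assumes "distinct [r, s, t]"
  shows "big (While r (Seq (Dec r) (Seq (Inc s) (Inc t)))) \<sigma> (\<sigma>(r := 0, s := \<sigma> s + \<sigma> r, t := \<sigma> t + \<sigma> r))"
proof (induction "\<sigma> r" arbitrary: \<sigma>)
  case 0
  then show ?case using While0[of \<sigma> r] by (simp add: fun_upd_idem)
next
  case (Suc n)
  let ?c = "Seq (Dec r) (Seq (Inc s) (Inc t))"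
  let ?\<tau> = "\<sigma>(r := \<sigma> r - 1, s := Suc (\<sigma> s), t := Suc (\<sigma> t))"
  have 1: "big ?c \<sigma> ?\<tau>"
    using Seq[OF Dec[of r \<sigma>] Seq[OF Inc[of s] Inc[of t]]] assms by simp
  have e: "?\<tau> r = n" using Suc assms by simp
  have "?\<tau>(r := 0, s := ?\<tau> s + ?\<tau> r, t := ?\<tau> t + ?\<tau> r) = \<sigma>(r := 0, s := \<sigma> s + \<sigma> r, t := \<sigma> t + \<sigma> r)"
    using assms Suc(2) by (auto simp: fun_eq_iff)
  with Suc(1)[of ?\<tau>, OF e[symmetric]] have "big (While r ?c) ?\<tau> (\<sigma>(r := 0, s := \<sigma> s + \<sigma> r, t := \<sigma> t + \<sigma> r))"
    by simp
  from WhileS[OF _ 1 this] show ?case using Suc by simp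
qed

text \<open>Reading a counter destroys it, so its value is drained into \<open>n\<close> and
  \<open>Suc n\<close> at once and then restored from \<open>Suc n\<close>.\<close>

lemma evaluates_var:
  assumes "i < n"
  shows "evaluates n (\<lambda>\<sigma>. \<sigma> i)"
proof (rule evaluatesI)
  fix \<sigma> :: "nat \<Rightarrow> nat" assume 0: "\<forall>i\<ge>n. \<sigma> i = 0"
  let ?\<tau> = "\<sigma>(i := 0, n := \<sigma> n + \<sigma> i, Suc n := \<sigma> (Suc n) + \<sigma> i)"
  have "?\<tau>(Suc n := 0, i := ?\<tau> i + ?\<tau> (Suc n)) = \<sigma>(n := \<sigma> i)"
    using assms 0 by (auto simp: fun_eq_iff)
  then show "big (Seq (While i (Seq (Dec i) (Seq (Inc n) (Inc (Suc n))))) (move_com (Suc n) i)) \<sigma> (\<sigma>(n := \<sigma> i))"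
    using Seq[OF big_copy[of i n "Suc n" \<sigma>] big_move[of "Suc n" i ?\<tau>]] assms by simp
qed

text \<open>The value of \<open>g\<close> becomes the new variable \<open>n\<close>,
  \<open>f\<close> is evaluated on top of it, and the result is moved down after \<open>n\<close>
  has been cleared.\<close>

lemma evaluates_let:
  assumes "evaluates n g" "evaluates (Suc n) f"
  shows "evaluates n (\<lambda>\<sigma>. f (\<sigma>(n := g \<sigma>)))"
proof -
  obtain c where c: "\<And>\<sigma>. (\<forall>i\<ge>n. \<sigma> i = 0) \<Longrightarrow> big c \<sigma> (\<sigma>(n := g \<sigma>))" using assms by (auto simp: evaluates_def)
  obtain d where d: "\<And>\<sigma>. (\<forall>i\<ge>Suc n. \<sigma> i = 0) \<Longrightarrow> big d \<sigma> (\<sigma>(Suc n := f \<sigma>))" using assms by (auto simp: evaluates_def)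
  show ?thesis
  proof (rule evaluatesI)
    fix \<sigma> :: "nat \<Rightarrow> nat" assume 0: "\<forall>i\<ge>n. \<sigma> i = 0"
    let ?v = "f (\<sigma>(n := g \<sigma>))"
    have 1: "big c \<sigma> (\<sigma>(n := g \<sigma>))" using c 0 by blast
    have 2: "big d (\<sigma>(n := g \<sigma>)) (\<sigma>(n := g \<sigma>, Suc n := ?v))"
      using d[of "\<sigma>(n := g \<sigma>)"] 0 by simp
    let ?\<tau> = "\<sigma>(n := g \<sigma>, Suc n := ?v)"
    have "(?\<tau>(n := 0))(Suc n := 0, n := (?\<tau>(n := 0)) n + (?\<tau>(n := 0)) (Suc n)) = \<sigma>(n := ?v)"
      using 0 by (auto simp: fun_eq_iff)
    then show "big (Seq c (Seq d (Seq (While n (Dec n)) (move_com (Suc n) n)))) \<sigma> (\<sigma>(n := ?v))"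
      using Seq[OF 1 Seq[OF 2 Seq[OF big_clear[of n ?\<tau>] big_move[of "Suc n" n "?\<tau>(n := 0)"]]]] by simp
  qed
qed

text \<open>Counter \<open>n\<close> holds the remaining rounds and \<open>Suc n\<close> the
  accumulator; each round evaluates into the next counter and moves the value down. The last two
  assumptions say that \<open>a\<close> and \<open>f\<close> do not look at the round counter, which
  changes during the loop.\<close>

lemma evaluates_iter:
  assumes "evaluates n k" "evaluates (Suc n) a" "evaluates (Suc (Suc n)) f"
    and a: "\<And>\<sigma> y. a (\<sigma>(n := y)) = a \<sigma>" and f: "\<And>\<sigma> y. f (\<sigma>(n := y)) = f \<sigma>"
  shows "evaluates n (\<lambda>\<sigma>. ((\<lambda>r. f (\<sigma>(Suc n := r))) ^^ k \<sigma>) (a \<sigma>))"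
proof -
  obtain c where c: "\<And>\<sigma>. (\<forall>i\<ge>n. \<sigma> i = 0) \<Longrightarrow> big c \<sigma> (\<sigma>(n := k \<sigma>))" using assms by (auto simp: evaluates_def)
  obtain d where d: "\<And>\<sigma>. (\<forall>i\<ge>Suc n. \<sigma> i = 0) \<Longrightarrow> big d \<sigma> (\<sigma>(Suc n := a \<sigma>))" using assms by (auto simp: evaluates_def)
  obtain e where e: "\<And>\<sigma>. (\<forall>i\<ge>Suc (Suc n). \<sigma> i = 0) \<Longrightarrow> big e \<sigma> (\<sigma>(Suc (Suc n) := f \<sigma>))" using assms by (auto simp: evaluates_def)
  define body where "body = Seq (Dec n) (Seq e (Seq (While (Suc n) (Dec (Suc n))) (move_com (Suc (Suc n)) (Suc n))))"
  show ?thesis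
  proof (rule evaluatesI)
    fix \<sigma> :: "nat \<Rightarrow> nat" assume 0: "\<forall>i\<ge>n. \<sigma> i = 0"
    define F where "F = (\<lambda>r. f (\<sigma>(Suc n := r)))"
    have loop: "big (While n body) (\<sigma>(n := m, Suc n := r)) (\<sigma>(n := 0, Suc n := (F ^^ m) r))" for m r
    proof (induction m arbitrary: r)
      case 0
      show ?case using While0[of "\<sigma>(n := 0, Suc n := r)" n body] by (simp add: fun_upd_def)
    next
      case (Suc m)
      let ?\<tau> = "\<sigma>(n := Suc m, Suc n := r)"
      let ?\<tau>' = "\<sigma>(n := m, Suc n := r)"
      have upd: "?\<tau>(n := ?\<tau> n - 1) = ?\<tau>'" by (auto simp: fun_eq_iff)
      have fF: "f ?\<tau>' = F r"
        using f[of "\<sigma>(Suc n := r)" m] by (simp add: F_def fun_upd_twist)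
      have 1: "big (Dec n) ?\<tau> ?\<tau>'" using Dec[of n ?\<tau>] upd by simp
      have 2: "big e ?\<tau>' (?\<tau>'(Suc (Suc n) := F r))"
        using e[of ?\<tau>'] 0 fF by simp
      let ?u = "(?\<tau>'(Suc (Suc n) := F r))(Suc n := 0)"
      have "?u(Suc (Suc n) := 0, Suc n := ?u (Suc n) + ?u (Suc (Suc n))) = \<sigma>(n := m, Suc n := F r)"
        using 0 by (auto simp: fun_eq_iff)
      then have 3: "big body ?\<tau> (\<sigma>(n := m, Suc n := F r))"
        unfolding body_def using Seq[OF 1 Seq[OF 2 Seq[OF big_clear big_move[of "Suc (Suc n)" "Suc n" ?u]]]]
        by simp
      have eq: "(F ^^ Suc m) r = (F ^^ m) (F r)" by (simp add: funpow_swap1)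
      show ?case unfolding eq by (rule WhileS[OF _ 3 Suc.IH]) simp
    qed
    have 1: "big c \<sigma> (\<sigma>(n := k \<sigma>))" using c 0 by blast
    have 2: "big d (\<sigma>(n := k \<sigma>)) (\<sigma>(n := k \<sigma>, Suc n := a \<sigma>))"
      using d[of "\<sigma>(n := k \<sigma>)"] 0 a by simp
    let ?v = "(F ^^ k \<sigma>) (a \<sigma>)"
    let ?u = "\<sigma>(n := 0, Suc n := ?v)"
    have "?u(Suc n := 0, n := ?u n + ?u (Suc n)) = \<sigma>(n := ?v)"
      using 0 by (auto simp: fun_eq_iff)
    then show "big (Seq c (Seq d (Seq (While n body) (move_com (Suc n) n)))) \<sigma>
        (\<sigma>(n := ((\<lambda>r. f (\<sigma>(Suc n := r))) ^^ k \<sigma>) (a \<sigma>)))"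
      using Seq[OF 1 Seq[OF 2 Seq[OF loop big_move[of "Suc n" n ?u]]]] by (simp add: F_def)
  qed
qed

section \<open>Computable functions on numbers and tuples\<close>

text \<open>The arguments may lie in arbitrary counters \<open>rs\<close> below \<open>n\<close>,
  possibly repeated, so a function can be applied under further local variables without moving its
  arguments.\<close>

definition compr :: "nat \<Rightarrow> (nat list \<Rightarrow> nat) \<Rightarrow> bool" where
  "compr k f \<longleftrightarrow> (\<forall>n rs. length rs = k \<and> set rs \<subseteq> {..<n} \<longrightarrow> evaluates n (\<lambda>\<sigma>. f (map \<sigma> rs)))"

lemma map_fun_upd_fresh: "set rs \<subseteq> {..<n::nat} \<Longrightarrow> n \<le> m \<Longrightarrow> map (\<sigma>(m := y)) rs = map \<sigma> rs"
  by (intro map_cong) (auto simp: subset_eq)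

lemma compr_cong: "compr k f \<Longrightarrow> (\<And>v. length v = k \<Longrightarrow> f v = g v) \<Longrightarrow> compr k g"
  by (simp add: compr_def)

lemma compr_zero: "compr k (\<lambda>_. 0)"
  by (simp add: compr_def evaluates_zero)

lemma compr_nth: "i < k \<Longrightarrow> compr k (\<lambda>v. v ! i)"
  by (auto simp: compr_def subset_iff intro!: evaluates_var)

lemma compr_Suc: "compr k f \<Longrightarrow> compr k (\<lambda>v. Suc (f v))"
  by (auto simp: compr_def intro: evaluates_Suc)

lemma compr_pred: "compr k f \<Longrightarrow> compr k (\<lambda>v. f v - 1)"
  unfolding compr_def using evaluates_pred by blast

text \<open>The accumulator is prepended as argument \<open>0\<close> and shifts the others by one,
  as in de Bruijn notation. Iteration with a computed bound is the only loop, so all functions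
  obtained are total.\<close>

lemma compr_iter:
  assumes "compr k c" "compr k a" "compr (Suc k) f"
  shows "compr k (\<lambda>v. ((\<lambda>r. f (r # v)) ^^ c v) (a v))"
  unfolding compr_def
proof (intro allI impI)
  fix n :: nat and rs assume *: "length rs = k \<and> set rs \<subseteq> {..<n}"
  have 1: "evaluates n (\<lambda>\<sigma>. c (map \<sigma> rs))" using assms(1) * by (auto simp: compr_def)
  have 2: "evaluates (Suc n) (\<lambda>\<sigma>. a (map \<sigma> rs))"
    using assms(2) * by (auto simp: compr_def subset_iff less_Suc_eq)
  have "length (Suc n # rs) = Suc k \<and> set (Suc n # rs) \<subseteq> {..<Suc (Suc n)}" using * by auto
  then have 3: "evaluates (Suc (Suc n)) (\<lambda>\<sigma>. f (map \<sigma> (Suc n # rs)))" using assms(3) unfolding compr_def by blast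
  have "evaluates n (\<lambda>\<sigma>. ((\<lambda>r. f (map (\<sigma>(Suc n := r)) (Suc n # rs))) ^^ c (map \<sigma> rs)) (a (map \<sigma> rs)))"
    using * by (intro evaluates_iter[OF 1 2 3]) (simp_all add: map_fun_upd_fresh[OF conjunct2[OF *]])
  then show "evaluates n (\<lambda>\<sigma>. ((\<lambda>r. f (r # map \<sigma> rs)) ^^ c (map \<sigma> rs)) (a (map \<sigma> rs)))"
    using * by (simp add: map_fun_upd_fresh[OF conjunct2[OF *]])
qed

lemma compr_comp1:
  assumes "compr k f" "compr 1 h"
  shows "compr k (\<lambda>v. h [f v])"
  unfolding compr_def
proof (intro allI impI)
  fix n :: nat and rs assume *: "length rs = k \<and> set rs \<subseteq> {..<n}"
  have 1: "evaluates n (\<lambda>\<sigma>. f (map \<sigma> rs))" using assms(1) * by (auto simp: compr_def)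
  have "length [n] = 1 \<and> set [n] \<subseteq> {..<Suc n}" by auto
  then have "evaluates (Suc n) (\<lambda>\<sigma>. h (map \<sigma> [n]))" using assms(2) unfolding compr_def by blast
  from evaluates_let[OF 1 this] show "evaluates n (\<lambda>\<sigma>. h [f (map \<sigma> rs)])" by simp
qed

lemma compr_comp2:
  assumes "compr k f" "compr k g" "compr 2 h"
  shows "compr k (\<lambda>v. h [f v, g v])"
  unfolding compr_def
proof (intro allI impI)
  fix n :: nat and rs assume *: "length rs = k \<and> set rs \<subseteq> {..<n}"
  have 1: "evaluates n (\<lambda>\<sigma>. f (map \<sigma> rs))" using assms(1) * by (auto simp: compr_def)
  have 2: "evaluates (Suc n) (\<lambda>\<sigma>. g (map \<sigma> rs))"
    using assms(2) * by (auto simp: compr_def subset_iff less_Suc_eq)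
  have "length [n, Suc n] = 2 \<and> set [n, Suc n] \<subseteq> {..<Suc (Suc n)}" by auto
  then have 3: "evaluates (Suc (Suc n)) (\<lambda>\<sigma>. h (map \<sigma> [n, Suc n]))"
    using assms(3) unfolding compr_def by blast
  from evaluates_let[OF 1 evaluates_let[OF 2 3]]
  show "evaluates n (\<lambda>\<sigma>. h [f (map \<sigma> rs), g (map \<sigma> rs)])" using * by (simp add: map_fun_upd_fresh[OF conjunct2[OF *]])
qed

section \<open>Pairing, bounded search and arithmetic\<close>

definition pair_code :: "nat \<Rightarrow> nat \<Rightarrow> nat" where
  "pair_code a b = (a + b) * (a + b) + a"

text \<open>Bounded minimisation, with the bound itself as value when nothing is found; so
  \<open>search n P < n\<close> expresses success. The body is an iteration in order to fit
  \<open>compr_iter\<close>.\<close>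

definition search :: "nat \<Rightarrow> (nat \<Rightarrow> bool) \<Rightarrow> nat" where
  "search n P = ((\<lambda>r. if P r then r else Suc r) ^^ n) 0"

lemma search_step: "search (Suc n) P = (if P (search n P) then search n P else Suc (search n P))"
  by (simp add: search_def)

lemma search_cases: "(P (search n P) \<or> search n P = n) \<and> (\<forall>j<search n P. \<not> P j) \<and> search n P \<le> n"
  by (induction n) (auto simp: search_step search_def[of 0] less_Suc_eq)

lemma search_eqI:
  assumes "j < n" "P j" "\<And>i. i < j \<Longrightarrow> \<not> P i"
  shows "search n P = j"
  using search_cases[of P n] assms by (cases "search n P" j rule: linorder_cases) auto

lemma search_found: "j < n \<Longrightarrow> P j \<Longrightarrow> P (search n P) \<and> search n P < n"
  using search_cases[of P n] by (cases "search n P" j rule: linorder_cases) auto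

definition isqrt :: "nat \<Rightarrow> nat" where
  "isqrt z = search (Suc z) (\<lambda>r. z < Suc r * Suc r)"

text \<open>The code lies between the squares of \<open>a + b\<close> and of
  \<open>a + b + 1\<close>, so the integer root recovers the sum. With this pairing tuples of zeros
  have code \<open>0\<close>, the content of fresh counters.\<close>

lemma isqrt_pair_code: "isqrt (pair_code a b) = a + b"
  unfolding isqrt_def
proof (rule search_eqI)
  show "a + b < Suc (pair_code a b)"
    by (cases "a + b") (auto simp: pair_code_def)
  show "pair_code a b < Suc (a + b) * Suc (a + b)" by (simp add: pair_code_def)
  fix i assume "i < a + b"
  then have "Suc i * Suc i \<le> (a + b) * (a + b)" by (intro mult_le_mono) auto
  then show "\<not> pair_code a b < Suc i * Suc i" by (simp add: pair_code_def del: mult_Suc mult_Suc_right)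
qed

definition pair_fst :: "nat \<Rightarrow> nat" where
  "pair_fst z = z - isqrt z * isqrt z"

definition pair_snd :: "nat \<Rightarrow> nat" where
  "pair_snd z = isqrt z - pair_fst z"

lemma pair_fst_code [simp]: "pair_fst (pair_code a b) = a"
  by (simp add: pair_fst_def isqrt_pair_code) (simp add: pair_code_def)

lemma pair_snd_code [simp]: "pair_snd (pair_code a b) = b"
  by (simp add: pair_snd_def isqrt_pair_code)

lemma compr_add: "compr k f \<Longrightarrow> compr k g \<Longrightarrow> compr k (\<lambda>v. f v + g v)"
proof -
  have eq: "((\<lambda>r. Suc r) ^^ n) m = n + m" for n m
    by (induction n) auto
  have "compr 2 (\<lambda>v. ((\<lambda>r. Suc ((r # v) ! 0)) ^^ (v ! 0)) (v ! 1))"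
    by (intro compr_iter compr_nth compr_Suc) auto
  then have "compr 2 (\<lambda>v. v ! 0 + v ! 1)"
    by (rule compr_cong) (use eq in simp)
  then show "compr k f \<Longrightarrow> compr k g \<Longrightarrow> compr k (\<lambda>v. f v + g v)"
    using compr_comp2[of k f g] by fastforce
qed

lemma compr_diff: "compr k f \<Longrightarrow> compr k g \<Longrightarrow> compr k (\<lambda>v. f v - g v)"
proof -
  have eq: "((\<lambda>r. r - 1) ^^ n) m = m - n" for n m :: nat
    by (induction n) auto
  have "compr 2 (\<lambda>v. ((\<lambda>r. (r # v) ! 0 - 1) ^^ (v ! 1)) (v ! 0))"
    by (intro compr_iter compr_nth compr_pred) auto
  then have "compr 2 (\<lambda>v. v ! 0 - v ! 1)"
    by (rule compr_cong) (use eq in simp)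
  then show "compr k f \<Longrightarrow> compr k g \<Longrightarrow> compr k (\<lambda>v. f v - g v)"
    using compr_comp2[of k f g] by fastforce
qed

lemma compr_mult: "compr k f \<Longrightarrow> compr k g \<Longrightarrow> compr k (\<lambda>v. f v * g v)"
proof -
  have eq: "((\<lambda>r. r + m) ^^ n) 0 = n * m" for n m :: nat
    by (induction n) auto
  have "compr 2 (\<lambda>v. ((\<lambda>r. (r # v) ! 0 + (r # v) ! 2) ^^ (v ! 0)) 0)"
    by (intro compr_iter compr_nth compr_add compr_zero) auto
  then have "compr 2 (\<lambda>v. v ! 0 * v ! 1)"
    by (rule compr_cong) (simp add: eq numeral_2_eq_2)
  then show "compr k f \<Longrightarrow> compr k g \<Longrightarrow> compr k (\<lambda>v. f v * g v)"
    using compr_comp2[of k f g] by fastforce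
qed

lemma compr_const: "compr k (\<lambda>_. c)"
  by (induction c) (auto intro: compr_zero compr_Suc)

text \<open>Both branches are evaluated, and one is selected by factors \<open>0\<close> and
  \<open>1\<close> built with truncated subtraction.\<close>

lemma compr_if0:
  assumes "compr k b" "compr k f" "compr k g"
  shows "compr k (\<lambda>v. if b v = 0 then f v else g v)"
proof -
  have "compr k (\<lambda>v. (1 - b v) * f v + (1 - (1 - b v)) * g v)"
    by (intro compr_add compr_mult compr_diff compr_const assms)
  then show ?thesis by (rule compr_cong) auto
qed

lemma compr_search:
  assumes "compr k n" "compr (Suc k) P"
  shows "compr k (\<lambda>v. search (n v) (\<lambda>r. P (r # v) \<noteq> 0))"
proof -
  have "compr k (\<lambda>v. ((\<lambda>r. if P (r # v) = 0 then Suc ((r # v) ! 0) else (r # v) ! 0) ^^ n v) 0)"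
    by (intro compr_iter[where f = "\<lambda>v. if P v = 0 then Suc (v ! 0) else v ! 0"]
          assms compr_zero compr_if0 compr_Suc compr_nth) auto
  moreover have "(\<lambda>r. if P (r # v) = 0 then Suc ((r # v) ! 0) else (r # v) ! 0)
      = (\<lambda>r. if P (r # v) \<noteq> 0 then r else Suc r)" for v
    by auto
  ultimately show ?thesis by (simp add: search_def cong: if_cong)
qed

lemma compr_isqrt: "compr k f \<Longrightarrow> compr k (\<lambda>v. isqrt (f v))"
proof -
  have "compr 1 (\<lambda>v. search (Suc (v ! 0)) (\<lambda>r. Suc ((r # v) ! 0) * Suc ((r # v) ! 0) - (r # v) ! 1 \<noteq> 0))"
    by (intro compr_search[where P = "\<lambda>v. Suc (v ! 0) * Suc (v ! 0) - v ! 1"]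
          compr_Suc compr_nth compr_diff compr_mult) auto
  then have "compr 1 (\<lambda>v. isqrt (v ! 0))"
    unfolding isqrt_def by (rule compr_cong) (simp add: not_le)
  then show "compr k f \<Longrightarrow> compr k (\<lambda>v. isqrt (f v))"
    using compr_comp1[of k f] by fastforce
qed

lemma compr_pair: "compr k f \<Longrightarrow> compr k g \<Longrightarrow> compr k (\<lambda>v. pair_code (f v) (g v))"
  unfolding pair_code_def by (intro compr_add compr_mult)

lemma compr_pair_fst: "compr k f \<Longrightarrow> compr k (\<lambda>v. pair_fst (f v))"
  unfolding pair_fst_def by (intro compr_diff compr_mult compr_isqrt)

lemma compr_pair_snd: "compr k f \<Longrightarrow> compr k (\<lambda>v. pair_snd (f v))"
  unfolding pair_snd_def by (intro compr_diff compr_isqrt compr_pair_fst)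

section \<open>Computable functions between encoded types\<close>

class enc =
  fixes enc :: "'a \<Rightarrow> nat"

instantiation nat :: enc begin
definition enc_eq_nat [simp]: "enc (n::nat) = n"
instance ..
end

instantiation bool :: enc begin
definition enc_eq_bool [simp]: "enc (b::bool) = of_bool b"
instance ..
end

instantiation prod :: (enc, enc) enc begin
definition enc_eq_prod [simp]: "enc (p :: 'a \<times> 'b) = pair_code (enc (fst p)) (enc (snd p))"
instance ..
end

text \<open>Types serve only to write algorithms with tuples and truth values; the computation is on
  codes. The closure rules collected in \<open>cmp_intros\<close> derive computability from the
  syntax of a definition.\<close>

definition cmp :: "('a::enc \<Rightarrow> 'b::enc) \<Rightarrow> bool" where
  "cmp f \<longleftrightarrow> (\<exists>g. compr 1 g \<and> (\<forall>x. g [enc x] = enc (f x)))"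

named_theorems cmp_intros

lemma cmpI: "compr 1 g \<Longrightarrow> (\<And>x. g [enc x] = enc (f x)) \<Longrightarrow> cmp f"
  by (auto simp: cmp_def)

lemma cmp_comp:
  assumes "cmp f" "cmp g" shows "cmp (\<lambda>x. f (g x))"
proof -
  obtain a b where "compr 1 a" "\<And>x. a [enc x] = enc (f x)" "compr 1 b" "\<And>x. b [enc x] = enc (g x)"
    using assms unfolding cmp_def by metis
  then show ?thesis by (intro cmpI[OF compr_comp1[of 1 b a]]) auto
qed

lemma cmp_id [cmp_intros]: "cmp (\<lambda>x. x)"
  by (rule cmpI[OF compr_nth[of 0 1]]) auto

lemma cmp_const [cmp_intros]: "cmp (\<lambda>_. c)"
  by (rule cmpI[OF compr_const]) auto

lemma cmp_op1:
  assumes "cmp f" "\<And>k g. compr k g \<Longrightarrow> compr k (\<lambda>v. h (g v))" "\<And>x. h (enc (f x)) = enc (F x)"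
  shows "cmp F"
proof -
  obtain a where "compr 1 a" "\<And>x. a [enc x] = enc (f x)" using assms unfolding cmp_def by metis
  then show ?thesis using assms by (intro cmpI[OF assms(2)[of 1 a]]) auto
qed

lemma cmp_op2:
  assumes "cmp f" "cmp g" "\<And>k f g. compr k f \<Longrightarrow> compr k g \<Longrightarrow> compr k (\<lambda>v. h (f v) (g v))"
    "\<And>x. h (enc (f x)) (enc (g x)) = enc (F x)"
  shows "cmp F"
proof -
  obtain a b where "compr 1 a" "\<And>x. a [enc x] = enc (f x)" "compr 1 b" "\<And>x. b [enc x] = enc (g x)"
    using assms unfolding cmp_def by metis
  then show ?thesis using assms by (intro cmpI[OF assms(3)[of 1 a b]]) auto
qed

lemma cmp_fst [cmp_intros]: "cmp f \<Longrightarrow> cmp (\<lambda>x. fst (f x))"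
  by (erule cmp_op1[OF _ compr_pair_fst]) auto

lemma cmp_snd [cmp_intros]: "cmp f \<Longrightarrow> cmp (\<lambda>x. snd (f x))"
  by (erule cmp_op1[OF _ compr_pair_snd]) auto

lemma cmp_Pair [cmp_intros]: "cmp f \<Longrightarrow> cmp g \<Longrightarrow> cmp (\<lambda>x. (f x, g x))"
  by (erule (1) cmp_op2[OF _ _ compr_pair]) auto

lemma cmp_add [cmp_intros]: "cmp f \<Longrightarrow> cmp g \<Longrightarrow> cmp (\<lambda>x. f x + g x :: nat)"
  by (erule (1) cmp_op2[OF _ _ compr_add]) auto

lemma cmp_Suc [cmp_intros]: "cmp f \<Longrightarrow> cmp (\<lambda>x. Suc (f x))"
  by (erule cmp_op1[OF _ compr_Suc]) auto

lemma cmp_diff [cmp_intros]: "cmp f \<Longrightarrow> cmp g \<Longrightarrow> cmp (\<lambda>x. f x - g x :: nat)"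
  by (erule (1) cmp_op2[OF _ _ compr_diff]) auto

lemma cmp_mult [cmp_intros]: "cmp f \<Longrightarrow> cmp g \<Longrightarrow> cmp (\<lambda>x. f x * g x :: nat)"
  by (erule (1) cmp_op2[OF _ _ compr_mult]) auto

lemma cmp_of_bool [cmp_intros]: "cmp f \<Longrightarrow> cmp (\<lambda>x. of_bool (f x) :: nat)"
  by (auto simp: cmp_def)

lemma cmp_le [cmp_intros]:
  fixes f g :: "'a::enc \<Rightarrow> nat"
  assumes "cmp f" "cmp g" shows "cmp (\<lambda>x. f x \<le> g x)"
proof (rule cmp_op2[where h = "\<lambda>a b. 1 - (a - b)", OF assms])
  show "1 - (enc (f x) - enc (g x)) = enc (f x \<le> g x)" for x
    by (cases "f x \<le> g x") auto
qed (intro compr_diff compr_const)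

lemma cmp_not [cmp_intros]: "cmp f \<Longrightarrow> cmp (\<lambda>x. \<not> f x)"
proof (erule cmp_op1)
  show "compr k (\<lambda>v. 1 - f v)" if "compr k f" for k f
    by (intro compr_diff compr_const that)
qed auto

lemma cmp_conj [cmp_intros]:
  assumes "cmp f" "cmp g" shows "cmp (\<lambda>x. f x \<and> g x)"
  by (rule cmp_op2[where h = "(*)", OF assms compr_mult]) auto

lemma cmp_less [cmp_intros]: "cmp f \<Longrightarrow> cmp g \<Longrightarrow> cmp (\<lambda>x. f x < (g x :: nat))"
  using cmp_not[OF cmp_le[of g f]] by (simp add: not_le)

lemma cmp_eq [cmp_intros]: "cmp f \<Longrightarrow> cmp g \<Longrightarrow> cmp (\<lambda>x. f x = (g x :: nat))"
  using cmp_conj[OF cmp_le[of f g] cmp_le[of g f]] by (simp add: eq_iff)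

lemma cmp_if [cmp_intros]:
  assumes "cmp b" "cmp f" "cmp g" shows "cmp (\<lambda>x. if b x then f x else g x)"
proof -
  obtain a where a: "compr 1 a" "\<And>x. a [enc x] = enc (b x)" using assms(1) unfolding cmp_def by metis
  obtain c where c: "compr 1 c" "\<And>x. c [enc x] = enc (f x)" using assms(2) unfolding cmp_def by metis
  obtain d where d: "compr 1 d" "\<And>x. d [enc x] = enc (g x)" using assms(3) unfolding cmp_def by metis
  show ?thesis by (rule cmpI[OF compr_if0[OF a(1) d(1) c(1)]]) (auto simp: a c d)
qed

lemma cmp_funpow:
  fixes f :: "'a::enc \<Rightarrow> 'b::enc \<Rightarrow> 'b"
  assumes n: "cmp n" and a: "cmp a" and f: "cmp (\<lambda>p. f (fst p) (snd p))"
  shows "cmp (\<lambda>x. (f x ^^ n x) (a x))"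
proof -
  obtain n' where n': "compr 1 n'" "\<And>x. n' [enc x] = enc (n x)" using n unfolding cmp_def by metis
  obtain a' where a': "compr 1 a'" "\<And>x. a' [enc x] = enc (a x)" using a unfolding cmp_def by metis
  obtain f' where f': "compr 1 f'" "\<And>p. f' [enc p] = enc (f (fst p) (snd p))" using f unfolding cmp_def by metis
  have f'': "f' [pair_code (enc x) (enc y)] = enc (f x y)" for x y using f'(2)[of "(x, y)"] by simp
  have "compr 1 (\<lambda>v. ((\<lambda>r. f' [pair_code ((r # v) ! 1) ((r # v) ! 0)]) ^^ n' v) (a' v))"
    by (intro compr_iter[where f = "\<lambda>v. f' [pair_code (v ! 1) (v ! 0)]"] n' a' compr_comp1 f' compr_pair compr_nth) auto
  moreover have "((\<lambda>r. f' [pair_code (enc x) r]) ^^ k) (enc y) = enc ((f x ^^ k) y)" for x y k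
    by (induction k) (auto simp: f'')
  ultimately show ?thesis by (intro cmpI) (auto simp: n' a')
qed

lemma cmp_rec_nat [cmp_intros]:
  assumes n: "cmp n" and a: "cmp a" and f: "cmp (\<lambda>p. f (fst p) (fst (snd p)) (snd (snd p)))"
  shows "cmp (\<lambda>x. rec_nat (a x) (\<lambda>i r. f x i r) (n x))"
proof -
  \<comment> \<open>An iteration has no access to its index, so the index is carried along in the
    state.\<close>
  let ?F = "\<lambda>x p. (Suc (fst p), f x (fst p) (snd p))"
  have "cmp (\<lambda>x. snd ((?F x ^^ n x) (0, a x)))"
    by (intro cmp_intros cmp_funpow n a f)
  moreover have "(?F x ^^ k) (0, a x) = (k, rec_nat (a x) (\<lambda>i r. f x i r) k)" for x k
    by (induction k) auto
  ultimately show ?thesis by simp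
qed

lemma sum_rec_nat: "(\<Sum>i<n. f i) = rec_nat 0 (\<lambda>i r. r + f i) n"
  by (induction n) auto

lemma cmp_sum [cmp_intros]:
  fixes f :: "'a::enc \<Rightarrow> nat \<Rightarrow> nat"
  assumes "cmp n" "cmp (\<lambda>p. f (fst p) (snd p))"
  shows "cmp (\<lambda>x. \<Sum>i<n x. f x i :: nat)"
proof -
  have "cmp (\<lambda>p. f (fst p) (fst (snd p)))"
    using cmp_comp[OF assms(2), of "\<lambda>p. (fst p, fst (snd p))"] by (simp add: cmp_intros)
  then have "cmp (\<lambda>x. rec_nat 0 (\<lambda>i r. r + f x i) (n x))" by (intro cmp_intros assms)
  then show ?thesis by (simp add: sum_rec_nat)
qed

lemma cmp_ex_less [cmp_intros]:
  fixes P :: "'a::enc \<Rightarrow> nat \<Rightarrow> bool"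
  assumes "cmp n" "cmp (\<lambda>p. P (fst p) (snd p))"
  shows "cmp (\<lambda>x. \<exists>i<n x. P x i)"
proof -
  have "(\<exists>i<n x. P x i) \<longleftrightarrow> 0 < (\<Sum>i<n x. of_bool (P x i) :: nat)" for x
    by (auto simp: sum_eq_0_iff[of "{..<n x}"] neq0_conv[symmetric])
  then show ?thesis by (simp only:) (intro cmp_intros assms)
qed

lemma cmp_all_less [cmp_intros]:
  fixes P :: "'a::enc \<Rightarrow> nat \<Rightarrow> bool"
  assumes "cmp n" "cmp (\<lambda>p. P (fst p) (snd p))"
  shows "cmp (\<lambda>x. \<forall>i<n x. P x i)"
  using cmp_not[OF cmp_ex_less[OF assms(1) cmp_not[OF assms(2)]]] by simp

lemma cmp_search [cmp_intros]:
  assumes "cmp n" "cmp (\<lambda>p. P (fst p) (snd p))"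
  shows "cmp (\<lambda>x. search (n x) (P x))"
  unfolding search_def
  by (rule cmp_funpow) (intro cmp_intros assms)+

lemma cmp_power [cmp_intros]:
  assumes "cmp f" "cmp n" shows "cmp (\<lambda>x. f x ^ n x :: nat)"
proof -
  have "cmp (\<lambda>x. ((\<lambda>r. f x * r) ^^ n x) 1)"
    by (rule cmp_funpow) (intro cmp_intros assms cmp_comp[OF assms(1)])+
  moreover have "((\<lambda>r. f x * r) ^^ k) 1 = f x ^ k" for x k
    by (induction k) auto
  ultimately show ?thesis by simp
qed

lemma fact_rec_nat: "fact n = (rec_nat 1 (\<lambda>i r. r * Suc i) n :: nat)"
  by (induction n) auto

lemma cmp_fact [cmp_intros]: "cmp n \<Longrightarrow> cmp (\<lambda>x. fact (n x) :: nat)"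
  unfolding fact_rec_nat by (intro cmp_intros)

lemma div_eq_search: "m div n = (if n = 0 then 0 else search (Suc m) (\<lambda>q. m < Suc q * n))" for m n :: nat
proof (cases "n = 0")
  case False
  have "search (Suc m) (\<lambda>q. m < Suc q * n) = m div n"
  proof (rule search_eqI)
    show "m div n < Suc m" by (simp add: div_le_dividend le_imp_less_Suc)
    show "m < Suc (m div n) * n" using False dividend_less_div_times[of n m] by simp
    fix i assume "i < m div n"
    then have "Suc i * n \<le> m" using less_eq_div_iff_mult_less_eq[of n "Suc i" m] False by auto
    then show "\<not> m < Suc i * n" by simp
  qed
  with False show ?thesis by simp
qed auto

lemma cmp_div [cmp_intros]:
  assumes "cmp f" "cmp g" shows "cmp (\<lambda>x. f x div g x :: nat)"
  unfolding div_eq_search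
  by (intro cmp_intros assms cmp_comp[OF assms(1) cmp_fst] cmp_comp[OF assms(2) cmp_fst])

lemma cmp_mod [cmp_intros]: "cmp f \<Longrightarrow> cmp g \<Longrightarrow> cmp (\<lambda>x. f x mod g x :: nat)"
  unfolding modulo_nat_def by (intro cmp_intros)

lemma cmp_min [cmp_intros]: "cmp f \<Longrightarrow> cmp g \<Longrightarrow> cmp (\<lambda>x. min (f x) (g x) :: nat)"
  unfolding min_def by (intro cmp_intros)

section \<open>Rationals as triples of naturals, and computable rational-valued functions\<close>

definition rval :: "nat \<times> nat \<times> nat \<Rightarrow> real" where
  "rval t = (real (fst t) - real (fst (snd t))) / real (Suc (snd (snd t)))"

text \<open>Denominators are stored diminished by one, hence the correction \<open>- 1\<close> in
  their product.\<close>

definition radd :: "nat \<times> nat \<times> nat \<Rightarrow> nat \<times> nat \<times> nat \<Rightarrow> nat \<times> nat \<times> nat" where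
  "radd s t = (fst s * Suc (snd (snd t)) + fst t * Suc (snd (snd s)),
     fst (snd s) * Suc (snd (snd t)) + fst (snd t) * Suc (snd (snd s)),
     Suc (snd (snd s)) * Suc (snd (snd t)) - 1)"

definition rmul :: "nat \<times> nat \<times> nat \<Rightarrow> nat \<times> nat \<times> nat \<Rightarrow> nat \<times> nat \<times> nat" where
  "rmul s t = (fst s * fst t + fst (snd s) * fst (snd t), fst s * fst (snd t) + fst (snd s) * fst t,
     Suc (snd (snd s)) * Suc (snd (snd t)) - 1)"

lemma rval_radd: "rval (radd s t) = rval s + rval t"
  by (cases s; cases t) (simp add: rval_def radd_def add_divide_eq_iff divide_add_eq_iff, simp add: field_simps)

lemma rval_rmul: "rval (rmul s t) = rval s * rval t"
  by (cases s; cases t) (simp add: rval_def rmul_def, simp add: field_simps)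

lemma cmp_radd [cmp_intros]: "cmp f \<Longrightarrow> cmp g \<Longrightarrow> cmp (\<lambda>x. radd (f x) (g x))"
  unfolding radd_def by (intro cmp_intros)

lemma cmp_rmul [cmp_intros]: "cmp f \<Longrightarrow> cmp g \<Longrightarrow> cmp (\<lambda>x. rmul (f x) (g x))"
  unfolding rmul_def by (intro cmp_intros)

text \<open>Real-valued expressions that take rational values computably. Formulas of the analysis
  can thus serve as algorithms without a separate rational version.\<close>

definition crat :: "('a::enc \<Rightarrow> real) \<Rightarrow> bool" where
  "crat f \<longleftrightarrow> (\<exists>t. cmp t \<and> (\<forall>x. f x = rval (t x)))"

lemma cratI: "cmp t \<Longrightarrow> (\<And>x. f x = rval (t x)) \<Longrightarrow> crat f"
  by (auto simp: crat_def)

lemma crat_nat [cmp_intros]: "cmp f \<Longrightarrow> crat (\<lambda>x. real (f x))"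
  by (rule cratI[of "\<lambda>x. (f x, 0, 0)"]) (auto simp: rval_def intro!: cmp_intros)

lemma crat_numeral [cmp_intros]: "crat (\<lambda>_. numeral w)" "crat (\<lambda>_. 0)" "crat (\<lambda>_. 1)"
  using crat_nat[OF cmp_const, of "numeral w"] crat_nat[OF cmp_const, of 0] crat_nat[OF cmp_const, of 1]
  by simp_all

lemma crat_add [cmp_intros]: "crat f \<Longrightarrow> crat g \<Longrightarrow> crat (\<lambda>x. f x + g x)"
  unfolding crat_def by (metis (no_types) cmp_radd rval_radd)

lemma crat_mult [cmp_intros]: "crat f \<Longrightarrow> crat g \<Longrightarrow> crat (\<lambda>x. f x * g x)"
  unfolding crat_def by (metis (no_types) cmp_rmul rval_rmul)

lemma crat_uminus [cmp_intros]: "crat f \<Longrightarrow> crat (\<lambda>x. - f x)"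
proof -
  assume "crat f"
  then obtain t where t: "cmp t" "\<And>x. f x = rval (t x)" by (auto simp: crat_def)
  show ?thesis
    by (rule cratI[of "\<lambda>x. (fst (snd (t x)), fst (t x), snd (snd (t x)))"])
      (use t in \<open>auto intro!: cmp_intros simp: rval_def field_simps\<close>)
qed

lemma crat_diff [cmp_intros]: "crat f \<Longrightarrow> crat g \<Longrightarrow> crat (\<lambda>x. f x - g x)"
  using crat_add[OF _ crat_uminus, of f g] by simp

lemma crat_inverse_nat:
  assumes "cmp n" shows "crat (\<lambda>x. 1 / real (n x))"
proof (rule cratI)
  \<comment> \<open>Division by zero yields \<open>0\<close>, hence the numerator \<open>0\<close>
    in that case.\<close>
  show "cmp (\<lambda>x. (if n x = 0 then 0 else 1::nat, 0::nat, n x - 1))"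
    by (intro cmp_intros assms)
qed (auto simp: rval_def)

lemma crat_divide_nat [cmp_intros]: "crat f \<Longrightarrow> cmp n \<Longrightarrow> crat (\<lambda>x. f x / real (n x))"
  using crat_mult[OF _ crat_inverse_nat, of f n] by simp

lemma crat_if [cmp_intros]: "cmp b \<Longrightarrow> crat f \<Longrightarrow> crat g \<Longrightarrow> crat (\<lambda>x. if b x then f x else g x)"
proof -
  assume b: "cmp b" and "crat f" "crat g"
  then obtain s t where "cmp t" "\<And>x. f x = rval (t x)" "cmp s" "\<And>x. g x = rval (s x)" unfolding crat_def by metis
  then show ?thesis by (intro cratI[of "\<lambda>x. if b x then t x else s x"] cmp_intros b) auto
qed

lemma crat_sum [cmp_intros]:
  fixes f :: "'a::enc \<Rightarrow> nat \<Rightarrow> real"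
  assumes n: "cmp n" and f: "crat (\<lambda>p. f (fst p) (snd p))"
  shows "crat (\<lambda>x. \<Sum>i<n x. f x i)"
proof -
  obtain t where t: "cmp t" "\<And>p. f (fst p) (snd p) = rval (t p)" using f unfolding crat_def by metis
  have t': "rval (t (x, i)) = f x i" for x i using t(2)[of "(x, i)"] by simp
  show ?thesis
  proof (rule cratI)
    show "cmp (\<lambda>x. rec_nat (0, 0, 0) (\<lambda>i r. radd r (t (x, i))) (n x))"
      by (intro cmp_intros n cmp_comp[OF t(1)])
    have "(\<Sum>i<k. f x i) = rval (rec_nat (0, 0, 0) (\<lambda>i r. radd r (t (x, i))) k)" for x k
      by (induction k) (auto simp: rval_radd t' rval_def[of "(0, 0, 0)"])
    then show "(\<Sum>i<n x. f x i) = rval (rec_nat (0, 0, 0) (\<lambda>i r. radd r (t (x, i))) (n x))" for x .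
  qed
qed

lemma crat_power [cmp_intros]:
  assumes f: "crat f" and n: "cmp n" shows "crat (\<lambda>x. f x ^ n x)"
proof -
  obtain t where t: "cmp t" "\<And>x. f x = rval (t x)" using f unfolding crat_def by metis
  show ?thesis
  proof (rule cratI)
    show "cmp (\<lambda>x. rec_nat (1, 0, 0) (\<lambda>i r. rmul r (t x)) (n x))"
      by (intro cmp_intros n cmp_comp[OF t(1)])
    have "f x ^ k = rval (rec_nat (1, 0, 0) (\<lambda>i r. rmul r (t x)) k)" for x k
      by (induction k) (auto simp: rval_rmul t(2) rval_def[of "(Suc 0, 0, 0)"])
    then show "f x ^ n x = rval (rec_nat (1, 0, 0) (\<lambda>i r. rmul r (t x)) (n x))" for x .
  qed
qed

lemma cmp_le_real [cmp_intros]: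
  assumes "crat f" "crat g" shows "cmp (\<lambda>x. f x \<le> g x)"
proof -
  obtain s t where t: "cmp t" "\<And>x. f x = rval (t x)" "cmp s" "\<And>x. g x = rval (s x)"
    using assms unfolding crat_def by metis
  \<comment> \<open>Cross-multiplied, with the subtracted parts moved to the other side, the
    inequality is one between naturals.\<close>
  have "f x \<le> g x \<longleftrightarrow> fst (t x) * Suc (snd (snd (s x))) + fst (snd (s x)) * Suc (snd (snd (t x)))
      \<le> fst (s x) * Suc (snd (snd (t x))) + fst (snd (t x)) * Suc (snd (snd (s x)))" for x
  proof -
    have "(a - b) / real (Suc c) \<le> (a' - b') / real (Suc c') \<longleftrightarrow>
      a * real (Suc c') + b' * real (Suc c) \<le> a' * real (Suc c) + b * real (Suc c')" for a b c a' b' c'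
      by (simp add: divide_le_eq le_divide_eq field_simps)
    then show ?thesis
      unfolding t rval_def by (simp only: of_nat_le_iff[symmetric, where 'a=real] of_nat_add of_nat_mult)
  qed
  then show ?thesis by (simp only:) (intro cmp_intros t)
qed

lemma cmp_less_real [cmp_intros]: "crat f \<Longrightarrow> crat g \<Longrightarrow> cmp (\<lambda>x. f x < g x)"
  using cmp_not[OF cmp_le_real[of g f]] by (simp add: not_le)

lemma crat_max [cmp_intros]: "crat f \<Longrightarrow> crat g \<Longrightarrow> crat (\<lambda>x. max (f x) (g x))"
  unfolding max_def by (intro cmp_intros)

section \<open>Transducers\<close>

text \<open>
  Depending on the scanned input bit and the current state, a transducer issues one of the actions
  \<open>0\<close> (nothing), \<open>1\<close> and \<open>2\<close> (write a bit) and \<open>3\<close> (advance the input head).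
\<close>

definition tstep :: "(bool \<times> 'a \<Rightarrow> nat \<times> 'a) \<Rightarrow> (nat \<Rightarrow> bool) \<Rightarrow> 'a \<times> nat \<times> bool list \<Rightarrow> 'a \<times> nat \<times> bool list" where
  "tstep F x c = (case c of (s, i, w) \<Rightarrow> case F (x i, s) of (a, s') \<Rightarrow>
     (s', if a = 3 then Suc i else i, w @ (if a = 1 then [False] else if a = 2 then [True] else [])))"

lemma reach_step:
  "fst c < length P \<Longrightarrow> reach P x (exec (P ! fst c) x c) d \<Longrightarrow> reach P x c d"
  by (rule converse_rtranclp_into_rtranclp) (auto simp: cstep_def)

text \<open>The program loops forever: counter \<open>0\<close> carries the code of the state,
  \<open>1\<close> receives the scanned bit, \<open>2\<close> the action and \<open>3\<close> the
  new state. As all counters start at \<open>0\<close>, the code of \<open>s0\<close> has to be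
  \<open>0\<close>. The conclusion says that each output of the transducer occurs at some time;
  since written words only grow, this determines the limit.\<close>

theorem transducer_machine:
  fixes F :: "bool \<times> 'a::enc \<Rightarrow> nat \<times> 'a"
  assumes F: "cmp F" and act: "\<And>p. fst (F p) \<le> 3" and s0: "enc s0 = 0"
  shows "\<exists>M. valid_machine M \<and>
    (\<forall>x n. \<exists>m. written (run M x m) = snd (snd ((tstep F x ^^ n) (s0, 0, []))))"
proof -
  obtain g where g: "compr 1 g" "\<And>p. g [enc p] = enc (F p)" using F unfolding cmp_def by metis
  have "compr 2 (\<lambda>v. pair_fst (g [pair_code (v ! 1) (v ! 0)]))" (is "compr 2 ?A")
    "compr 2 (\<lambda>v. pair_snd (g [pair_code (v ! 1) (v ! 0)]))" (is "compr 2 ?B")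
    by (intro compr_pair_fst compr_pair_snd compr_comp1 g compr_pair compr_nth; simp)+
  moreover have "length [0, 1] = (2::nat)" "set [0, 1] \<subseteq> {..<(2::nat)}" "set [0, 1] \<subseteq> {..<(3::nat)}" by auto
  ultimately have AB: "evaluates 2 (\<lambda>\<sigma>. ?A (map \<sigma> [0, 1]))" "evaluates 3 (\<lambda>\<sigma>. ?B (map \<sigma> [0, 1]))"
    unfolding compr_def by blast+
  obtain cA where cA: "\<And>\<sigma>. (\<forall>i\<ge>2. \<sigma> i = 0) \<Longrightarrow> big cA \<sigma> (\<sigma>(2 := pair_fst (g [pair_code (\<sigma> 1) (\<sigma> 0)])))"
    using AB(1) by (auto simp: evaluates_def)
  obtain cB where cB: "\<And>\<sigma>. (\<forall>i\<ge>3. \<sigma> i = 0) \<Longrightarrow> big cB \<sigma> (\<sigma>(3 := pair_snd (g [pair_code (\<sigma> 1) (\<sigma> 0)])))"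
    using AB(2) by (auto simp: evaluates_def)
  \<comment> \<open>Action and new state are both computed from the old counters \<open>0\<close>
    and \<open>1\<close>, which are cleared only afterwards.\<close>
  define C where "C = Seq cA (Seq cB (Seq (While 0 (Dec 0)) (Seq (While 1 (Dec 1)) (move_com 3 0))))"
  define a where "a = 2 + length (code 2 C)"
  \<comment> \<open>Dispatch on the action by successive zero tests and decrements; every branch
    leaves counter \<open>2\<close> at \<open>0\<close> and jumps back to the start.\<close>
  define tail where "tail = [JZ 2 0, DEC 2, JZ 2 (a + 6), DEC 2, JZ 2 (a + 8), JMP (a + 10),
    OUT False, JMP 0, OUT True, JMP 0, DEC 2, ADV, JMP 0]"
  define P where "P = [JF 2, INC 1] @ code 2 C @ tail"
  define reg :: "nat \<Rightarrow> nat \<Rightarrow> nat" where "reg s = (\<lambda>_. 0)(0 := s)" for s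
  have "code_at P 0 P" by (auto simp: code_at_def)
  then have "code_at P 0 ([JF 2, INC 1] @ code 2 C @ tail)" by (simp add: P_def)
  then have P0: "P ! 0 = JF 2" "P ! 1 = INC 1" and CC: "code_at P 2 (code 2 C)" and CT: "code_at P a tail"
    by (simp_all add: code_at_Cons a_def numeral_2_eq_2 del: append.simps)
  have len: "length P = a + 13" by (simp add: P_def tail_def a_def)
  have fetch: "P ! a = JZ 2 0" "P ! Suc a = DEC 2" "P ! Suc (Suc a) = JZ 2 (a + 6)" "P ! (a + 3) = DEC 2"
    "P ! (a + 4) = JZ 2 (a + 8)" "P ! (a + 5) = JMP (a + 10)" "P ! (a + 6) = OUT False" "P ! (a + 7) = JMP 0"
    "P ! (a + 8) = OUT True" "P ! (a + 9) = JMP 0" "P ! (a + 10) = DEC 2" "P ! (a + 11) = ADV" "P ! (a + 12) = JMP 0"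
    using CT by (auto simp: tail_def code_at_Cons eval_nat_numeral)
  have Suc_a: "Suc (Suc (Suc a)) = a + 3" "Suc (a + 3) = a + 4" "Suc (a + 4) = a + 5"
    "Suc (a + 6) = a + 7" "Suc (a + 8) = a + 9" "Suc (a + 10) = a + 11" "Suc (a + 11) = a + 12"
    by simp_all
  have big: "big C ((reg s)(1 := b)) ((reg (pair_snd (g [pair_code b s])))(2 := pair_fst (g [pair_code b s])))" for s b
  proof -
    let ?\<sigma> = "(reg s)(1 := b)"
    let ?x = "pair_fst (g [pair_code b s])" and ?y = "pair_snd (g [pair_code b s])"
    have 1: "big cA ?\<sigma> (?\<sigma>(2 := ?x))" using cA[of ?\<sigma>] by (simp add: reg_def)
    have 2: "big cB (?\<sigma>(2 := ?x)) (?\<sigma>(2 := ?x, 3 := ?y))" using cB[of "?\<sigma>(2 := ?x)"] by (simp add: reg_def)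
    let ?u = "?\<sigma>(2 := ?x, 3 := ?y, 0 := 0, 1 := 0)"
    have "?u(3 := 0, 0 := ?u 0 + ?u 3) = (reg ?y)(2 := ?x)" by (auto simp: reg_def fun_eq_iff)
    then show ?thesis
      unfolding C_def using Seq[OF 1 Seq[OF 2 Seq[OF big_clear[of 0] Seq[OF big_clear[of 1] big_move[of 3 0 ?u]]]]]
      by simp
  qed
  have tail_reach: "reach P x (a, (reg s)(2 := k), i, w)
      (0, reg s, if k = 3 then Suc i else i, w @ (if k = 1 then [False] else if k = 2 then [True] else []))"
    if k: "k \<le> 3" for x s i w and k :: nat
  proof -
    have r: "(reg s)(2 := 0) = reg s" "reg s 2 = 0" by (auto simp: reg_def)
    consider "k = 0" | "k = 1" | "k = 2" | "k = 3" using k by linarith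
    then show ?thesis
    proof cases
      case 1
      then show ?thesis by - (rule reach_step, simp add: len, simp add: fetch r)
    next
      case 2
      show ?thesis unfolding 2
        by - (rule reach_step, simp add: len, simp add: fetch r Suc_a,
          rule reach_step, simp add: len, simp add: fetch r Suc_a,
          rule reach_step, simp add: len, simp add: fetch r Suc_a,
          rule reach_step, simp add: len, simp add: fetch r Suc_a,
          rule reach_step, simp add: len, simp add: fetch r Suc_a)
    next
      case 3
      show ?thesis unfolding 3
        by - (rule reach_step, simp add: len, simp add: fetch r Suc_a,
          rule reach_step, simp add: len, simp add: fetch r Suc_a,
          rule reach_step, simp add: len, simp add: fetch r Suc_a,
          rule reach_step, simp add: len, simp add: fetch r Suc_a,
          rule reach_step, simp add: len, simp add: fetch r Suc_a,
          rule reach_step, simp add: len, simp add: fetch r Suc_a,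
          rule reach_step, simp add: len, simp add: fetch r Suc_a)
    next
      case 4
      show ?thesis unfolding 4
        by - (rule reach_step, simp add: len, simp add: fetch r Suc_a,
          rule reach_step, simp add: len, simp add: fetch r Suc_a,
          rule reach_step, simp add: len, simp add: fetch r Suc_a,
          rule reach_step, simp add: len, simp add: fetch r Suc_a,
          rule reach_step, simp add: len, simp add: fetch r Suc_a,
          rule reach_step, simp add: len, simp add: fetch r Suc_a,
          rule reach_step, simp add: len, simp add: fetch r Suc_a,
          rule reach_step, simp add: len, simp add: fetch r Suc_a,
          rule reach_step, simp add: len, simp add: fetch r Suc_a)
    qed
  qed
  have loop: "reach P x (0, reg (enc s), i, w) (case tstep F x (s, i, w) of (s', i', w') \<Rightarrow> (0, reg (enc s'), i', w'))" for x s i w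
  proof -
    obtain k s' where Fk: "F (x i, s) = (k, s')" by fastforce
    have gk: "g [pair_code (of_bool (x i)) (enc s)] = pair_code k (enc s')" using g(2)[of "(x i, s)"] Fk by simp
    have "k \<le> 3" using act[of "(x i, s)"] Fk by simp
    have "reach P x (0, reg (enc s), i, w) (2, (reg (enc s))(1 := of_bool (x i)), i, w)"
    proof (cases "x i")
      case True
      have "Suc (reg (enc s) 1) = 1" by (simp add: reg_def)
      with True show ?thesis
        by - (rule reach_step, simp add: len, simp add: P0,
              rule reach_step, simp add: len, simp add: P0[simplified] numeral_2_eq_2)
    next
      case False
      have "(reg (enc s))(1 := 0) = reg (enc s)" by (auto simp: reg_def)
      with False show ?thesis
        by - (rule reach_step, simp add: len, simp add: P0)
    qed
    also have "reach P x (2, (reg (enc s))(1 := of_bool (x i)), i, w) (a, (reg (enc s'))(2 := k), i, w)"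
      using code_correct[OF big[of "enc s" "of_bool (x i)"] CC, of x i w] by (simp add: gk a_def)
    also have "reach P x (a, (reg (enc s'))(2 := k), i, w) (case tstep F x (s, i, w) of (s', i', w') \<Rightarrow> (0, reg (enc s'), i', w'))"
      using tail_reach[OF \<open>k \<le> 3\<close>] by (simp add: tstep_def Fk)
    finally show ?thesis .
  qed
  have all: "reach P x (0, \<lambda>_. 0, 0, []) (case (tstep F x ^^ n) (s0, 0, []) of (s', i', w') \<Rightarrow> (0, reg (enc s'), i', w'))" for x n
  proof (induction n)
    case 0
    have "reg 0 = (\<lambda>_. 0)" by (auto simp: reg_def)
    then show ?case by (simp add: s0)
  next
    case (Suc n)
    obtain s i w where e: "(tstep F x ^^ n) (s0, 0, []) = (s, i, w)" by (metis prod_cases3)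
    show ?case using rtranclp_trans[OF Suc[unfolded e prod.case] loop[of x s i w]] by (simp add: e)
  qed
  have "list_all (target_le (length P)) (code 2 C)"
    by (rule code_targets) (simp add: len a_def)
  then have targets: "list_all (target_le (length P)) P"
    by (simp add: P_def tail_def) (simp add: a_def)
  obtain R where R: "list_all (regs_below R) P" using code_regs by blast
  have "\<exists>m. written (run (counter_machine P R) x m) = snd (snd ((tstep F x ^^ n) (s0, 0, [])))" for x n
  proof -
    obtain m where "run (counter_machine P R) x m
        = config_of R (case (tstep F x ^^ n) (s0, 0, []) of (s', i', w') \<Rightarrow> (0, reg (enc s'), i', w'))"
      using run_counter_machine[OF all R] by blast
    then show ?thesis by (intro exI[of _ m]) (simp add: config_of_def split: prod.splits)
  qed
  then show ?thesis using valid_counter_machine[OF R targets] by blast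
qed

section \<open>Characteristic functions of random vectors\<close>

context prob_space
begin

lemma integrable_bounded:
  fixes f :: "'a \<Rightarrow> 'b::{banach, second_countable_topology}"
  assumes "f \<in> borel_measurable M" "\<And>x. norm (f x) \<le> B"
  shows "integrable M f"
  using assms by (intro integrable_const_bound[of _ B]) auto

text \<open>The weight is turned into a probability density: \<open>1 + v / b\<close> is nonnegative
  once \<open>b\<close> dominates \<open>v\<close>, and it has integral \<open>1\<close> because
  frequency \<open>a = 0\<close> shows that \<open>v\<close> has mean zero. Under the reweighted
  measure \<open>X\<close> has an unchanged characteristic function, hence by Levy's theorem an
  unchanged law.\<close>

lemma real_weight_char_eq_zero:
  fixes v X :: "'a \<Rightarrow> real"
  assumes [measurable]: "X \<in> borel_measurable M" "v \<in> borel_measurable M"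
    and bound: "\<And>x. \<bar>v x\<bar> \<le> B"
    and zero: "\<And>a. (CLINT x|M. v x *\<^sub>R iexp (a * X x)) = 0"
    and A [measurable]: "A \<in> sets borel"
  shows "(LINT x|M. v x * indicator A (X x)) = 0"
proof -
  define b where "b = max B 1"
  have b: "b > 0" "\<And>x. \<bar>v x\<bar> \<le> b" using bound by (auto simp: b_def intro: max.coboundedI1)
  define d where "d x = 1 + v x / b" for x
  have d_meas [measurable]: "d \<in> borel_measurable M" by (simp add: d_def[abs_def])
  have d0: "0 \<le> d x" for x
    using b(2)[of x] b(1) by (auto simp: d_def field_simps abs_le_iff)
  have d2: "norm (d x) \<le> 2" for x
    using b(2)[of x] b(1) d0[of x] by (auto simp: d_def field_simps abs_le_iff)
  define D where "D = density M (\<lambda>x. ennreal (d x))"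
  have iv: "integrable M v" using b by (intro integrable_bounded[of v b]) auto
  have id: "integrable M d" using d2 by (intro integrable_bounded[of d 2]) auto
  have "complex_of_real (LINT x|M. v x) = (CLINT x|M. v x *\<^sub>R iexp (0 * X x))"
    by (simp add: scaleR_conv_of_real)
  then have v0: "(LINT x|M. v x) = 0" using zero[of 0] by simp
  have "(LINT x|M. d x) = 1" unfolding d_def using iv v0 by (simp add: prob_space)
  then have "prob_space D"
    unfolding D_def using d0 id
    by (intro prob_spaceI) (simp add: emeasure_density nn_integral_eq_integral)
  then interpret D: prob_space D .
  have XD [measurable]: "X \<in> borel_measurable D" by (simp add: D_def)
  have ie [measurable]: "(\<lambda>x. iexp (t * X x)) \<in> borel_measurable M" for t by measurable
  have int: "integrable M (\<lambda>x. v x *\<^sub>R iexp (t * X x))" for t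
    using b by (intro integrable_bounded[of _ b]) (auto simp del: of_real_mult)
  have int1: "integrable M (\<lambda>x. iexp (t * X x))" for t
    by (intro integrable_bounded[of _ 1]) (auto simp del: of_real_mult)
  have int2: "integrable M (\<lambda>x. (1 / b) *\<^sub>R (v x *\<^sub>R iexp (t * X x)))" for t
    by (intro integrable_scaleR_right int)
  have "char (distr D borel X) t = char (distr M borel X) t" for t
  proof -
    have "char (distr D borel X) t = (CLINT x|M. d x *\<^sub>R iexp (t * X x))"
      unfolding char_def D_def using d0
      by (subst integral_distr, simp, simp, subst integral_density) auto
    also have "\<dots> = (CLINT x|M. iexp (t * X x) + (1 / b) *\<^sub>R (v x *\<^sub>R iexp (t * X x)))"
      by (simp add: d_def scaleR_add_left divide_inverse mult.commute)
    also have "\<dots> = (CLINT x|M. iexp (t * X x)) + (1 / b) *\<^sub>R (CLINT x|M. v x *\<^sub>R iexp (t * X x))"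
      by (simp only: Bochner_Integration.integral_add[OF int1 int2] integral_scaleR_right)
    also have "\<dots> = (CLINT x|M. iexp (t * X x))" using zero by simp
    also have "\<dots> = char (distr M borel X) t"
      unfolding char_def by (subst integral_distr) auto
    finally show ?thesis .
  qed
  then have eq: "distr D borel X = distr M borel X"
    by (intro Levy_uniqueness ext D.real_distribution_distr real_distribution_distr) auto
  have "(LINT x|M. d x * indicator A (X x)) = (LINT x|D. indicator A (X x))"
    unfolding D_def using d0 by (subst integral_density) auto
  also have "\<dots> = (LINT x|distr D borel X. indicator A x)" by (subst integral_distr) auto
  also have "\<dots> = (LINT x|M. indicator A (X x))" unfolding eq by (subst integral_distr) auto
  finally have 1: "(LINT x|M. d x * indicator A (X x)) = (LINT x|M. indicator A (X x))" .
  have i1: "integrable M (\<lambda>x. indicator A (X x) :: real)"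
    by (intro integrable_bounded[of _ 1]) (auto simp: indicator_def)
  have i2: "integrable M (\<lambda>x. v x * indicator A (X x))"
    using b by (intro integrable_bounded[of _ b]) (auto simp: indicator_def intro: less_imp_le)
  have "(LINT x|M. d x * indicator A (X x)) = (LINT x|M. indicator A (X x) + (1 / b) * (v x * indicator A (X x)))"
    by (simp add: d_def algebra_simps)
  also have "\<dots> = (LINT x|M. indicator A (X x)) + (1 / b) * (LINT x|M. v x * indicator A (X x))"
    using i1 i2 by (subst Bochner_Integration.integral_add) auto
  finally show ?thesis using 1 b(1) by simp
qed

text \<open>The centred weight \<open>V - c\<close> has vanishing transform but is complex.
  Conjugating the integral at frequency \<open>- a\<close> shows that the conjugate weight has
  vanishing transform too, hence so have the real and imaginary parts, to which
  \<open>real_weight_char_eq_zero\<close> applies.\<close>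

lemma weight_char_eq_const:
  fixes V :: "'a \<Rightarrow> complex" and X :: "'a \<Rightarrow> real"
  assumes [measurable]: "X \<in> borel_measurable M" "V \<in> borel_measurable M"
    and bound: "\<And>x. norm (V x) \<le> B"
    and char: "\<And>a. (CLINT x|M. V x * iexp (a * X x)) = c * (CLINT x|M. iexp (a * X x))"
    and A [measurable]: "A \<in> sets borel"
  shows "(CLINT x|M. V x * indicator A (X x)) = c * prob {x \<in> space M. X x \<in> A}"
proof -
  define U where "U x = V x - c" for x
  have U_meas [measurable]: "U \<in> borel_measurable M" by (simp add: U_def[abs_def])
  have ie [measurable]: "(\<lambda>x. iexp (t * X x)) \<in> borel_measurable M" for t by measurable
  have UB: "norm (U x) \<le> B + norm c" for x
    using norm_triangle_ineq4[of "V x" c] bound[of x] by (simp add: U_def)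
  have iV: "integrable M (\<lambda>x. V x * iexp (t * X x))" for t
    using bound by (intro integrable_bounded[of _ B]) (auto simp: norm_mult simp del: of_real_mult)
  have i1: "integrable M (\<lambda>x. iexp (t * X x))" for t
    by (intro integrable_bounded[of _ 1]) (auto simp del: of_real_mult)
  have zero: "(CLINT x|M. U x * iexp (a * X x)) = 0" for a
    unfolding U_def using iV[of a] i1[of a] char[of a]
    by (simp add: left_diff_distrib)
  have iU: "integrable M (\<lambda>x. U x * iexp (a * X x))" for a
    using UB by (intro integrable_bounded[of _ "B + norm c"]) (auto simp: norm_mult simp del: of_real_mult)
  have zero': "(CLINT x|M. cnj (U x) * iexp (a * X x)) = 0" for a
  proof -
    have "(CLINT x|M. cnj (U x) * iexp (a * X x)) = (CLINT x|M. cnj (U x * iexp (- a * X x)))"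
      by (simp add: exp_cnj)
    also have "\<dots> = cnj (CLINT x|M. U x * iexp (- a * X x))" by (rule Bochner_Integration.integral_cnj)
    finally show ?thesis using zero[of "- a"] by simp
  qed
  have [measurable]: "(\<lambda>x. cnj (U x)) \<in> borel_measurable M"
    by (rule measurable_compose[OF U_meas borel_measurable_continuous_onI]) (intro continuous_intros)
  have iU': "integrable M (\<lambda>x. cnj (U x) * iexp (a * X x))" for a
    using UB by (intro integrable_bounded[of _ "B + norm c"]) (auto simp: norm_mult simp del: of_real_mult)
  have Re0: "(CLINT x|M. Re (U x) *\<^sub>R iexp (a * X x)) = 0" for a
  proof -
    have "Re (U x) *\<^sub>R iexp (a * X x) = (1 / 2) * (U x * iexp (a * X x) + cnj (U x) * iexp (a * X x))" for x
      by (simp add: scaleR_conv_of_real complex_add_cnj flip: distrib_right)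
    then show ?thesis
      by (simp only: integral_mult_right_zero Bochner_Integration.integral_add[OF iU iU'] zero zero') simp
  qed
  have Im0: "(CLINT x|M. Im (U x) *\<^sub>R iexp (a * X x)) = 0" for a
  proof -
    have "Im (U x) *\<^sub>R iexp (a * X x) = (1 / (2 * \<i>)) * (U x * iexp (a * X x) - cnj (U x) * iexp (a * X x))" for x
      by (simp add: scaleR_conv_of_real complex_diff_cnj flip: left_diff_distrib) (simp add: algebra_simps)
    then show ?thesis
      by (simp only: integral_mult_right_zero Bochner_Integration.integral_diff[OF iU iU'] zero zero') simp
  qed
  have B: "\<bar>Re (U x)\<bar> \<le> B + norm c" "\<bar>Im (U x)\<bar> \<le> B + norm c" for x
    using UB[of x] abs_Re_le_cmod[of "U x"] abs_Im_le_cmod[of "U x"] by auto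
  have R: "(LINT x|M. Re (U x) * indicator A (X x)) = 0"
    by (rule real_weight_char_eq_zero[OF _ _ B(1) Re0]) auto
  have I: "(LINT x|M. Im (U x) * indicator A (X x)) = 0"
    by (rule real_weight_char_eq_zero[OF _ _ B(2) Im0]) auto
  have iUA: "integrable M (\<lambda>x. U x * indicator A (X x))"
    using UB by (intro integrable_bounded[of _ "B + norm c"])
      (auto simp: norm_mult indicator_def intro: order_trans[OF norm_ge_zero])
  have iA: "integrable M (\<lambda>x. indicator A (X x) :: complex)"
    by (intro integrable_bounded[of _ 1]) (auto simp: indicator_def)
  have reim: "Re (U x * indicator A (X x)) = Re (U x) * indicator A (X x)"
    "Im (U x * indicator A (X x)) = Im (U x) * indicator A (X x)" for x
    by (auto simp: indicator_def)
  have "Re (CLINT x|M. U x * indicator A (X x)) = 0" "Im (CLINT x|M. U x * indicator A (X x)) = 0"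
    using R I integral_Re[OF iUA] integral_Im[OF iUA] by (simp_all only: reim)
  then have "(CLINT x|M. U x * indicator A (X x)) = 0" by (simp add: complex_eq_iff)
  moreover have "(CLINT x|M. V x * indicator A (X x)) = (CLINT x|M. U x * indicator A (X x)) + c * (CLINT x|M. indicator A (X x))"
  proof -
    have "V x * indicator A (X x) = U x * indicator A (X x) + c * indicator A (X x)" for x
      by (simp add: U_def algebra_simps)
    then show ?thesis using iUA iA by simp
  qed
  moreover have "(CLINT x|M. indicator A (X x)) = prob {x \<in> space M. X x \<in> A}"
  proof -
    have "(CLINT x|M. indicator A (X x)) = (CLINT x|M. complex_of_real (indicator A (X x)))"
      by (intro Bochner_Integration.integral_cong) (auto simp: indicator_def)
    also have "\<dots> = complex_of_real (LINT x|M. indicator {x \<in> space M. X x \<in> A} x)"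
      by (subst integral_complex_of_real, intro arg_cong[where f = of_real] Bochner_Integration.integral_cong) (auto simp: indicator_def)
    also have "\<dots> = prob {x \<in> space M. X x \<in> A}"
      by (simp add: Int_absorb2 subset_iff)
    finally show ?thesis .
  qed
  ultimately show ?thesis by simp
qed

text \<open>The factors \<open>iexp (a i * X i)\<close> are traded one at a time for indicators of \<open>X i \<in> A i\<close>.\<close>

theorem indep_vars_of_joint_char:
  fixes X :: "nat \<Rightarrow> 'a \<Rightarrow> real"
  assumes X [measurable]: "\<And>i. i < n \<Longrightarrow> X i \<in> borel_measurable M"
    and joint: "\<And>a. (CLINT x|M. iexp (\<Sum>i<n. a i * X i x)) = (\<Prod>i<n. \<phi> i (a i))"
    and one: "\<And>i. i < n \<Longrightarrow> \<phi> i 0 = 1"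
  shows "indep_vars (\<lambda>_. borel) X {..<n}"
    and "\<And>i. i < n \<Longrightarrow> char (distr M borel (X i)) = \<phi> i"
proof -
  have phi: "(CLINT x|M. iexp (t * X i x)) = \<phi> i t" if "i < n" for i t
  proof -
    \<comment> \<open>All frequencies except the \<open>i\<close>-th are set to \<open>0\<close>,
      where the factors are \<open>1\<close>; this identifies the marginals.\<close>
    have "(\<Sum>j<n. (if j = i then t else 0) * X j x) = t * X i x" for x
      using that by (simp add: if_distrib[of "\<lambda>c. c * _"] cong: if_cong)
    moreover have "(\<Prod>j<n. \<phi> j (if j = i then t else 0)) = \<phi> i t"
      using that one by (subst prod.remove[of _ i]) (auto intro!: prod.neutral)
    ultimately show ?thesis using joint[of "\<lambda>j. if j = i then t else 0"] by simp
  qed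
  show "char (distr M borel (X i)) = \<phi> i" if "i < n" for i
  proof
    show "char (distr M borel (X i)) t = \<phi> i t" for t
      using phi[OF that, of t] that unfolding char_def by (subst integral_distr) auto
  qed
  have main: "(CLINT x|M. (\<Prod>i<j. indicator (A i) (X i x)) * (\<Prod>i\<in>{j..<n}. iexp (a i * X i x)))
      = (\<Prod>i<j. complex_of_real (prob {x \<in> space M. X i x \<in> A i})) * (\<Prod>i\<in>{j..<n}. \<phi> i (a i))"
    if "j \<le> n" "\<And>i. A i \<in> sets borel" for j A a
    using that(1)
  proof (induction j arbitrary: a)
    case 0
    have "(\<Prod>i\<in>{0..<n}. iexp (a i * X i x)) = iexp (\<Sum>i<n. a i * X i x)" for x
      by (simp add: exp_sum sum_distrib_left atLeast0LessThan)
    then show ?case using joint[of a] by (simp add: atLeast0LessThan)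
  next
    case (Suc j)
    then have j: "j < n" by simp
    note A[measurable] = that(2)
    define V where "V x = (\<Prod>i<j. indicator (A i) (X i x)) * (\<Prod>i\<in>{Suc j..<n}. iexp (a i * X i x))" for x
    define c where "c = (\<Prod>i<j. complex_of_real (prob {x \<in> space M. X i x \<in> A i})) * (\<Prod>i\<in>{Suc j..<n}. \<phi> i (a i))"
    have "(\<lambda>x. \<Prod>i<j. indicator (A i) (X i x) :: complex) \<in> borel_measurable M"
      using j by (intro borel_measurable_prod borel_measurable_indicator' measurable_sets) auto
    moreover have "(\<lambda>x. \<Prod>i\<in>{Suc j..<n}. iexp (a i * X i x)) \<in> borel_measurable M"
    proof (intro borel_measurable_prod)
      fix i assume "i \<in> {Suc j..<n}"
      then have [measurable]: "X i \<in> borel_measurable M" by simp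
      show "(\<lambda>x. iexp (a i * X i x)) \<in> borel_measurable M" by measurable
    qed
    ultimately have V [measurable]: "V \<in> borel_measurable M" unfolding V_def by measurable
    have V1: "norm (V x) \<le> 1" for x
    proof -
      have "norm (\<Prod>i<j. indicator (A i) (X i x) :: complex) \<le> 1"
        by (simp add: prod_norm[symmetric]) (auto intro!: prod_le_1 simp: indicator_def)
      moreover have "norm (\<Prod>i\<in>{Suc j..<n}. iexp (a i * X i x)) = 1"
        by (simp add: prod_norm[symmetric] del: of_real_mult)
      ultimately show ?thesis by (simp add: V_def norm_mult del: of_real_mult)
    qed
    \<comment> \<open>The induction hypothesis for all values \<open>t\<close> of the
      \<open>j\<close>-th frequency: against every exponential of \<open>X j\<close>, the bounded
      weight \<open>V\<close> acts like the constant \<open>c\<close>. By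
      \<open>weight_char_eq_const\<close> it then does so against indicators.\<close>
    have char: "(CLINT x|M. V x * iexp (t * X j x)) = c * (CLINT x|M. iexp (t * X j x))" for t
    proof -
      let ?a = "a(j := t)"
      have "{j..<n} = insert j {Suc j..<n}" using j by auto
      then have "(\<Prod>i<j. indicator (A i) (X i x)) * (\<Prod>i\<in>{j..<n}. iexp (?a i * X i x)) = V x * iexp (t * X j x)"
        "(\<Prod>i\<in>{j..<n}. \<phi> i (?a i)) = \<phi> j t * (\<Prod>i\<in>{Suc j..<n}. \<phi> i (a i))" for x
        by (auto simp: V_def intro!: prod.cong)
      with Suc.IH[of ?a] j show ?thesis by (simp add: c_def phi[OF j] mult_ac del: of_real_mult)
    qed
    have "(\<Prod>i<Suc j. indicator (A i) (X i x)) * (\<Prod>i\<in>{Suc j..<n}. iexp (a i * X i x)) = V x * indicator (A j) (X j x)" for x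
      by (simp add: V_def mult_ac)
    then have "(CLINT x|M. (\<Prod>i<Suc j. indicator (A i) (X i x)) * (\<Prod>i\<in>{Suc j..<n}. iexp (a i * X i x)))
        = c * prob {x \<in> space M. X j x \<in> A j}"
      using weight_char_eq_const[OF X[OF j] V V1 char that(2)[of j]] by (simp only:)
    then show ?case by (simp add: c_def mult_ac)
  qed
  show "indep_vars (\<lambda>_. borel) X {..<n}"
  proof (cases "n = 0")
    case False
    show ?thesis
      unfolding indep_vars_def2
    proof (intro conjI ballI)
      show "indep_sets (\<lambda>i. {X i -` A \<inter> space M |A. A \<in> sets borel}) {..<n}"
      proof (subst indep_sets_finite)
        show "\<forall>B\<in>Pi {..<n} (\<lambda>i. {X i -` A \<inter> space M |A. A \<in> sets borel}).
            prob (\<Inter>j<n. B j) = (\<Prod>j<n. prob (B j))"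
        proof
          fix B assume "B \<in> Pi {..<n} (\<lambda>i. {X i -` A \<inter> space M |A. A \<in> sets borel})"
          then have "\<forall>i. \<exists>A. A \<in> sets borel \<and> (i < n \<longrightarrow> B i = X i -` A \<inter> space M)" by (force simp: Pi_iff)
          then obtain A where A: "\<And>i. A i \<in> sets borel" "\<And>i. i < n \<Longrightarrow> B i = X i -` A i \<inter> space M" by metis
          have Bm: "B i \<in> events" if "i < n" for i using A that X[OF that] by (auto intro!: measurable_sets)
          have Bi: "{x \<in> space M. X i x \<in> A i} = B i" if "i < n" for i using A that by auto
          have sub: "(\<Inter>j<n. B j) \<in> events" using Bm False by (intro sets.finite_INT) auto
          have "(\<Prod>i<n. indicator (A i) (X i x)) = complex_of_real (indicator (\<Inter>j<n. B j) x)" if "x \<in> space M" for x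
            using that A False by (auto simp: indicator_def)
          then have "(CLINT x|M. (\<Prod>i<n. indicator (A i) (X i x))) = (CLINT x|M. complex_of_real (indicator (\<Inter>j<n. B j) x))"
            by (intro Bochner_Integration.integral_cong) auto
          also have "\<dots> = prob (\<Inter>j<n. B j)"
            using sub by (subst integral_complex_of_real) (simp add: integral_indicator)
          finally have "complex_of_real (prob (\<Inter>j<n. B j)) = (\<Prod>i<n. complex_of_real (prob (B i)))"
            using main[of n A] A by (simp add: Bi)
          then show "prob (\<Inter>j<n. B j) = (\<Prod>j<n. prob (B j))"
            by (metis of_real_prod of_real_eq_iff)
        qed
        fix i assume i: "i \<in> {..<n}"
        show "{X i -` A \<inter> space M |A. A \<in> sets borel} \<subseteq> events"
          using X[of i] i by (auto intro!: measurable_sets)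
        show "space M \<in> {X i -` A \<inter> space M |A. A \<in> sets borel}"
          by (auto intro!: exI[of _ UNIV])
      qed (use False in auto)
    qed auto
  qed (simp add: indep_vars_def2 indep_sets_def)
qed

lemma distributed_normal_of_char:
  assumes X [measurable]: "X \<in> borel_measurable M" and v: "v > 0"
    and char: "\<And>t. char (distr M borel X) t = complex_of_real (exp (- (v * t\<^sup>2) / 2))"
  shows "distributed M lborel X (normal_density 0 (sqrt v))"
proof -
  let ?Y = "\<lambda>x. X x / sqrt v"
  have "char (distr M borel ?Y) = char std_normal_distribution"
  proof
    fix t
    have "char (distr M borel ?Y) t = char (distr M borel X) (t / sqrt v)"
      unfolding char_def by (simp add: integral_distr)
    also have "\<dots> = exp (- (t\<^sup>2) / 2)"
      using v by (simp add: char power_divide)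
    finally show "char (distr M borel ?Y) t = char std_normal_distribution t"
      by (simp add: char_std_normal_distribution)
  qed
  then have "distr M borel ?Y = std_normal_distribution"
    by (intro Levy_uniqueness real_distribution_distr real_dist_normal_dist) auto
  then have "distributed M lborel ?Y std_normal_density"
    by (auto simp: distributed_def cong: distr_cong)
  then show ?thesis using normal_standard_normal_convert[of "sqrt v" X 0] v by simp
qed

end

section \<open>Uniform random variables from coin flips\<close>

abbreviation coin :: "bool measure" where
  "coin \<equiv> measure_pmf (bernoulli_pmf (1 / 2))"

interpretation coin: prob_space coin_space
  unfolding coin_space_def by (intro prob_space_PiM prob_space_measure_pmf)

lemma space_coin_space [simp]: "space coin_space = UNIV"
  by (simp add: coin_space_def space_PiM)

lemma measurable_coin_component: "(\<lambda>\<omega>. \<omega> n) \<in> measurable coin_space coin"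
  unfolding coin_space_def by (rule measurable_component_singleton) simp

lemma coin_component [measurable]: "(\<lambda>\<omega>. \<omega> n) \<in> measurable coin_space (count_space UNIV)"
  using measurable_coin_component[of n] by (simp cong: measurable_cong_sets)

definition subseq_by :: "(nat \<Rightarrow> nat) \<Rightarrow> (nat \<Rightarrow> bool) \<Rightarrow> nat \<Rightarrow> bool" where
  "subseq_by e \<omega> j = \<omega> (e j)"

lemma subseq_by_PiM:
  assumes "range e \<subseteq> K"
  shows "subseq_by e \<in> measurable (PiM K (\<lambda>_. coin)) coin_space"
  unfolding coin_space_def
proof (rule measurable_PiM_single')
  fix i show "(\<lambda>\<omega>. subseq_by e \<omega> i) \<in> measurable (PiM K (\<lambda>_. coin)) coin"
    using assms unfolding subseq_by_def by (intro measurable_component_singleton) auto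
qed auto

lemma subseq_by_measurable [measurable]: "subseq_by e \<in> measurable coin_space coin_space"
  using subseq_by_PiM[of e UNIV] by (simp add: coin_space_def)

lemma distr_subseq_by:
  assumes "inj e"
  shows "distr coin_space coin_space (subseq_by e) = coin_space"
proof -
  have "subseq_by e = (\<lambda>\<omega>. \<lambda>n\<in>UNIV. \<omega> (e n))" by (auto simp: subseq_by_def fun_eq_iff)
  then show ?thesis
    using distr_PiM_reindex[of UNIV "\<lambda>_. coin" e UNIV] assms
    by (simp add: coin_space_def prob_space_measure_pmf)
qed

lemma integral_subseq_by:
  fixes f :: "(nat \<Rightarrow> bool) \<Rightarrow> 'b::{banach, second_countable_topology}"
  assumes "inj e" and [measurable]: "f \<in> borel_measurable coin_space"
  shows "(LINT \<omega>|coin_space. f (subseq_by e \<omega>)) = (LINT \<omega>|coin_space. f \<omega>)"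
  by (subst (2) distr_subseq_by[OF assms(1), symmetric], subst integral_distr) auto

lemma indep_coin_components: "coin.indep_vars (\<lambda>_. coin) (\<lambda>i \<omega>. \<omega> i) UNIV"
proof (subst coin.indep_vars_iff_distr_eq_PiM')
  have "distr coin_space coin (\<lambda>\<omega>. \<omega> i) = coin" for i
    unfolding coin_space_def by (rule distr_PiM_component) (auto simp: prob_space_measure_pmf)
  moreover have "distr coin_space (PiM UNIV (\<lambda>_. coin)) (\<lambda>x. \<lambda>i\<in>UNIV. x i) = coin_space"
    by (simp add: coin_space_def restrict_def distr_id2)
  ultimately show "distr coin_space (PiM UNIV (\<lambda>_. coin)) (\<lambda>x. \<lambda>i\<in>UNIV. x i)
      = PiM UNIV (\<lambda>i. distr coin_space coin (\<lambda>\<omega>. \<omega> i))"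
    by (simp add: coin_space_def)
qed (auto intro: measurable_coin_component)

text \<open>Substreams along disjoint sets of positions are functions of disjoint blocks of
  independent coordinates; restricting the stream to a block makes this dependence explicit.\<close>

lemma indep_subseq_by:
  assumes "\<And>r. r \<in> I \<Longrightarrow> inj (e r)" "disjoint_family_on (\<lambda>r. range (e r)) I"
  shows "coin.indep_vars (\<lambda>_. coin_space) (\<lambda>r. subseq_by (e r)) I"
proof -
  have "coin.indep_vars (\<lambda>r. PiM (range (e r)) (\<lambda>_. coin))
      (\<lambda>r \<omega>. restrict (\<lambda>i. \<omega> i) (range (e r))) I"
    by (rule coin.indep_vars_restrict[OF indep_coin_components _ assms(2)]) auto
  from coin.indep_vars_compose2[OF this, of "\<lambda>r. subseq_by (e r)" "\<lambda>_. coin_space"]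
  have "coin.indep_vars (\<lambda>_. coin_space) (\<lambda>r \<omega>. subseq_by (e r) (restrict \<omega> (range (e r)))) I"
    by (simp add: subseq_by_PiM)
  moreover have "subseq_by (e r) (restrict \<omega> (range (e r))) = subseq_by (e r) \<omega>" for r \<omega>
    by (auto simp: subseq_by_def fun_eq_iff)
  ultimately show ?thesis by simp
qed

text \<open>The form in which independence is applied later: the expectation of a product splits,
  and each factor is computed as if its substream were the whole stream.\<close>

lemma integral_prod_subseq_by:
  fixes f :: "'i \<Rightarrow> (nat \<Rightarrow> bool) \<Rightarrow> complex"
  assumes I: "finite I" "\<And>r. r \<in> I \<Longrightarrow> inj (e r)" "disjoint_family_on (\<lambda>r. range (e r)) I"
    and f: "\<And>r. r \<in> I \<Longrightarrow> f r \<in> borel_measurable coin_space" "\<And>r \<omega>. r \<in> I \<Longrightarrow> norm (f r \<omega>) \<le> B"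
  shows "(CLINT \<omega>|coin_space. (\<Prod>r\<in>I. f r (subseq_by (e r) \<omega>))) = (\<Prod>r\<in>I. CLINT \<omega>|coin_space. f r \<omega>)"
proof -
  have "coin.indep_vars (\<lambda>_. borel) (\<lambda>r \<omega>. f r (subseq_by (e r) \<omega>)) I"
    by (rule coin.indep_vars_compose2[OF indep_subseq_by[OF I(2,3)]]) (use f in auto)
  then have "(CLINT \<omega>|coin_space. (\<Prod>r\<in>I. f r (subseq_by (e r) \<omega>)))
      = (\<Prod>r\<in>I. CLINT \<omega>|coin_space. f r (subseq_by (e r) \<omega>))"
  proof (rule coin.indep_vars_lebesgue_integral[OF I(1)])
    fix r assume r: "r \<in> I"
    have "(\<lambda>\<omega>. f r (subseq_by (e r) \<omega>)) \<in> borel_measurable coin_space"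
      using f(1)[OF r] by measurable
    then show "integrable coin_space (\<lambda>\<omega>. f r (subseq_by (e r) \<omega>))"
      using f(2)[OF r] by (intro coin.integrable_const_bound[of _ B]) auto
  qed
  also have "\<dots> = (\<Prod>r\<in>I. CLINT \<omega>|coin_space. f r \<omega>)"
    by (intro prod.cong refl integral_subseq_by I f)
  finally show ?thesis .
qed

section \<open>Binary expansions and the uniform distribution\<close>

definition ureal_part :: "(nat \<Rightarrow> bool) \<Rightarrow> nat \<Rightarrow> real" where
  "ureal_part b n = (\<Sum>j<n. of_bool (b j) / 2 ^ Suc j)"

definition ureal :: "(nat \<Rightarrow> bool) \<Rightarrow> real" where
  "ureal b = (\<Sum>j. of_bool (b j) / 2 ^ Suc j)"

lemma summable_ureal: "summable (\<lambda>j. of_bool (b j) / 2 ^ Suc j :: real)"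
proof (rule summable_comparison_test)
  show "summable (\<lambda>j. (1 / 2) ^ Suc j :: real)" 
    using summable_mult[OF summable_geometric[of "1 / 2 :: real"], of "1 / 2"] by simp
  show "\<exists>N. \<forall>n\<ge>N. norm (of_bool (b n) / 2 ^ Suc n :: real) \<le> (1 / 2) ^ Suc n"
    by (auto simp: power_divide)
qed

lemma ureal_part_le: "ureal_part b n \<le> ureal b"
  unfolding ureal_part_def ureal_def by (rule sum_le_suminf[OF summable_ureal]) auto

lemma ureal_le_part: "ureal b \<le> ureal_part b n + 1 / 2 ^ n"
proof -
  have "ureal b = (\<Sum>j. of_bool (b (j + n)) / 2 ^ Suc (j + n)) + ureal_part b n"
    unfolding ureal_part_def ureal_def by (rule suminf_split_initial_segment[OF summable_ureal])
  also have "(\<Sum>j. of_bool (b (j + n)) / 2 ^ Suc (j + n) :: real) \<le> (\<Sum>j. (1 / 2) ^ Suc n * (1 / 2) ^ j)"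
  proof (rule suminf_le)
    have "1 / 2 ^ Suc (j + n) = (1 / 2) ^ Suc n * (1 / 2 :: real) ^ j" for j
      by (simp add: power_divide power_add)
    then show "of_bool (b (j + n)) / 2 ^ Suc (j + n) \<le> (1 / 2) ^ Suc n * (1 / 2 :: real) ^ j" for j
      by (cases "b (j + n)") auto
    show "summable (\<lambda>j. of_bool (b (j + n)) / 2 ^ Suc (j + n) :: real)"
      by (rule summable_ignore_initial_segment[OF summable_ureal])
    show "summable (\<lambda>j. (1 / 2) ^ Suc n * (1 / 2 :: real) ^ j)"
      by (intro summable_mult summable_geometric) simp
  qed
  also have "\<dots> = (1 / 2) ^ Suc n * 2"
    by (subst suminf_mult) (auto simp: suminf_geometric summable_geometric)
  finally show ?thesis by (simp add: power_divide)
qed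

lemma ureal_bounds: "0 \<le> ureal b" "ureal b \<le> 1"
  using ureal_part_le[of b 0] ureal_le_part[of b 0] by (auto simp: ureal_part_def)

lemma ureal_part_tendsto: "ureal_part b \<longlonglongrightarrow> ureal b"
  using summable_LIMSEQ[OF summable_ureal[of b]] by (simp add: ureal_part_def[abs_def] ureal_def)

lemma ureal_measurable [measurable]: "ureal \<in> borel_measurable coin_space"
proof -
  have "(\<lambda>\<omega>. of_bool (\<omega> j) / 2 ^ Suc j :: real) \<in> borel_measurable coin_space" for j
    by (rule measurable_compose[OF coin_component, of "\<lambda>b. of_bool b / 2 ^ Suc j"]) simp
  then show ?thesis unfolding ureal_def[abs_def] by (rule borel_measurable_suminf)
qed

text \<open>Each truncation depends on finitely many coordinates, hence is continuous for the
  product topology, and the truncations converge uniformly. The openness of the domain rests on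
  this.\<close>

lemma continuous_ureal: "continuous_on UNIV ureal"
proof (rule uniform_limit_theorem)
  show "uniform_limit UNIV (\<lambda>n b. ureal_part b n) ureal sequentially"
  proof (rule uniform_limitI)
    fix e :: real assume "e > 0"
    then have "\<forall>\<^sub>F n in sequentially. (1 / 2) ^ n < e"
      by (intro order_tendstoD[OF LIMSEQ_realpow_zero]) auto
    then show "\<forall>\<^sub>F n in sequentially. \<forall>b\<in>UNIV. dist (ureal_part b n) (ureal b) < e"
    proof eventually_elim
      case (elim n)
      show ?case
      proof
        fix b show "dist (ureal_part b n) (ureal b) < e"
          using ureal_part_le[of b n] ureal_le_part[of b n] elim by (simp add: dist_real_def power_divide)
      qed
    qed
  qed
  have "continuous_on UNIV (\<lambda>b::nat \<Rightarrow> bool. of_bool (b j) :: real)" for j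
    by (rule continuous_on_compose2[OF _ continuous_on_product_coordinates, of UNIV of_bool])
       (auto simp: continuous_on_discrete)
  then show "\<forall>\<^sub>F n in sequentially. continuous_on UNIV (\<lambda>b. ureal_part b n)"
    unfolding ureal_part_def
    by (intro always_eventually allI continuous_on_sum continuous_on_divide continuous_on_const) auto
qed auto

abbreviation unif :: "real measure" where
  "unif \<equiv> density lborel (indicator {0..1})"

lemma integral_unif:
  fixes f :: "real \<Rightarrow> 'b::{banach, second_countable_topology}"
  assumes "f \<in> borel_measurable borel"
  shows "(LINT x|unif. f x) = (LINT x|lborel. indicator {0..1} x *\<^sub>R f x)"
proof -
  have "unif = density lborel (\<lambda>x. ennreal (indicator {0..1} x))" by (simp add: ennreal_indicator)
  then show ?thesis using assms by (simp add: integral_density)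
qed

interpretation unif: prob_space unif
  by (rule prob_spaceI) (simp add: emeasure_density)

lemma char_unif: "t \<noteq> 0 \<Longrightarrow> char unif t = (iexp t - 1) / (\<i> * t)"
proof -
  assume t: "t \<noteq> 0"
  have ii: "\<i> * (z * \<i>) = - z" for z by (simp add: complex_eq_iff)
  have "char unif t = (CLINT x|lborel. indicator {0..1} x *\<^sub>R iexp (t * x))"
    unfolding char_def by (rule integral_unif) simp
  also have "\<dots> = iexp (t * 1) / (\<i> * t) - iexp (t * 0) / (\<i> * t)"
  proof (rule integral_FTC_atLeastAtMost)
    show "((\<lambda>x. iexp (t * x) / (\<i> * t)) has_vector_derivative iexp (t * x)) (at x within {0..1})" for x
      using t by (auto intro!: derivative_eq_intros has_vector_derivative_real_field simp: ii)
  qed (auto intro!: continuous_intros)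
  finally show ?thesis by (simp add: diff_divide_distrib)
qed

text \<open>A uniform variable is a fair bit of weight one half plus an independent uniform variable
  of half size; the first factor is the transform of that bit.\<close>

lemma char_unif_half: "char unif t = (1 + iexp (t / 2)) / 2 * char unif (t / 2)"
proof (cases "t = 0")
  case True
  then show ?thesis using unif.prob_space by (simp add: char_def)
next
  case False
  have "iexp t = iexp (t / 2) * iexp (t / 2)" by (simp flip: exp_add)
  then show ?thesis using False by (simp add: char_unif divide_simps) (simp add: algebra_simps)
qed

text \<open>By independence the transform of a truncated expansion is the product of those of its
  bits. Iterating \<open>char_unif_half\<close> splits the same product off
  \<open>char unif t\<close>, and the remaining factor, taken at \<open>t / 2 ^ n\<close>, tends to
  \<open>1\<close>.\<close>

lemma distr_ureal: "distr coin_space borel ureal = unif"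
proof (rule Levy_uniqueness)
  show "real_distribution (distr coin_space borel ureal)" by simp
  show u: "real_distribution unif" by unfold_locales auto
  show "char (distr coin_space borel ureal) = char unif"
  proof
    fix t
    have bit: "(CLINT \<omega>|coin_space. iexp (t * (of_bool (\<omega> j) / 2 ^ Suc j))) = (1 + iexp (t / 2 ^ Suc j)) / 2" for j
    proof -
      have "(CLINT \<omega>|coin_space. iexp (t * (of_bool (\<omega> j) / 2 ^ Suc j)))
          = (CLINT b|distr coin_space coin (\<lambda>\<omega>. \<omega> j). iexp (t * (of_bool b / 2 ^ Suc j)))"
        using measurable_coin_component[of j] by (subst integral_distr) auto
      also have "distr coin_space coin (\<lambda>\<omega>. \<omega> j) = coin"
        unfolding coin_space_def by (rule distr_PiM_component) (auto simp: prob_space_measure_pmf)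
      also have "(CLINT b|coin. iexp (t * (of_bool b / 2 ^ Suc j))) = (1 + iexp (t / 2 ^ Suc j)) / 2"
        by (subst integral_measure_pmf[of UNIV]) (auto simp: UNIV_bool scaleR_conv_of_real field_simps)
      finally show ?thesis .
    qed
    have part: "(CLINT \<omega>|coin_space. iexp (t * ureal_part \<omega> n)) = (\<Prod>j<n. (1 + iexp (t / 2 ^ Suc j)) / 2)" for n
    proof -
      have ind: "coin.indep_vars (\<lambda>_. borel) (\<lambda>j \<omega>. iexp (t * (of_bool (\<omega> j) / 2 ^ Suc j))) {..<n}"
        by (rule coin.indep_vars_compose2[OF coin.indep_vars_subset[OF indep_coin_components subset_UNIV],
              of _ "\<lambda>j b. iexp (t * (of_bool b / 2 ^ Suc j))"]) auto
      have "(CLINT \<omega>|coin_space. iexp (t * ureal_part \<omega> n))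
          = (CLINT \<omega>|coin_space. (\<Prod>j<n. iexp (t * (of_bool (\<omega> j) / 2 ^ Suc j))))"
        by (simp only: ureal_part_def sum_distrib_left of_real_sum exp_sum[OF finite_lessThan])
      also have "\<dots> = (\<Prod>j<n. CLINT \<omega>|coin_space. iexp (t * (of_bool (\<omega> j) / 2 ^ Suc j)))"
        using ind by (intro coin.indep_vars_lebesgue_integral coin.integrable_const_bound[of _ 1])
          (auto simp: coin.indep_vars_def simp del: of_real_mult)
      finally show ?thesis by (simp only: bit)
    qed
    have unif_part: "char unif t = (\<Prod>j<n. (1 + iexp (t / 2 ^ Suc j)) / 2) * char unif (t / 2 ^ n)" for n
      by (induction n) (simp, subst (asm) (2) char_unif_half, simp add: mult_ac)
    have char_part: "(\<lambda>n. char unif (t / 2 ^ n)) \<longlonglongrightarrow> 1"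
    proof -
      interpret real_distribution unif by (rule u)
      have "(\<lambda>n. t / 2 ^ n) \<longlonglongrightarrow> 0"
        using tendsto_mult_right_zero[OF LIMSEQ_realpow_zero[of "1 / 2 :: real"], of t] by (simp add: power_divide)
      then have "(\<lambda>n. char unif (t / 2 ^ n)) \<longlonglongrightarrow> char unif 0"
        using isCont_char[of 0] by (rule isCont_tendsto_compose[rotated])
      then show ?thesis by (simp add: char_zero)
    qed
    have meas: "(\<lambda>\<omega>. ureal_part \<omega> n) \<in> borel_measurable coin_space" for n
      unfolding ureal_part_def
      by (intro borel_measurable_sum measurable_compose[OF coin_component, of "\<lambda>b. of_bool b / 2 ^ _"]) simp
    have "(\<lambda>n. CLINT \<omega>|coin_space. iexp (t * ureal_part \<omega> n)) \<longlonglongrightarrow> (CLINT \<omega>|coin_space. iexp (t * ureal \<omega>))"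
      by (rule integral_dominated_convergence[where w = "\<lambda>_. 1"])
         (use meas in \<open>auto intro!: tendsto_intros ureal_part_tendsto simp del: of_real_mult\<close>)
    then have "(\<lambda>n. (\<Prod>j<n. (1 + iexp (t / 2 ^ Suc j)) / 2) * char unif (t / 2 ^ n)) \<longlonglongrightarrow> char (distr coin_space borel ureal) t * 1"
      unfolding part by (intro tendsto_mult char_part) (simp add: char_def integral_distr)
    then have "(\<lambda>n. char unif t) \<longlonglongrightarrow> char (distr coin_space borel ureal) t"
      using unif_part by simp
    then show "char (distr coin_space borel ureal) t = char unif t"
      by (metis LIMSEQ_unique tendsto_const)
  qed
qed

lemma integral_ureal:
  fixes f :: "real \<Rightarrow> 'b::{banach, second_countable_topology}"
  assumes [measurable]: "f \<in> borel_measurable borel"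
  shows "(LINT \<omega>|coin_space. f (ureal \<omega>)) = (LINT x|unif. f x)"
  unfolding distr_ureal[symmetric] by (subst integral_distr) auto

text \<open>Conditioning a uniform variable on lying below or above \<open>1 - e\<close> gives
  uniform variables on the two intervals, here rescaled to the unit interval. The common endpoint is
  a null set.\<close>

lemma integral_unif_split:
  fixes f :: "real \<Rightarrow> complex"
  assumes f [measurable]: "f \<in> borel_measurable borel" and B: "\<And>x. norm (f x) \<le> B" and e: "0 < e" "e < 1"
  shows "(CLINT x|unif. f x) = (1 - e) * (CLINT x|unif. f ((1 - e) * x)) + e * (CLINT x|unif. f (1 - e + e * x))"
proof -
  have int: "integrable lborel (\<lambda>x. indicator A x *\<^sub>R f x)" if "A \<subseteq> {0..1}" "A \<in> sets borel" for A
  proof (rule Bochner_Integration.integrable_bound)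
    show "integrable lborel (\<lambda>x. indicator {0..1::real} x *\<^sub>R B :: real)"
      by (intro integrable_scaleR_left integrable_real_indicator) auto
    show "AE x in lborel. norm (indicator A x *\<^sub>R f x) \<le> norm (indicator {0..1} x *\<^sub>R B)"
      using B order_trans[OF norm_ge_zero B] that by (auto simp: indicator_def subset_eq)
  qed (use that in auto)
  have ind1: "indicator {0..1 - e} (0 + (1 - e) * x) = (indicator {0..1} x :: real)" for x
    using e by (auto simp: indicator_def zero_le_mult_iff mult_le_cancel_left1)
  have ind2: "indicator {1 - e..1} (1 - e + e * x) = (indicator {0..1} x :: real)" for x
    using e by (auto simp: indicator_def zero_le_mult_iff mult_le_cancel_left2)
  have "(CLINT x|lborel. indicator {0..1 - e} x *\<^sub>R f x)
      = \<bar>1 - e\<bar> *\<^sub>R (CLINT x|lborel. indicator {0..1 - e} (0 + (1 - e) * x) *\<^sub>R f (0 + (1 - e) * x))"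
    by (rule lborel_integral_real_affine) (use e in simp)
  then have "(CLINT x|lborel. indicator {0..1 - e} x *\<^sub>R f x) = (1 - e) * (CLINT x|unif. f ((1 - e) * x))"
    unfolding ind1 using e by (simp add: integral_unif scaleR_conv_of_real)
  moreover have "(CLINT x|lborel. indicator {1 - e..1} x *\<^sub>R f x)
      = \<bar>e\<bar> *\<^sub>R (CLINT x|lborel. indicator {1 - e..1} (1 - e + e * x) *\<^sub>R f (1 - e + e * x))"
    by (rule lborel_integral_real_affine) (use e in simp)
  then have "(CLINT x|lborel. indicator {1 - e..1} x *\<^sub>R f x) = e * (CLINT x|unif. f (1 - e + e * x))"
    unfolding ind2 using e by (simp add: integral_unif scaleR_conv_of_real)
  moreover have "(CLINT x|lborel. indicator {0..1} x *\<^sub>R f x)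
      = (CLINT x|lborel. indicator {0..1 - e} x *\<^sub>R f x + indicator {1 - e..1} x *\<^sub>R f x)"
    by (intro integral_cong_AE) (use AE_lborel_singleton[of "1 - e"] e in \<open>auto simp: indicator_def\<close>)
  moreover have "\<dots> = (CLINT x|lborel. indicator {0..1 - e} x *\<^sub>R f x) + (CLINT x|lborel. indicator {1 - e..1} x *\<^sub>R f x)"
    using e by (intro Bochner_Integration.integral_add int) auto
  ultimately show ?thesis by (simp add: integral_unif)
qed

section \<open>The folded normal distribution and its quantile function\<close>

abbreviation gauss :: "real measure" where
  "gauss \<equiv> std_normal_distribution"

interpretation gauss: prob_space gauss
  by (rule prob_space_normal_density) simp

text \<open>The distribution function of the modulus of a standard normal variable; at negative
  arguments the interval is empty, which gives the correct value \<open>0\<close>.\<close>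

definition folded_cdf :: "real \<Rightarrow> real" where
  "folded_cdf x = measure gauss {-x..x}"

lemma measure_gauss:
  assumes [measurable]: "S \<in> sets borel"
  shows "measure gauss S = (LINT s|lborel. indicator S s * std_normal_density s)"
proof -
  have "measure gauss S = (LINT s|gauss. indicator S s)" by simp
  also have "\<dots> = (LINT s|lborel. std_normal_density s *\<^sub>R indicator S s)"
    by (rule integral_density) auto
  finally show ?thesis by (simp add: mult.commute)
qed

lemma integrable_gauss_indicator:
  "S \<in> sets borel \<Longrightarrow> integrable lborel (\<lambda>s. indicator S s * std_normal_density s)"
  using integrable_real_mult_indicator[of S lborel std_normal_density] integrable_normal_density[of 1 0]
  by (simp add: mult.commute)

lemma measure_gauss_bounds:
  assumes S [measurable]: "S \<in> sets borel" "emeasure lborel S < \<infinity>"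
    and c: "\<And>s. s \<in> S \<Longrightarrow> c \<le> std_normal_density s" and d: "\<And>s. s \<in> S \<Longrightarrow> std_normal_density s \<le> d"
  shows "c * measure lborel S \<le> measure gauss S" "measure gauss S \<le> d * measure lborel S"
proof -
  have int: "integrable lborel (\<lambda>s. indicator S s * k :: real)" for k
    using integrable_real_indicator[OF _ S(2)] by auto
  have "(LINT s|lborel. indicator S s * c) \<le> (LINT s|lborel. indicator S s * std_normal_density s)"
    by (intro integral_mono int integrable_gauss_indicator S) (auto simp: indicator_def c)
  then show "c * measure lborel S \<le> measure gauss S" by (simp add: measure_gauss mult.commute)
  have "(LINT s|lborel. indicator S s * std_normal_density s) \<le> (LINT s|lborel. indicator S s * d)"
    by (intro integral_mono int integrable_gauss_indicator S) (auto simp: indicator_def d)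
  then show "measure gauss S \<le> d * measure lborel S" by (simp add: measure_gauss mult.commute)
qed

lemma std_normal_density_le_1: "std_normal_density s \<le> 1"
proof -
  have "1 \<le> sqrt (2 * pi)" using pi_ge_two by (intro real_le_rsqrt) simp
  then show ?thesis by (simp add: std_normal_density_def divide_le_eq order_trans[of "exp _" 1])
qed

text \<open>The increment is the normal mass of two intervals of length \<open>y - x\<close>, on
  which the density lies between its value at the outer end \<open>y\<close> and \<open>1\<close>.
  The lower bound yields strict monotonicity, the upper one continuity.\<close>

lemma folded_cdf_diff:
  assumes "0 \<le> x" "x \<le> y"
  shows "2 * (y - x) * std_normal_density y \<le> folded_cdf y - folded_cdf x"
    and "folded_cdf y - folded_cdf x \<le> 2 * (y - x)"
proof -
  let ?S = "{-y..<-x} \<union> {x<..y}"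
  have "{-y..y} = {-x..x} \<union> ?S" using assms by auto
  then have "measure gauss {-y..y} = measure gauss {-x..x} + measure gauss ?S"
    using assms by (simp only:) (rule gauss.finite_measure_Union, auto)
  then have eq: "folded_cdf y - folded_cdf x = measure gauss ?S" by (simp add: folded_cdf_def)
  have "emeasure lborel ?S = emeasure lborel {-y..<-x} + emeasure lborel {x<..y}"
    using assms by (intro plus_emeasure[symmetric]) auto
  also have "\<dots> = ennreal (2 * (y - x))" using assms by (simp flip: ennreal_plus)
  finally have e: "emeasure lborel ?S = ennreal (2 * (y - x))" .
  then have m: "measure lborel ?S = 2 * (y - x)" using assms by (simp add: measure_def)
  have le: "std_normal_density y \<le> std_normal_density s" if "s \<in> ?S" for s
  proof -
    have "\<bar>s\<bar> \<le> y" using that assms by auto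
    then have "s\<^sup>2 \<le> y\<^sup>2" by (metis abs_le_square_iff abs_of_nonneg assms order_trans)
    then show ?thesis by (simp add: std_normal_density_def divide_right_mono)
  qed
  show "2 * (y - x) * std_normal_density y \<le> folded_cdf y - folded_cdf x"
    "folded_cdf y - folded_cdf x \<le> 2 * (y - x)"
    using measure_gauss_bounds[of ?S "std_normal_density y" 1] e le std_normal_density_le_1
    unfolding eq m by (auto simp: mult.commute)
qed

lemma folded_cdf_strict_mono: "0 \<le> x \<Longrightarrow> x < y \<Longrightarrow> folded_cdf x < folded_cdf y"
  using folded_cdf_diff(1)[of x y] normal_density_pos[of 1 0 y]
  by (smt (verit, best) mult_pos_pos)

lemma folded_cdf_le_iff: "0 \<le> x \<Longrightarrow> 0 \<le> y \<Longrightarrow> folded_cdf x \<le> folded_cdf y \<longleftrightarrow> x \<le> y"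
  using folded_cdf_strict_mono[of x y] folded_cdf_strict_mono[of y x] by (cases x y rule: linorder_cases) auto

lemma folded_cdf_0 [simp]: "folded_cdf 0 = 0"
proof -
  have "measure gauss {0::real} \<le> 1 * measure lborel {0::real}"
    by (rule measure_gauss_bounds(2)[where c = 0]) (auto simp: std_normal_density_le_1 simp del: std_normal_density_def)
  then show ?thesis using measure_nonneg[of gauss "{0}"] by (simp add: folded_cdf_def)
qed

lemma folded_cdf_nonneg: "0 \<le> folded_cdf x"
  by (simp add: folded_cdf_def)

lemma continuous_folded_cdf: "continuous_on {0..} folded_cdf"
proof (rule continuous_onI)
  fix x e :: real assume "x \<in> {0..}" "e > 0"
  show "\<exists>d>0. \<forall>x'\<in>{0..}. dist x' x < d \<longrightarrow> dist (folded_cdf x') (folded_cdf x) \<le> e"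
  proof (intro exI[of _ "e / 2"] conjI ballI impI)
    fix x' :: real assume x': "x' \<in> {0..}" "dist x' x < e / 2"
    have "\<bar>folded_cdf x' - folded_cdf x\<bar> \<le> 2 * \<bar>x' - x\<bar>"
    proof (cases "x \<le> x'")
      case True
      then show ?thesis using folded_cdf_diff(2)[of x x'] folded_cdf_le_iff[of x x'] x' \<open>x \<in> {0..}\<close> by auto
    next
      case False
      then show ?thesis using folded_cdf_diff(2)[of x' x] folded_cdf_le_iff[of x' x] x' \<open>x \<in> {0..}\<close> by auto
    qed
    then show "dist (folded_cdf x') (folded_cdf x) \<le> e" using x' by (simp add: dist_real_def)
  qed (use \<open>e > 0\<close> in auto)
qed

text \<open>Here \<open>105\<close> is the eighth moment of the standard normal distribution.\<close>

lemma folded_cdf_ge: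
  assumes "x > 0"
  shows "1 - 105 / x ^ 8 \<le> folded_cdf x"
proof -
  have "measure gauss (space gauss - {-x..x}) = 1 - folded_cdf x"
    unfolding folded_cdf_def by (rule gauss.prob_compl) simp
  then have "1 - folded_cdf x = (LINT s|lborel. indicator (- {-x..x}) s * std_normal_density s)"
    by (subst measure_gauss[symmetric]) (auto simp: Compl_eq_Diff_UNIV)
  also have "\<dots> \<le> (LINT s|lborel. (std_normal_density s * s ^ (2 * 4)) / x ^ 8)"
  proof (rule integral_mono)
    show "integrable lborel (\<lambda>s. std_normal_density s * s ^ (2 * 4) / x ^ 8)"
      by (intro integrable_divide integrable_std_normal_moment)
    \<comment> \<open>Markov's inequality for the eighth power: outside the interval,
      \<open>s ^ 8 / x ^ 8\<close> is at least \<open>1\<close>.\<close>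
    show "indicator (- {-x..x}) s * std_normal_density s \<le> std_normal_density s * s ^ (2 * 4) / x ^ 8" for s
    proof (cases "s \<in> {-x..x}")
      case False
      then have "x \<le> \<bar>s\<bar>" by auto
      then have "x ^ 8 \<le> \<bar>s\<bar> ^ 8" using assms by (intro power_mono) auto
      then have "1 \<le> s ^ 8 / x ^ 8" using assms by (simp add: power_even_abs)
      then show ?thesis using False normal_density_nonneg[of 1 0 s] mult_left_mono[of 1 "s ^ 8 / x ^ 8" "std_normal_density s"] by simp
    qed (simp add: normal_density_nonneg)
  qed (rule integrable_gauss_indicator, simp)
  also have "\<dots> = 105 / x ^ 8"
    using integral_std_normal_moment_even[of 4] by (simp add: fact_numeral)
  finally show ?thesis by simp
qed

lemma folded_cdf_less_1: "folded_cdf x < 1"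
proof (cases "x \<ge> 0")
  case True
  have "folded_cdf x < folded_cdf (x + 1)" using True by (intro folded_cdf_strict_mono) auto
  also have "\<dots> \<le> 1" by (simp add: folded_cdf_def gauss.prob_le_1)
  finally show ?thesis .
qed (simp add: folded_cdf_def)

text \<open>Outside \<open>[0, 1)\<close>, in particular at the singular end \<open>1\<close>, the
  value is a default that keeps the function total and nonnegative.\<close>

definition quantile :: "real \<Rightarrow> real" where
  "quantile v = (if 0 \<le> v \<and> v < 1 then SOME x. 0 \<le> x \<and> folded_cdf x = v else 0)"

lemma quantile:
  assumes "0 \<le> v" "v < 1"
  shows "0 \<le> quantile v" "folded_cdf (quantile v) = v"
proof -
  \<comment> \<open>The tail bound \<open>105 / b ^ 8\<close> is then at most \<open>1 - v\<close>,
    so \<open>folded_cdf\<close> reaches \<open>v\<close> on \<open>[0, b]\<close>;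
    \<open>b \<ge> 1\<close> allows \<open>b\<close> to be replaced by \<open>b ^ 8\<close>.\<close>
  define b where "b = max 1 (105 / (1 - v))"
  have b: "b \<ge> 1" "105 / (1 - v) \<le> b" by (auto simp: b_def)
  then have "105 \<le> b * (1 - v)" using assms by (simp add: divide_le_eq)
  also have "\<dots> \<le> b ^ 8 * (1 - v)" using b assms self_le_power[of b 8] by (intro mult_right_mono) auto
  finally have "105 / b ^ 8 \<le> 1 - v" using b by (simp add: divide_le_eq mult.commute)
  then have "v \<le> folded_cdf b" using folded_cdf_ge[of b] b by linarith
  then have "\<exists>x\<ge>0. x \<le> b \<and> folded_cdf x = v"
    using assms b by (intro IVT' continuous_on_subset[OF continuous_folded_cdf]) auto
  then have "\<exists>x. 0 \<le> x \<and> folded_cdf x = v" by blast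
  from someI_ex[OF this] show "0 \<le> quantile v" "folded_cdf (quantile v) = v"
    using assms by (auto simp: quantile_def)
qed

lemma quantile_nonneg: "0 \<le> quantile v"
  using quantile(1)[of v] by (cases "0 \<le> v \<and> v < 1") (auto simp: quantile_def)

lemma quantile_le_iff: "0 \<le> v \<Longrightarrow> v < 1 \<Longrightarrow> 0 \<le> x \<Longrightarrow> quantile v \<le> x \<longleftrightarrow> v \<le> folded_cdf x"
  using quantile[of v] folded_cdf_le_iff[of "quantile v" x] by auto

lemma le_quantile_iff: "0 \<le> v \<Longrightarrow> v < 1 \<Longrightarrow> 0 \<le> x \<Longrightarrow> x \<le> quantile v \<longleftrightarrow> folded_cdf x \<le> v"
  using quantile[of v] folded_cdf_le_iff[of x "quantile v"] by auto

text \<open>The set \<open>{1..}\<close> enters through the default value \<open>0\<close>; it meets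
  the unit interval in a single point.\<close>

lemma quantile_vimage:
  assumes "0 \<le> x"
  shows "quantile -` {..x} = {..folded_cdf x} \<union> {1..}"
proof -
  have "quantile v \<le> x \<longleftrightarrow> v \<le> folded_cdf x \<or> 1 \<le> v" for v
  proof (cases "0 \<le> v \<and> v < 1")
    case False
    then show ?thesis using assms folded_cdf_nonneg[of x] by (auto simp: quantile_def)
  qed (use quantile_le_iff[of v x] assms in auto)
  then show ?thesis by auto
qed

lemma quantile_measurable [measurable]: "quantile \<in> borel_measurable borel"
proof (rule borel_measurableI_le)
  fix x :: real
  have "{v \<in> space borel. quantile v \<le> x} = (if 0 \<le> x then {..folded_cdf x} \<union> {1..} else {})"
  proof (cases "0 \<le> x")
    case False
    then have "\<not> quantile v \<le> x" for v using quantile_nonneg[of v] by linarith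
    then show ?thesis using False by auto
  qed (use quantile_vimage[of x] in auto)
  then show "{v \<in> space borel. quantile v \<le> x} \<in> sets borel" by auto
qed

text \<open>Inverse transform sampling, verified on distribution functions.\<close>

lemma distr_quantile: "distr unif borel quantile = distr gauss borel abs"
proof (rule cdf_unique)
  show "real_distribution (distr unif borel quantile)"
    by (rule unif.real_distribution_distr) simp
  show "real_distribution (distr gauss borel abs)"
    by (rule gauss.real_distribution_distr) simp
  show "cdf (distr unif borel quantile) = cdf (distr gauss borel abs)"
  proof
    fix x :: real
    show "cdf (distr unif borel quantile) x = cdf (distr gauss borel abs) x"
    proof (cases "0 \<le> x")
      case True
      have h: "0 \<le> folded_cdf x" "folded_cdf x < 1" by (rule folded_cdf_nonneg folded_cdf_less_1)+
      have "cdf (distr unif borel quantile) x = measure unif ({..folded_cdf x} \<union> {1..})"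
        unfolding cdf_def by (subst measure_distr) (auto simp: quantile_vimage[OF True])
      also have "emeasure unif ({..folded_cdf x} \<union> {1..}) = emeasure lborel ({0..folded_cdf x} \<union> {1})"
      proof (subst emeasure_density)
        have "indicator {0..1} s * indicator ({..folded_cdf x} \<union> {1..}) s = (indicator ({0..folded_cdf x} \<union> {1}) s :: ennreal)" for s
          using h by (auto simp: indicator_def)
        then show "(\<integral>\<^sup>+ s. indicator {0..1} s * indicator ({..folded_cdf x} \<union> {1..}) s \<partial>lborel)
            = emeasure lborel ({0..folded_cdf x} \<union> {1})"
          by (simp only:) (rule nn_integral_indicator, simp)
      qed auto
      then have "measure unif ({..folded_cdf x} \<union> {1..}) = folded_cdf x"
        using h by (subst (asm) emeasure_Un_null_set) (auto simp: measure_def null_sets_def)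
      also have "folded_cdf x = measure gauss (abs -` {..x})"
        unfolding folded_cdf_def by (rule arg_cong[where f = "measure gauss"]) auto
      also have "\<dots> = cdf (distr gauss borel abs) x"
        unfolding cdf_def by (subst measure_distr) auto
      finally show ?thesis .
    next
      case False
      then have "quantile -` {..x} = {}" "abs -` {..x} = {}"
        using quantile_nonneg order_trans by (auto simp: vimage_def)
      then show ?thesis unfolding cdf_def by (subst (1 2) measure_distr) auto
    qed
  qed
qed

text \<open>The cosine is even, so it does not see the difference between a normal variable and its
  modulus; what remains is the real part of the normal characteristic function.\<close>

lemma integral_cos_quantile: "(LINT u|unif. cos (c * quantile u)) = exp (- c\<^sup>2 / 2)"
proof -
  have "(LINT u|unif. cos (c * quantile u)) = (LINT y|distr unif borel quantile. cos (c * y))"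
    by (subst integral_distr) auto
  also have "\<dots> = (LINT s|gauss. cos (c * \<bar>s\<bar>))"
    unfolding distr_quantile by (subst integral_distr) auto
  also have "\<dots> = (LINT s|gauss. Re (iexp (c * s)))"
    by (intro Bochner_Integration.integral_cong refl) (auto simp: abs_if Re_exp)
  also have "\<dots> = Re (char gauss c)"
    unfolding char_def by (intro integral_Re gauss.integrable_const_bound[of _ 1]) (auto simp del: of_real_mult)
  finally show ?thesis by (simp add: char_std_normal_distribution)
qed

section \<open>Gaussian variables with an open domain\<close>

definition eps :: "nat \<Rightarrow> real" where
  "eps i = 1 / (real i + 2)\<^sup>2"

lemma eps_bounds: "0 < eps i" "eps i < 1"
proof -
  have "1 < (real i + 2)\<^sup>2" by (rule power2_gt_1_iff[THEN iffD2]) simp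
  then show "0 < eps i" "eps i < 1" by (auto simp: eps_def)
qed

text \<open>
  The level is \<open>m\<close> with probability \<open>q m - q (m - 1)\<close>, where \<open>q m = (m + 1) / (m + 2)\<close> and \<open>q (- 1) = 0\<close>.
  At level \<open>m\<close> the seeds with index \<open>i \<ge> m\<close> are conditioned to be below \<open>1 - eps i\<close>, the one with index
  \<open>m - 1\<close> is conditioned to be above, and those before are unconditioned.  The mixture is i.i.d. because
  \<open>eps i = (q (i + 1) - q i) / q (i + 1)\<close>.  As \<open>eps\<close> decays only polynomially, the bounds on the
  coefficients grow slowly enough for the series to converge.
\<close>

definition cond_seed :: "nat \<Rightarrow> nat \<Rightarrow> real \<Rightarrow> real" where
  "cond_seed m i u = (if i + 1 < m then u else if i + 1 = m then 1 - eps i + eps i * u else (1 - eps i) * u)"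

definition row :: "nat \<Rightarrow> nat \<Rightarrow> nat" where
  "row r j = prod_encode (r, j)"

definition selector :: "(nat \<Rightarrow> bool) \<Rightarrow> real" where
  "selector \<omega> = ureal (subseq_by (row 0) \<omega>)"

text \<open>Within a row, position \<open>0\<close> is reserved for the sign of the coefficient and
  the odd positions feed its seed, so sign and seed are independent.\<close>

definition row_seed :: "(nat \<Rightarrow> bool) \<Rightarrow> real" where
  "row_seed b = ureal (subseq_by (\<lambda>j. 2 * j + 1) b)"

definition seed :: "(nat \<Rightarrow> bool) \<Rightarrow> nat \<Rightarrow> real" where
  "seed \<omega> i = row_seed (subseq_by (row (Suc i)) \<omega>)"

definition row_gauss :: "nat \<Rightarrow> nat \<Rightarrow> (nat \<Rightarrow> bool) \<Rightarrow> real" where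
  "row_gauss m i b = (if b 0 then 1 else - 1) * quantile (cond_seed m i (row_seed b))"

text \<open>Both inequalities are strict, so that a finite prefix confirms them; the excluded
  endpoints form a null event.\<close>

definition at_level :: "nat \<Rightarrow> real \<Rightarrow> bool" where
  "at_level m u \<longleftrightarrow> real m / (real m + 1) < u \<and> u < (real m + 1) / (real m + 2)"

text \<open>\<open>LEAST\<close> makes the level a total measurable function; by
  \<open>level_eq\<close> it agrees with \<open>at_level\<close> wherever the latter holds.\<close>

definition level :: "(nat \<Rightarrow> bool) \<Rightarrow> nat" where
  "level \<omega> = (LEAST m. selector \<omega> < (real m + 1) / (real m + 2))"

definition zeta :: "(nat \<Rightarrow> bool) \<Rightarrow> nat \<Rightarrow> real" where
  "zeta \<omega> i = row_gauss (level \<omega>) i (subseq_by (row (Suc i)) \<omega>)"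

lemma inj_row: "inj (row r)"
  by (auto simp: inj_def row_def)

lemma disjoint_rows: "disjoint_family_on (\<lambda>r. range (row r)) I"
  by (auto simp: disjoint_family_on_def row_def)

lemma frac_step_mono: "m \<le> n \<Longrightarrow> (real m + 1) / (real m + 2) \<le> (real n + 1) / (real n + 2)"
  by (simp add: frac_le_eq divide_simps) (simp add: algebra_simps)

lemma frac_step_less:
  assumes "m < n" shows "(real m + 1) / (real m + 2) \<le> real n / (real n + 1)"
proof -
  have "real m + 1 \<le> real n" using assms by linarith
  then show ?thesis by (simp add: divide_simps) (simp add: algebra_simps)
qed

lemma at_level_unique:
  assumes "at_level m u" "at_level n u" shows "m = n"
proof -
  have False if "at_level m u" "at_level n u" "m < n" for m n
    using that frac_step_less[of m n] by (simp add: at_level_def)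
  with assms show ?thesis by (cases m n rule: linorder_cases) blast+
qed

lemma level_eq:
  assumes "at_level m (selector \<omega>)" shows "level \<omega> = m"
  unfolding level_def
proof (rule Least_equality)
  show "selector \<omega> < (real m + 1) / (real m + 2)" using assms by (simp add: at_level_def)
  fix n assume "selector \<omega> < (real n + 1) / (real n + 2)"
  then show "m \<le> n"
    using assms frac_step_less[of n m] by (cases "m \<le> n") (auto simp: at_level_def)
qed

lemma level_gt:
  assumes "(real n + 1) / (real n + 2) < selector \<omega>" "selector \<omega> < 1" shows "n < level \<omega>"
proof (rule ccontr)
  have "\<exists>m. selector \<omega> < (real m + 1) / (real m + 2)"
  proof -
    obtain m :: nat where "1 / (1 - selector \<omega>) < real m" using reals_Archimedean2 by blast
    then have "1 < real m * (1 - selector \<omega>)" using assms by (simp add: divide_less_eq)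
    also have "\<dots> \<le> (real m + 2) * (1 - selector \<omega>)" using assms by (intro mult_right_mono) auto
    finally have "selector \<omega> < (real m + 1) / (real m + 2)" by (simp add: less_divide_eq algebra_simps)
    then show ?thesis by blast
  qed
  then have "selector \<omega> < (real (level \<omega>) + 1) / (real (level \<omega>) + 2)"
    unfolding level_def by (rule LeastI_ex)
  moreover assume "\<not> n < level \<omega>"
  ultimately show False using frac_step_mono[of "level \<omega>" n] assms by linarith
qed

lemma row_seed_measurable [measurable]: "row_seed \<in> borel_measurable coin_space"
  unfolding row_seed_def[abs_def] by measurable

lemma selector_measurable [measurable]: "selector \<in> borel_measurable coin_space"
  unfolding selector_def[abs_def] by measurable

lemma seed_measurable [measurable]: "(\<lambda>\<omega>. seed \<omega> i) \<in> borel_measurable coin_space"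
  unfolding seed_def[abs_def] by measurable

lemma cond_seed_measurable [measurable]: "cond_seed m i \<in> borel_measurable borel"
  unfolding cond_seed_def[abs_def] by measurable

lemma row_gauss_measurable [measurable]: "row_gauss m i \<in> borel_measurable coin_space"
  unfolding row_gauss_def[abs_def] by measurable

lemma level_measurable [measurable]: "level \<in> measurable coin_space (count_space UNIV)"
  unfolding level_def[abs_def] by measurable

lemma zeta_measurable [measurable]: "(\<lambda>\<omega>. zeta \<omega> i) \<in> borel_measurable coin_space"
proof -
  have "(\<lambda>\<omega>. (\<lambda>m \<omega>. row_gauss m i (subseq_by (row (Suc i)) \<omega>)) (level \<omega>) \<omega>) \<in> borel_measurable coin_space"
    by (rule measurable_compose_countable) measurable
  then show ?thesis by (simp add: zeta_def)
qed

lemma distr_selector: "distr coin_space borel selector = unif"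
proof -
  have "distr coin_space borel selector = distr (distr coin_space coin_space (subseq_by (row 0))) borel ureal"
    by (subst distr_distr) (auto simp: selector_def[abs_def] comp_def)
  then show ?thesis by (simp add: distr_subseq_by[OF inj_row] distr_ureal)
qed

lemma distr_seed: "distr coin_space borel (\<lambda>\<omega>. seed \<omega> i) = unif"
proof -
  have inj: "inj (\<lambda>j::nat. 2 * j + 1)" by (auto simp: inj_def)
  have "distr coin_space borel (\<lambda>\<omega>. seed \<omega> i)
      = distr (distr (distr coin_space coin_space (subseq_by (row (Suc i)))) coin_space (subseq_by (\<lambda>j. 2 * j + 1))) borel ureal"
    by (subst distr_distr, simp, simp, subst distr_distr) (auto simp: seed_def[abs_def] row_seed_def comp_def)
  then show ?thesis by (simp only: distr_subseq_by[OF inj_row] distr_subseq_by[OF inj] distr_ureal)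
qed

lemma AE_unif_neq: "AE x in unif. x \<noteq> c"
  using AE_lborel_singleton[of c] by (subst AE_density) auto

lemma AE_selector: "AE \<omega> in coin_space. selector \<omega> \<noteq> c"
  using AE_unif_neq[of c] unfolding distr_selector[symmetric] by (subst (asm) AE_distr_iff) auto

lemma AE_seed: "AE \<omega> in coin_space. seed \<omega> i \<noteq> c"
  using AE_unif_neq[of c] unfolding distr_seed[of i, symmetric] by (subst (asm) AE_distr_iff) auto

lemma selector_bounds: "0 \<le> selector \<omega>" "selector \<omega> \<le> 1"
  by (auto simp: selector_def ureal_bounds)

lemma seed_bounds: "0 \<le> seed \<omega> i" "seed \<omega> i \<le> 1"
  by (auto simp: seed_def row_seed_def ureal_bounds)

lemma ex_at_level:
  assumes "selector \<omega> < 1" "\<And>m. selector \<omega> \<noteq> real m / (real m + 1)"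
  shows "at_level (level \<omega>) (selector \<omega>)"
proof -
  have upper: "selector \<omega> < (real (level \<omega>) + 1) / (real (level \<omega>) + 2)"
  proof (rule ccontr)
    assume "\<not> ?thesis"
    then have "(real (level \<omega>) + 1) / (real (level \<omega>) + 2) < selector \<omega>"
      using assms(2)[of "Suc (level \<omega>)"] by (simp add: add.commute)
    then show False using level_gt[of "level \<omega>" \<omega>] assms(1) by simp
  qed
  moreover have "real (level \<omega>) / (real (level \<omega>) + 1) < selector \<omega>"
  proof (cases "level \<omega>")
    case 0
    then show ?thesis using selector_bounds(1)[of \<omega>] assms(2)[of 0] by simp
  next
    case (Suc n)
    then have "\<not> selector \<omega> < (real n + 1) / (real n + 2)"
      using not_less_Least[of n "\<lambda>m. selector \<omega> < (real m + 1) / (real m + 2)"] unfolding level_def by simp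
    then show ?thesis using assms(2)[of "Suc n"] Suc by (simp add: add.commute)
  qed
  ultimately show ?thesis by (simp add: at_level_def)
qed

section \<open>The domain: full measure and openness\<close>

definition gauss_dom :: "(nat \<Rightarrow> bool) set" where
  "gauss_dom = {\<omega>. \<exists>m. at_level m (selector \<omega>) \<and> (\<forall>i<m. seed \<omega> i < 1)}"

lemma gauss_domD:
  assumes "\<omega> \<in> gauss_dom"
  shows "at_level (level \<omega>) (selector \<omega>)" "i < level \<omega> \<Longrightarrow> seed \<omega> i < 1"
  using assms level_eq by (auto simp: gauss_dom_def)

lemma AE_gauss_dom: "AE \<omega> in coin_space. \<omega> \<in> gauss_dom"
proof -
  have "AE \<omega> in coin_space. \<forall>m. selector \<omega> \<noteq> real m / (real m + 1)"
    by (intro AE_all_countable[THEN iffD2] allI AE_selector)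
  moreover have "AE \<omega> in coin_space. \<forall>i. seed \<omega> i \<noteq> 1"
    by (intro AE_all_countable[THEN iffD2] allI AE_seed)
  moreover note AE_selector[of 1]
  ultimately show ?thesis
  proof eventually_elim
    case (elim \<omega>)
    then have "at_level (level \<omega>) (selector \<omega>)"
      using selector_bounds[of \<omega>] by (intro ex_at_level) (auto simp: less_le)
    moreover have "seed \<omega> i < 1" for i using elim(2) seed_bounds[of \<omega> i] by (auto simp: less_le)
    ultimately show ?case by (auto simp: gauss_dom_def)
  qed
qed

lemma gauss_dom_sets [measurable]: "gauss_dom \<in> sets coin_space"
proof -
  have "{\<omega> \<in> space coin_space. \<exists>m. at_level m (selector \<omega>) \<and> (\<forall>i<m. seed \<omega> i < 1)} \<in> sets coin_space"
    unfolding at_level_def by measurable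
  then show ?thesis by (simp add: gauss_dom_def)
qed

lemma prob_gauss_dom: "measure coin_space gauss_dom = 1"
  using AE_gauss_dom gauss_dom_sets by (simp add: coin.prob_eq_1)

lemma continuous_subseq_by: "continuous_on UNIV (subseq_by e)"
  unfolding subseq_by_def[abs_def]
  by (rule continuous_on_coordinatewise_then_product) (rule continuous_on_product_coordinates)

lemma open_gauss_dom: "open gauss_dom"
proof -
  have c: "continuous_on UNIV (\<lambda>\<omega>. ureal (subseq_by e \<omega>))" for e
    by (rule continuous_on_compose2[OF continuous_ureal continuous_subseq_by]) auto
  have s: "continuous_on UNIV selector" unfolding selector_def[abs_def] by (rule c)
  have t: "continuous_on UNIV (\<lambda>\<omega>. seed \<omega> i)" for i
    unfolding seed_def[abs_def] row_seed_def
    by (rule continuous_on_compose2[OF c continuous_subseq_by]) auto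
  have "gauss_dom = (\<Union>m. {\<omega>. real m / (real m + 1) < selector \<omega>} \<inter> {\<omega>. selector \<omega> < (real m + 1) / (real m + 2)}
      \<inter> (\<Inter>i\<in>{..<m}. {\<omega>. seed \<omega> i < 1}))"
    by (auto simp: gauss_dom_def at_level_def)
  also have "open \<dots>"
    by (intro open_UN open_Int open_INT ballI open_Collect_less s t continuous_on_const) auto
  finally show ?thesis .
qed

section \<open>The joint law of the coefficients\<close>

definition cond_char :: "nat \<Rightarrow> nat \<Rightarrow> real \<Rightarrow> complex" where
  "cond_char m i c = (CLINT b|coin_space. iexp (c * row_gauss m i b))"

text \<open>The sign is symmetric and independent of the seed, so the sine part of the exponential
  integrates to \<open>0\<close>.\<close>

lemma cond_char_eq:
  "cond_char m i c = (CLINT u|unif. complex_of_real (cos (c * quantile (cond_seed m i u))))"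
proof -
  define h where "h u = quantile (cond_seed m i u)" for u
  have h [measurable]: "h \<in> borel_measurable borel" unfolding h_def[abs_def] by measurable
  \<comment> \<open>Even and odd positions of the row give independent substreams; of the even one
    only the first bit, the sign, is read.\<close>
  define e :: "bool \<Rightarrow> nat \<Rightarrow> nat" where "e r j = (if r then 2 * j else 2 * j + 1)" for r j
  have inj: "inj (e r)" for r by (auto simp: inj_def e_def)
  have "2 * x \<noteq> Suc (2 * y)" for x y :: nat by arith
  then have disj: "disjoint_family_on (\<lambda>r. range (e r)) UNIV"
    by (auto simp: disjoint_family_on_def e_def) (metis (full_types))+
  define s :: "bool \<Rightarrow> complex" where "s b = (if b then 1 else - 1)" for b
  define f where "f r b = (if r then s (b 0) else complex_of_real (sin (c * h (ureal b))))" for r b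
  have f_meas: "f r \<in> borel_measurable coin_space" for r
    unfolding f_def[abs_def] s_def by (cases r) auto
  have prod: "(\<Prod>r\<in>UNIV. f r (subseq_by (e r) b)) = s (b 0) * complex_of_real (sin (c * h (row_seed b)))" for b
    by (simp add: UNIV_bool f_def row_seed_def subseq_by_def e_def[abs_def])
  have "(CLINT b|coin_space. (\<Prod>r\<in>UNIV. f r (subseq_by (e r) b))) = (\<Prod>r\<in>UNIV. CLINT b|coin_space. f r b)"
    by (rule integral_prod_subseq_by[where B = 1]) (auto simp: inj disj f_meas, auto simp: f_def s_def)
  moreover have "(CLINT b|coin_space. f True b) = 0"
  proof -
    have fT: "f True = (\<lambda>b. s (b 0))" by (auto simp: f_def fun_eq_iff)
    have "(CLINT b|coin_space. f True b) = (CLINT x|distr coin_space coin (\<lambda>\<omega>. \<omega> 0). s x)"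
      by (subst integral_distr[OF measurable_coin_component]) (auto simp: fT)
    also have "distr coin_space coin (\<lambda>\<omega>. \<omega> 0) = coin"
      unfolding coin_space_def by (rule distr_PiM_component) (auto simp: prob_space_measure_pmf)
    also have "(CLINT x|coin. s x) = 0"
      by (subst integral_measure_pmf[of UNIV]) (auto simp: UNIV_bool s_def)
    finally show ?thesis .
  qed
  ultimately have zero: "(CLINT b|coin_space. s (b 0) * complex_of_real (sin (c * h (row_seed b)))) = 0"
    unfolding prod by (simp add: UNIV_bool)
  have expand: "iexp (c * row_gauss m i b) = complex_of_real (cos (c * h (row_seed b)))
      + \<i> * (s (b 0) * complex_of_real (sin (c * h (row_seed b))))" for b
    by (auto simp: row_gauss_def h_def s_def complex_eq_iff Re_exp Im_exp)
  have i1: "integrable coin_space (\<lambda>b. complex_of_real (cos (c * h (row_seed b))))"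
    by (intro coin.integrable_const_bound[of _ 1]) auto
  have i2: "integrable coin_space (\<lambda>b. \<i> * (s (b 0) * complex_of_real (sin (c * h (row_seed b)))))"
    by (intro coin.integrable_const_bound[of _ 1]) (auto simp: s_def norm_mult)
  have "cond_char m i c = (CLINT b|coin_space. complex_of_real (cos (c * h (row_seed b))))"
    unfolding cond_char_def expand
    by (simp only: Bochner_Integration.integral_add[OF i1 i2] integral_mult_right_zero zero) simp
  also have "\<dots> = (CLINT b|coin_space. complex_of_real (cos (c * h (ureal b))))"
    unfolding row_seed_def by (rule integral_subseq_by) (auto simp: inj_def)
  also have "\<dots> = (CLINT u|unif. complex_of_real (cos (c * h u)))"
    by (rule integral_ureal) simp
  finally show ?thesis by (simp add: h_def)
qed

lemma cond_char_before: "i + 1 < m \<Longrightarrow> cond_char m i c = complex_of_real (exp (- c\<^sup>2 / 2))"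
proof -
  assume "i + 1 < m"
  then have "cond_char m i c = complex_of_real (LINT u|unif. cos (c * quantile u))"
    by (simp only: cond_char_eq cond_seed_def if_True integral_complex_of_real)
  then show ?thesis by (simp add: integral_cos_quantile)
qed

text \<open>A uniform seed is split at \<open>1 - eps i\<close>: the lower part is the conditioned
  seed at every level \<open>m \<le> i\<close>, the upper part the one at level
  \<open>Suc i\<close>.\<close>

lemma cond_char_mix:
  assumes "m \<le> i"
  shows "complex_of_real (exp (- c\<^sup>2 / 2)) = (1 - eps i) * cond_char m i c + eps i * cond_char (Suc i) i c"
proof -
  have "complex_of_real (exp (- c\<^sup>2 / 2)) = (CLINT u|unif. complex_of_real (cos (c * quantile u)))"
    by (simp add: integral_cos_quantile)
  also have "\<dots> = (1 - eps i) * (CLINT u|unif. complex_of_real (cos (c * quantile ((1 - eps i) * u))))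
      + eps i * (CLINT u|unif. complex_of_real (cos (c * quantile (1 - eps i + eps i * u))))"
    by (rule trans[OF integral_unif_split[where B = 1 and e = "eps i"]]) (use eps_bounds[of i] in auto)
  finally show ?thesis using assms by (simp add: cond_char_eq cond_seed_def)
qed

lemma prob_at_level: "measure coin_space {\<omega>. at_level m (selector \<omega>)} = (real m + 1) / (real m + 2) - real m / (real m + 1)"
proof -
  let ?I = "{real m / (real m + 1)<..<(real m + 1) / (real m + 2)}"
  have le: "real m / (real m + 1) \<le> (real m + 1) / (real m + 2)" by (simp add: divide_simps) (simp add: algebra_simps)
  have "measure coin_space {\<omega>. at_level m (selector \<omega>)} = measure (distr coin_space borel selector) ?I"
    by (subst measure_distr) (auto simp: at_level_def vimage_def)
  also have "\<dots> = measure unif ?I" by (simp only: distr_selector)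
  also have "\<dots> = (real m + 1) / (real m + 2) - real m / (real m + 1)"
  proof -
    have "0 \<le> real m / (real m + 1)" "(real m + 1) / (real m + 2) \<le> 1" by (simp_all add: divide_le_eq)
    then have "?I \<subseteq> {0..1}"
      unfolding subset_iff greaterThanLessThan_iff atLeastAtMost_iff
      by (meson less_imp_le order.strict_trans1 order.strict_trans2)
    then have "indicator {0..1} s * indicator ?I s = (indicator ?I s :: ennreal)" for s by (auto simp: indicator_def)
    then have "emeasure unif ?I = emeasure lborel ?I" by (simp add: emeasure_density)
    then show ?thesis using le by (simp add: measure_def)
  qed
  finally show ?thesis .
qed

text \<open>Given the level the coefficients are independent, so the transform is a mixture of
  products of \<open>cond_char\<close>. The fact \<open>telescope\<close> evaluates the mixture over
  the levels up to \<open>n\<close>, and the event \<open>q n < selector\<close> supplies the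
  remaining mass \<open>1 - q n\<close>.\<close>

theorem zeta_joint_char:
  "(CLINT \<omega>|coin_space. iexp (\<Sum>i<n. c i * zeta \<omega> i)) = (\<Prod>i<n. complex_of_real (exp (- (c i)\<^sup>2 / 2)))"
proof -
  define q where "q m = (real m + 1) / (real m + 2)" for m
  define p where "p m = q m - real m / (real m + 1)" for m
  define S where "S r = (if r < Suc n then {u. at_level r u} else {u. q n < u})" for r
  define pr where "pr r = measure coin_space {\<omega>. selector \<omega> \<in> S r}" for r
  have S_sets [measurable]: "S r \<in> sets borel" for r by (auto simp: S_def at_level_def)
  \<comment> \<open>All levels above \<open>n\<close> leave the first \<open>n\<close> seeds
    unconditioned; they are merged into the index \<open>Suc n\<close> and represented by the level
    \<open>n + 2\<close>.\<close>
  define N where "N r = (if r \<le> n then r else n + 2)" for r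
  define T where "T r \<omega> = indicator (S r) (selector \<omega>) * (\<Prod>i<n. iexp (c i * row_gauss (N r) i (subseq_by (row (Suc i)) \<omega>)))" for r \<omega>
  have int_T: "integrable coin_space (T r) \<and> (CLINT \<omega>|coin_space. T r \<omega>) = pr r * (\<Prod>i<n. cond_char (N r) i (c i))" for r
  proof -
    define f where "f k b = (case k of 0 \<Rightarrow> indicator (S r) (ureal b) | Suc i \<Rightarrow> iexp (c i * row_gauss (N r) i b))" for k b
    have f_meas: "f k \<in> borel_measurable coin_space" for k
      unfolding f_def[abs_def] by (cases k) auto
    have f_le: "norm (f k b) \<le> 1" for k b
      by (cases k) (auto simp: f_def indicator_def simp del: of_real_mult)
    have T_eq: "T r \<omega> = (\<Prod>k<Suc n. f k (subseq_by (row k) \<omega>))" for \<omega>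
      unfolding T_def prod.lessThan_Suc_shift by (simp add: f_def selector_def)
    have [measurable]: "(\<lambda>\<omega>. \<Prod>k<Suc n. f k (subseq_by (row k) \<omega>)) \<in> borel_measurable coin_space"
      by (intro borel_measurable_prod measurable_compose[OF subseq_by_measurable f_meas])
    have "norm (\<Prod>k<Suc n. f k (subseq_by (row k) \<omega>)) \<le> 1" for \<omega>
      unfolding prod_norm[symmetric] by (intro prod_le_1) (auto simp: f_le)
    then have "integrable coin_space (T r)"
      unfolding T_eq[abs_def]
      by (intro coin.integrable_const_bound[of _ 1] always_eventually allI) (simp_all del: prod.lessThan_Suc)
    moreover have "(CLINT \<omega>|coin_space. T r \<omega>) = (\<Prod>k<Suc n. CLINT b|coin_space. f k b)"
      unfolding T_eq by (rule integral_prod_subseq_by[OF _ inj_row disjoint_rows f_meas f_le]) simp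
    moreover have "(CLINT b|coin_space. f 0 b) = pr r"
    proof -
      have "(CLINT b|coin_space. f 0 b) = (CLINT \<omega>|coin_space. f 0 (subseq_by (row 0) \<omega>))"
        by (rule integral_subseq_by[symmetric, OF inj_row f_meas])
      also have "\<dots> = (CLINT \<omega>|coin_space. complex_of_real (indicator {\<omega>. selector \<omega> \<in> S r} \<omega>))"
        by (intro Bochner_Integration.integral_cong) (auto simp: f_def selector_def indicator_def)
      also have "\<dots> = pr r" by (subst integral_complex_of_real) (simp add: pr_def)
      finally show ?thesis .
    qed
    moreover have "f (Suc i) = (\<lambda>b. iexp (c i * row_gauss (N r) i b))" for i
      by (auto simp: f_def fun_eq_iff)
    ultimately show ?thesis unfolding prod.lessThan_Suc_shift by (simp add: cond_char_def)
  qed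
  have pr_eq: "pr m = p m" if "m \<le> n" for m
    using that prob_at_level[of m] by (simp add: pr_def p_def q_def S_def)
  have pr_last: "pr (Suc n) = 1 - q n"
  proof -
    have q01: "0 \<le> q n" "q n \<le> 1" by (auto simp: q_def)
    have "pr (Suc n) = measure (distr coin_space borel selector) {q n<..}"
      unfolding pr_def S_def by (subst measure_distr) (auto simp: vimage_def)
    also have "\<dots> = measure unif {q n<..}" by (simp only: distr_selector)
    also have "\<dots> = 1 - q n"
    proof -
      have "indicator {0..1} s * indicator {q n<..} s = (indicator {q n<..1} s :: ennreal)" for s
        using q01 by (auto simp: indicator_def)
      then have "emeasure unif {q n<..} = emeasure lborel {q n<..1}" by (simp add: emeasure_density)
      then show ?thesis using q01 by (simp add: measure_def)
    qed
    finally show ?thesis .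
  qed
  have decomp: "AE \<omega> in coin_space. iexp (\<Sum>i<n. c i * zeta \<omega> i) = (\<Sum>r<Suc (Suc n). T r \<omega>)"
  proof -
    have "AE \<omega> in coin_space. \<forall>m. selector \<omega> \<noteq> real m / (real m + 1)"
      by (intro AE_all_countable[THEN iffD2] allI AE_selector)
    moreover note AE_selector[of 1] 
    ultimately show ?thesis
    proof eventually_elim
      case (elim \<omega>)
      then have lt1: "selector \<omega> < 1" using selector_bounds(2)[of \<omega>] by simp
      then have lv: "at_level (level \<omega>) (selector \<omega>)" using elim by (intro ex_at_level) auto
      define r where "r = min (level \<omega>) (Suc n)"
      have in_S: "selector \<omega> \<in> S k \<longleftrightarrow> k = r" if "k < Suc (Suc n)" for k
      proof (cases "k < Suc n")
        case True
        then show ?thesis using lv at_level_unique[OF lv, of k] by (auto simp: S_def r_def)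
      next
        case False
        then have k: "k = Suc n" using that by simp
        have "q n < selector \<omega> \<longleftrightarrow> n < level \<omega>"
        proof
          assume "n < level \<omega>"
          then have "q n \<le> real (level \<omega>) / (real (level \<omega>) + 1)"
            using frac_step_less[of n "level \<omega>"] by (simp add: q_def)
          then show "q n < selector \<omega>" using lv by (simp add: at_level_def)
        qed (use level_gt lt1 in \<open>simp add: q_def\<close>)
        then show ?thesis by (auto simp: S_def k r_def)
      qed
      have "(\<Sum>k<Suc (Suc n). T k \<omega>) = (\<Sum>k<Suc (Suc n). if k = r then T r \<omega> else 0)"
        by (rule sum.cong) (auto simp: T_def in_S)
      also have "\<dots> = T r \<omega>" by (simp add: r_def)
      also have "\<dots> = (\<Prod>i<n. iexp (c i * row_gauss (N r) i (subseq_by (row (Suc i)) \<omega>)))"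
        using in_S[of r] by (simp add: T_def r_def)
      also have "\<dots> = (\<Prod>i<n. iexp (c i * zeta \<omega> i))"
      proof (intro prod.cong refl)
        fix i assume "i \<in> {..<n}"
        then have "cond_seed (N r) i = cond_seed (level \<omega>) i"
          by (auto simp: N_def r_def cond_seed_def fun_eq_iff)
        then show "iexp (c i * row_gauss (N r) i (subseq_by (row (Suc i)) \<omega>)) = iexp (c i * zeta \<omega> i)"
          by (simp add: zeta_def row_gauss_def)
      qed
      also have "\<dots> = iexp (\<Sum>i<n. c i * zeta \<omega> i)"
        by (simp only: sum_distrib_left of_real_sum exp_sum[OF finite_lessThan])
      finally show ?case by simp
    qed
  qed
  \<comment> \<open>Given that the level is at most \<open>k\<close>, an event of probability
    \<open>q k\<close>, the first \<open>k\<close> coefficients are i.i.d. normal. In passing to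
    \<open>Suc k\<close>, the new level supplies exactly the upper part that the earlier levels cut
    off from coefficient \<open>k\<close>.\<close>
  have telescope: "(\<Sum>m<Suc k. complex_of_real (p m) * (\<Prod>i<k. cond_char m i (c i)))
      = complex_of_real (q k) * (\<Prod>i<k. complex_of_real (exp (- (c i)\<^sup>2 / 2)))" for k
  proof (induction k)
    case 0
    then show ?case by (simp add: p_def q_def)
  next
    case (Suc k)
    let ?F = "\<lambda>i. complex_of_real (exp (- (c i)\<^sup>2 / 2))"
    have q1: "q (Suc k) * (1 - eps k) = q k" "q (Suc k) * eps k = p (Suc k)"
      by (simp_all add: q_def p_def eps_def power2_eq_square divide_simps) (simp_all add: algebra_simps)
    have eq0: "cond_char m k (c k) = cond_char 0 k (c k)" if "m < Suc k" for m
      using that by (simp add: cond_char_eq cond_seed_def)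
    have "(\<Sum>m<Suc k. complex_of_real (p m) * (\<Prod>i<Suc k. cond_char m i (c i)))
        = (\<Sum>m<Suc k. complex_of_real (p m) * (\<Prod>i<k. cond_char m i (c i))) * cond_char 0 k (c k)"
      unfolding sum_distrib_right
    proof (intro sum.cong refl)
      fix m assume "m \<in> {..<Suc k}"
      then have "cond_char m k (c k) = cond_char 0 k (c k)" by (intro eq0) simp
      then show "complex_of_real (p m) * (\<Prod>i<Suc k. cond_char m i (c i))
          = complex_of_real (p m) * (\<Prod>i<k. cond_char m i (c i)) * cond_char 0 k (c k)"
        by (simp only: prod.lessThan_Suc mult.assoc)
    qed
    also have "\<dots> = complex_of_real (q k) * (\<Prod>i<k. ?F i) * cond_char 0 k (c k)" by (simp only: Suc.IH)
    finally have 1: "(\<Sum>m<Suc k. complex_of_real (p m) * (\<Prod>i<Suc k. cond_char m i (c i)))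
        = complex_of_real (q k) * (\<Prod>i<k. ?F i) * cond_char 0 k (c k)" .
    have 2: "(\<Prod>i<Suc k. cond_char (Suc k) i (c i)) = (\<Prod>i<k. ?F i) * cond_char (Suc k) k (c k)"
    proof -
      have "cond_char (Suc k) i (c i) = ?F i" if "i < k" for i using that cond_char_before[of i "Suc k" "c i"] by simp
      then have "(\<Prod>i<k. cond_char (Suc k) i (c i)) = (\<Prod>i<k. ?F i)" by (intro prod.cong) auto
      then show ?thesis by simp
    qed
    have "?F k = (1 - eps k) * cond_char 0 k (c k) + eps k * cond_char (Suc k) k (c k)"
      by (rule cond_char_mix) simp
    then have "complex_of_real (q (Suc k)) * ?F k = complex_of_real (q (Suc k) * (1 - eps k)) * cond_char 0 k (c k)
        + complex_of_real (q (Suc k) * eps k) * cond_char (Suc k) k (c k)"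
      by (simp only: of_real_mult of_real_diff of_real_1 distrib_left mult.assoc)
    then have 3: "complex_of_real (q (Suc k)) * ?F k = complex_of_real (q k) * cond_char 0 k (c k)
        + complex_of_real (p (Suc k)) * cond_char (Suc k) k (c k)"
      unfolding q1 .
    have gen: "a * b * c + d * (b * e) = b * (a * c + d * e)" for a b c d e :: complex
      by (simp add: algebra_simps)
    have "(\<Sum>m<Suc (Suc k). complex_of_real (p m) * (\<Prod>i<Suc k. cond_char m i (c i)))
      = (\<Sum>m<Suc k. complex_of_real (p m) * (\<Prod>i<Suc k. cond_char m i (c i)))
        + complex_of_real (p (Suc k)) * (\<Prod>i<Suc k. cond_char (Suc k) i (c i))" by (rule sum.lessThan_Suc)
    also have "\<dots> = (\<Prod>i<k. ?F i) * (complex_of_real (q (Suc k)) * ?F k)"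
      unfolding 1 2 3 by (rule gen)
    also have "\<dots> = complex_of_real (q (Suc k)) * (\<Prod>i<Suc k. ?F i)"
      by (subst prod.lessThan_Suc) (rule mult.left_commute)
    finally show ?case .
  qed
  have "(CLINT \<omega>|coin_space. iexp (\<Sum>i<n. c i * zeta \<omega> i)) = (CLINT \<omega>|coin_space. (\<Sum>r<Suc (Suc n). T r \<omega>))"
  proof (rule integral_cong_AE[OF _ _ decomp])
    show "(\<lambda>\<omega>. iexp (\<Sum>i<n. c i * zeta \<omega> i)) \<in> borel_measurable coin_space" by measurable
    show "(\<lambda>\<omega>. \<Sum>r<Suc (Suc n). T r \<omega>) \<in> borel_measurable coin_space"
      using int_T by (intro borel_measurable_sum borel_measurable_integrable) auto
  qed
  also have "\<dots> = (\<Sum>r<Suc (Suc n). pr r * (\<Prod>i<n. cond_char (N r) i (c i)))"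
    using int_T by (subst Bochner_Integration.integral_sum) auto
  also have "\<dots> = (\<Sum>m<Suc n. complex_of_real (p m) * (\<Prod>i<n. cond_char m i (c i)))
      + (1 - q n) * (\<Prod>i<n. cond_char (n + 2) i (c i))"
    unfolding sum.lessThan_Suc[of _ "Suc n"]
    by (intro arg_cong2[where f = "(+)"] sum.cong refl) (auto simp: pr_eq pr_last N_def)
  also have "(\<Prod>i<n. cond_char (n + 2) i (c i)) = (\<Prod>i<n. complex_of_real (exp (- (c i)\<^sup>2 / 2)))"
    by (intro prod.cong refl cond_char_before) auto
  finally show ?thesis unfolding telescope by (simp add: algebra_simps)
qed

section \<open>The Faber--Schauder expansion\<close>

text \<open>The primitive of the Haar mother function; its copies with factor
  \<open>1 / sqrt (2 ^ n)\<close> are the primitives of the Haar functions of unit norm.\<close>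

definition tent :: "real \<Rightarrow> real" where
  "tent y = max 0 (min y (1 - y))"

lemma tent_nonneg: "0 \<le> tent y" and tent_le: "tent y \<le> 1 / 2"
  by (auto simp: tent_def max_def min_def)

lemma tent_eq_0: "y \<le> 0 \<or> 1 \<le> y \<Longrightarrow> tent y = 0"
  by (auto simp: tent_def)

text \<open>Coefficients are numbered in dyadic blocks: \<open>2 ^ n + j\<close> belongs to the
  \<open>j\<close>-th interval of level \<open>n\<close>. Index \<open>0\<close> is left for the
  constant function, whose primitive is \<open>t\<close>.\<close>

definition level_sum :: "nat \<Rightarrow> (nat \<Rightarrow> real) \<Rightarrow> real \<Rightarrow> real" where
  "level_sum n z t = (\<Sum>j<2 ^ n. z (2 ^ n + j) * tent (2 ^ n * t - real j)) / sqrt (2 ^ n)"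

definition partial_path :: "nat \<Rightarrow> (nat \<Rightarrow> real) \<Rightarrow> real \<Rightarrow> real" where
  "partial_path M z t = z 0 * t + (\<Sum>n<M. level_sum n z t)"

definition bm_path :: "(nat \<Rightarrow> real) \<Rightarrow> real \<Rightarrow> real" where
  "bm_path z t = z 0 * t + (\<Sum>n. level_sum n z t)"

lemma tent_shift_unique:
  assumes "tent (x - real j) \<noteq> 0" "tent (x - real k) \<noteq> 0" shows "j = k"
proof -
  have "x - real j > 0" "x - real j < 1" "x - real k > 0" "x - real k < 1"
    using assms tent_eq_0 by (meson not_le)+
  then show ?thesis by linarith
qed

text \<open>The supports of the shifted tents overlap in endpoints only, so at most one term
  survives. A level is therefore controlled by its largest coefficient rather than by a sum.\<close>

lemma sum_tent_single:
  "\<exists>k. (\<Sum>j<N. c j * tent (x - real j)) = c k * tent (x - real k) \<and> k < N \<or> (\<Sum>j<N. c j * tent (x - real j)) = 0"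
proof (cases "\<exists>k<N. tent (x - real k) \<noteq> 0")
  case True
  then obtain k where k: "k < N" "tent (x - real k) \<noteq> 0" by blast
  then have "(\<Sum>j<N. c j * tent (x - real j)) = (\<Sum>j<N. if j = k then c k * tent (x - real k) else 0)"
    using tent_shift_unique by (intro sum.cong) auto
  with k show ?thesis by auto
qed auto

lemma level_sum_le:
  assumes "\<And>j. j < 2 ^ n \<Longrightarrow> \<bar>z (2 ^ n + j)\<bar> \<le> B" "0 \<le> B"
  shows "\<bar>level_sum n z t\<bar> \<le> B / 2 / sqrt (2 ^ n)"
proof -
  let ?S = "\<Sum>j<2 ^ n. z (2 ^ n + j) * tent (2 ^ n * t - real j)"
  have "\<bar>?S\<bar> \<le> B / 2"
    using sum_tent_single[where N = "2 ^ n" and c = "\<lambda>j. z (2 ^ n + j)" and x = "2 ^ n * t"]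
  proof (elim exE disjE conjE)
    fix k :: nat assume k: "?S = z (2 ^ n + k) * tent (2 ^ n * t - real k)" "k < 2 ^ n"
    have "\<bar>z (2 ^ n + k)\<bar> * tent (2 ^ n * t - real k) \<le> B * (1 / 2)"
      using assms(1)[OF k(2)] by (intro mult_mono tent_nonneg tent_le assms(2)) auto
    then show ?thesis unfolding k(1) by (simp add: abs_mult tent_nonneg)
  qed (use assms in auto)
  then have "\<bar>?S\<bar> / sqrt (2 ^ n) \<le> B / 2 / sqrt (2 ^ n)" by (rule divide_right_mono) simp
  then show ?thesis unfolding level_sum_def by (simp only: abs_divide) simp
qed

text \<open>This is \<open>2 ^ (- 1 / 4)\<close>. At level \<open>n\<close> the coefficients are of
  size \<open>1 / rho ^ n\<close> and the normalising factor is \<open>rho ^ (2 * n)\<close>, so the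
  level contributes a multiple of \<open>rho ^ n\<close>.\<close>

definition rho :: real where "rho = sqrt (sqrt (1 / 2))"

lemma rho: "0 < rho" "rho ^ 4 = 1 / 2" "rho \<le> 85 / 100" "rho ^ 2 = sqrt (1 / 2)"
proof -
  show "0 < rho" by (simp add: rho_def)
  show 2: "rho ^ 2 = sqrt (1 / 2)" by (simp add: rho_def)
  have "rho ^ 4 = (rho ^ 2) ^ 2" by simp
  then show 4: "rho ^ 4 = 1 / 2" by (simp only: 2) simp
  show "rho \<le> 85 / 100"
  proof (rule power_le_imp_le_base[of _ 3])
    show "rho ^ Suc 3 \<le> (85 / 100) ^ Suc 3" using 4 by (simp add: power_divide)
  qed simp
qed

lemma sqrt_pow2: "1 / sqrt (2 ^ n) = rho ^ (2 * n)"
  by (simp add: power_mult rho(4) real_sqrt_power real_sqrt_divide power_divide)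

text \<open>For indices below \<open>2 ^ Suc n\<close> the conditioning removes a tail of mass at
  least \<open>1 / (9 * 4 ^ n)\<close>. The eighth power of \<open>3 / rho ^ n\<close> is
  \<open>6561 * 4 ^ n\<close>, so \<open>folded_cdf_ge\<close> leaves at most
  \<open>105 / (6561 * 4 ^ n)\<close> beyond that point, which is less.\<close>

lemma quantile_tail:
  assumes "m \<le> i" "i < 2 ^ Suc n" "0 \<le> u" "u \<le> 1"
  shows "quantile (cond_seed m i u) \<le> 3 / rho ^ n"
proof -
  let ?x = "3 / rho ^ n"
  have x: "0 < ?x" using rho(1) by simp
  have v: "cond_seed m i u = (1 - eps i) * u" using assms by (simp add: cond_seed_def)
  have le: "(1 - eps i) * u \<le> 1 - eps i" using assms eps_bounds[of i] mult_left_mono[of u 1 "1 - eps i"] by simp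
  have "rho ^ (n * 8) = (rho ^ 4) ^ (2 * n)" by (simp only: power_mult[symmetric]) (simp add: mult.commute)
  also have "\<dots> = 1 / 4 ^ n" unfolding rho(2) by (simp add: power_mult power_divide power2_eq_square)
  finally have x8: "?x ^ 8 = 6561 * 4 ^ n" by (simp add: power_divide power_mult[symmetric])
  have "i + 2 \<le> 3 * 2 ^ n" using assms(2) one_le_power[of "2::nat" n] by simp
  then have "real (i + 2) \<le> real (3 * 2 ^ n)" by (rule of_nat_mono)
  then have "real i + 2 \<le> 3 * 2 ^ n" by simp
  then have "(real i + 2)\<^sup>2 \<le> (3 * 2 ^ n)\<^sup>2" by (intro power_mono) auto
  also have "\<dots> = 9 * 4 ^ n" by (simp add: power_mult_distrib power_mult[symmetric] mult.commute[of n]) (simp add: power_mult)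
  finally have "(real i + 2)\<^sup>2 \<le> 9 * 4 ^ n" .
  moreover have "0 \<le> (4::real) ^ n" by simp
  ultimately have "105 * (real i + 2)\<^sup>2 \<le> 6561 * 4 ^ n" by linarith
  then have "105 / (6561 * 4 ^ n) \<le> eps i"
    by (simp add: eps_def divide_le_eq le_divide_eq mult.commute)
  then have "1 - eps i \<le> folded_cdf ?x" using folded_cdf_ge[OF x] x8 by simp
  with le have "(1 - eps i) * u \<le> folded_cdf ?x" by linarith
  moreover have "(1 - eps i) * u < 1" using le eps_bounds(1)[of i] by linarith
  moreover have "0 \<le> (1 - eps i) * u" using eps_bounds[of i] assms by simp
  ultimately show ?thesis unfolding v using quantile_le_iff[of "(1 - eps i) * u" ?x] x by simp
qed

lemma row_seed_bounds: "0 \<le> row_seed b" "row_seed b \<le> 1"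
  by (auto simp: row_seed_def ureal_bounds)

lemma zeta_tail:
  assumes "level \<omega> \<le> i" "i < 2 ^ Suc n"
  shows "\<bar>zeta \<omega> i\<bar> \<le> 3 / rho ^ n"
  using quantile_tail[OF assms row_seed_bounds] quantile_nonneg
  by (auto simp: zeta_def row_gauss_def abs_mult)

lemma level_sum_zeta:
  assumes "level \<omega> \<le> 2 ^ n"
  shows "\<bar>level_sum n (zeta \<omega>) t\<bar> \<le> 3 / 2 * rho ^ n"
proof -
  have "\<bar>zeta \<omega> (2 ^ n + j)\<bar> \<le> 3 / rho ^ n" if "j < 2 ^ n" for j
    using assms that by (intro zeta_tail) auto
  then have "\<bar>level_sum n (zeta \<omega>) t\<bar> \<le> 3 / rho ^ n / 2 / sqrt (2 ^ n)"
    using rho(1) by (intro level_sum_le) auto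
  also have "\<dots> = 3 / 2 / rho ^ n * (1 / sqrt (2 ^ n))" by simp
  also have "\<dots> = 3 / 2 * rho ^ n"
  proof -
    have "rho ^ (2 * n) = rho ^ n * rho ^ n" by (simp only: mult_2 power_add)
    then show ?thesis unfolding sqrt_pow2 using rho(1) by simp
  qed
  finally show ?thesis .
qed

lemma level_le_pow2: "level \<omega> \<le> n \<Longrightarrow> level \<omega> \<le> 2 ^ n"
  using less_exp[of n] by linarith

lemma summable_level_sum: "summable (\<lambda>n. level_sum n (zeta \<omega>) t)"
proof (rule summable_comparison_test)
  show "\<exists>N. \<forall>n\<ge>N. norm (level_sum n (zeta \<omega>) t) \<le> 3 / 2 * rho ^ n"
    using level_sum_zeta level_le_pow2 by (intro exI[of _ "level \<omega>"]) auto
  show "summable (\<lambda>n. 3 / 2 * rho ^ n)" using rho by (intro summable_mult summable_geometric) auto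
qed

text \<open>Once \<open>M\<close> reaches the level, all omitted coefficients obey the deterministic
  bound of \<open>zeta_tail\<close>; the level is thus the only random quantity in the modulus of
  convergence.\<close>

lemma bm_path_tail:
  assumes "level \<omega> \<le> M"
  shows "\<bar>bm_path (zeta \<omega>) t - partial_path M (zeta \<omega>) t\<bar> \<le> 10 * rho ^ M"
proof -
  let ?f = "\<lambda>n. level_sum n (zeta \<omega>) t"
  have geo: "summable (\<lambda>n. 3 / 2 * rho ^ M * rho ^ n)" using rho by (intro summable_mult summable_geometric) auto
  have le: "\<bar>?f (n + M)\<bar> \<le> 3 / 2 * rho ^ M * rho ^ n" for n
    using level_sum_zeta[of \<omega> "n + M" t] level_le_pow2[of \<omega> "n + M"] assms by (simp add: power_add mult_ac)
  have summ: "summable (\<lambda>n. \<bar>?f (n + M)\<bar>)"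
    by (rule summable_comparison_test[OF _ geo]) (use le in auto)
  have "bm_path (zeta \<omega>) t - partial_path M (zeta \<omega>) t = (\<Sum>n. ?f (n + M))"
    using suminf_split_initial_segment[OF summable_level_sum, of \<omega> t M] by (simp add: bm_path_def partial_path_def)
  also have "\<bar>\<dots>\<bar> \<le> (\<Sum>n. \<bar>?f (n + M)\<bar>)"
    by (rule summable_rabs[OF summ])
  also have "\<dots> \<le> (\<Sum>n. 3 / 2 * rho ^ M * rho ^ n)"
    by (rule suminf_le[OF le summ geo])
  also have "\<dots> = 3 / 2 * rho ^ M / (1 - rho)"
    using rho by (subst suminf_mult) (auto simp: suminf_geometric summable_geometric)
  also have "\<dots> \<le> 10 * rho ^ M"
  proof -
    \<comment> \<open>The constant \<open>10\<close> is
      \<open>(3 / 2) / (1 - 85 / 100)\<close>.\<close>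
    have "3 / 2 / (1 - rho) \<le> 10" using rho by (simp add: divide_le_eq)
    then have "3 / 2 / (1 - rho) * rho ^ M \<le> 10 * rho ^ M" using rho(1) by (intro mult_right_mono) auto
    then show ?thesis by simp
  qed
  finally show ?thesis .
qed

lemma continuous_level_sum: "continuous_on A (level_sum n z)"
  unfolding level_sum_def tent_def by (intro continuous_intros) auto

lemma continuous_partial_path: "continuous_on A (partial_path M z)"
  unfolding partial_path_def by (intro continuous_intros continuous_level_sum)

lemma rho_pow_tendsto: "(\<lambda>M. 10 * rho ^ M) \<longlonglongrightarrow> 0"
  using tendsto_mult_right_zero[OF LIMSEQ_realpow_zero[of rho]] rho by auto

lemma continuous_path: "continuous_on A (bm_path (zeta \<omega>))"
proof (rule uniform_limit_theorem)
  show "uniform_limit A (\<lambda>M. partial_path M (zeta \<omega>)) (bm_path (zeta \<omega>)) sequentially"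
  proof (rule uniform_limitI)
    fix e :: real assume "e > 0"
    then have "\<forall>\<^sub>F M in sequentially. 10 * rho ^ M < e" using order_tendstoD(2)[OF rho_pow_tendsto] by blast
    then show "\<forall>\<^sub>F M in sequentially. \<forall>t\<in>A. dist (partial_path M (zeta \<omega>) t) (bm_path (zeta \<omega>) t) < e"
      using eventually_ge_at_top[of "level \<omega>"]
    proof eventually_elim
      case (elim M)
      show ?case
      proof
        fix t show "dist (partial_path M (zeta \<omega>) t) (bm_path (zeta \<omega>) t) < e"
          using bm_path_tail[of \<omega> M t] elim by (simp add: dist_real_def abs_minus_commute)
      qed
    qed
  qed
qed (auto intro!: always_eventually continuous_partial_path)

lemma partial_path_tendsto: "(\<lambda>M. partial_path M (zeta \<omega>) t) \<longlonglongrightarrow> bm_path (zeta \<omega>) t"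
  unfolding partial_path_def bm_path_def by (intro tendsto_intros summable_LIMSEQ summable_level_sum)

lemma partial_path_measurable: "(\<lambda>\<omega>. partial_path M (zeta \<omega>) t) \<in> borel_measurable coin_space"
  unfolding partial_path_def level_sum_def by measurable

lemma bm_path_measurable: "(\<lambda>\<omega>. bm_path (zeta \<omega>) t) \<in> borel_measurable coin_space"
  by (rule borel_measurable_LIMSEQ_real[OF partial_path_tendsto partial_path_measurable])

lemma bm_path_0: "bm_path z 0 = 0"
  by (simp add: bm_path_def level_sum_def tent_eq_0)

section \<open>The covariance of the expansion\<close>

definition tent_cov :: "nat \<Rightarrow> real \<Rightarrow> real \<Rightarrow> real" where
  "tent_cov n s t = (\<Sum>j<2 ^ n. tent (2 ^ n * s - real j) * tent (2 ^ n * t - real j)) / 2 ^ n"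

lemma tent_cov_0: "tent_cov 0 s t = tent s * tent t"
  by (simp add: tent_cov_def)

lemma sum_split_double:
  fixes f :: "nat \<Rightarrow> 'b::comm_monoid_add"
  shows "(\<Sum>j<2 * N. f j) = (\<Sum>j<N. f j) + (\<Sum>j<N. f (N + j))"
  using sum.atLeastLessThan_concat[of 0 N "2 * N" f] sum.shift_bounds_nat_ivl[of f 0 N N]
  by (simp add: atLeast0LessThan add.commute mult_2)

text \<open>Self-similarity: the intervals of level \<open>Suc n\<close> in the left and right half
  of the unit interval are rescaled copies of those of level \<open>n\<close>.\<close>

lemma tent_cov_Suc: "tent_cov (Suc n) s t = (tent_cov n (2 * s) (2 * t) + tent_cov n (2 * s - 1) (2 * t - 1)) / 2"
  unfolding tent_cov_def power_Suc sum_split_double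
  by (simp add: add_divide_distrib algebra_simps)

lemma tent_cov_outside: "s \<le> 0 \<or> 1 \<le> s \<or> t \<le> 0 \<or> 1 \<le> t \<Longrightarrow> tent_cov n s t = 0"
proof -
  have "tent (2 ^ n * x - real j) = 0" if "j < 2 ^ n" "x \<le> 0 \<or> 1 \<le> x" for x j
  proof (rule tent_eq_0)
    have "real (Suc j) \<le> real (2 ^ n)" using that(1) by (intro of_nat_mono) simp
    then have "real j + 1 \<le> 2 ^ n" by simp
    moreover have "2 ^ n * x \<le> 0 \<or> 2 ^ n \<le> 2 ^ n * x" using that(2) by (auto simp: mult_le_0_iff)
    ultimately show "2 ^ n * x - real j \<le> 0 \<or> 1 \<le> 2 ^ n * x - real j" by linarith
  qed
  then show "s \<le> 0 \<or> 1 \<le> s \<or> t \<le> 0 \<or> 1 \<le> t \<Longrightarrow> tent_cov n s t = 0"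
    unfolding tent_cov_def by (auto intro!: sum.neutral)
qed

text \<open>
  The remainder satisfies \<open>e (M + 1) s t = e M (2 s) (2 t) / 2\<close> on the lower quarter, the analogous
  identity on the upper quarter, and vanishes on the two remaining quarters of the unit square.
\<close>

lemma covariance_remainder:
  assumes "0 \<le> s" "s \<le> 1" "0 \<le> t" "t \<le> 1"
  shows "0 \<le> min s t - s * t - (\<Sum>n<M. tent_cov n s t) \<and> min s t - s * t - (\<Sum>n<M. tent_cov n s t) \<le> 1 / 2 ^ M"
  using assms
proof (induction M arbitrary: s t)
  case 0
  have "s * t \<le> min s t" "0 \<le> s * t" "min s t \<le> 1" using 0 by (auto simp: mult_left_le mult_left_le_one_le)
  then show ?case by (simp only: lessThan_0 sum.empty power_0 div_by_1) linarith
next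
  case (Suc M)
  define e where "e s t = min s t - s * t - (\<Sum>n<M. tent_cov n s t)" for s t
  have split: "min s t - s * t - (\<Sum>n<Suc M. tent_cov n s t)
      = min s t - s * t - tent s * tent t
        - ((\<Sum>n<M. tent_cov n (2 * s) (2 * t)) + (\<Sum>n<M. tent_cov n (2 * s - 1) (2 * t - 1))) / 2"
    unfolding sum.lessThan_Suc_shift tent_cov_0 tent_cov_Suc
    by (simp add: sum_divide_distrib[symmetric] sum.distrib)
  \<comment> \<open>In the mixed quarters level \<open>0\<close> alone gives the whole of
    \<open>min s t - s * t\<close>, because each finer tent is supported in one half.\<close>
  consider "s \<le> 1/2" "t \<le> 1/2" | "1/2 \<le> s" "1/2 \<le> t" | "s \<le> 1/2" "1/2 \<le> t" | "1/2 \<le> s" "t \<le> 1/2" by linarith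
  then show ?case
  proof cases
    case 1
    then have a: "(\<Sum>n<M. tent_cov n (2 * s - 1) (2 * t - 1)) = 0" by (intro sum.neutral) (simp add: tent_cov_outside)
    have b: "tent s = s" "tent t = t" using 1 Suc.prems by (auto simp: tent_def)
    have "min s t - s * t - (\<Sum>n<Suc M. tent_cov n s t) = e (2 * s) (2 * t) / 2"
      unfolding split e_def a b by (auto simp: min_def field_simps)
    then show ?thesis using Suc.IH[of "2 * s" "2 * t"] Suc.prems 1 by (simp add: e_def)
  next
    case 2
    then have a: "(\<Sum>n<M. tent_cov n (2 * s) (2 * t)) = 0" by (intro sum.neutral) (simp add: tent_cov_outside)
    have b: "tent s = 1 - s" "tent t = 1 - t" using 2 Suc.prems by (auto simp: tent_def)
    have "min s t - s * t - (\<Sum>n<Suc M. tent_cov n s t) = e (2 * s - 1) (2 * t - 1) / 2"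
      unfolding split e_def a b by (auto simp: min_def field_simps)
    then show ?thesis using Suc.IH[of "2 * s - 1" "2 * t - 1"] Suc.prems 2 by (simp add: e_def)
  next
    case 3
    then have a: "(\<Sum>n<M. tent_cov n (2 * s) (2 * t)) = 0" "(\<Sum>n<M. tent_cov n (2 * s - 1) (2 * t - 1)) = 0"
      by (auto intro!: sum.neutral simp: tent_cov_outside)
    have b: "tent s = s" "tent t = 1 - t" using 3 Suc.prems by (auto simp: tent_def)
    then show ?thesis unfolding split a b using 3 by (simp add: min_def algebra_simps)
  next
    case 4
    then have a: "(\<Sum>n<M. tent_cov n (2 * s) (2 * t)) = 0" "(\<Sum>n<M. tent_cov n (2 * s - 1) (2 * t - 1)) = 0"
      by (auto intro!: sum.neutral simp: tent_cov_outside)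
    have b: "tent s = 1 - s" "tent t = t" using 4 Suc.prems by (auto simp: tent_def)
    have "min s t = t" using 4 by simp
    then show ?thesis unfolding split a b by (simp add: algebra_simps)
  qed
qed

text \<open>The primitive of the \<open>i\<close>-th Haar function in linear numbering;
  \<open>floor_log\<close> recovers the level from the index.\<close>

definition basis :: "nat \<Rightarrow> real \<Rightarrow> real" where
  "basis i t = (if i = 0 then t
     else tent (2 ^ floor_log i * t - real (i - 2 ^ floor_log i)) / sqrt (2 ^ floor_log i))"

lemma basis_dyadic: "j < 2 ^ n \<Longrightarrow> basis (2 ^ n + j) t = tent (2 ^ n * t - real j) / sqrt (2 ^ n)"
proof -
  assume "j < 2 ^ n"
  then have "floor_log (2 ^ n + j) = n" by (intro floor_log_eqI) auto
  then show ?thesis by (simp add: basis_def)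
qed

lemma sum_dyadic:
  fixes f :: "nat \<Rightarrow> 'b::comm_monoid_add"
  shows "(\<Sum>i<2 ^ M. f i) = f 0 + (\<Sum>n<M. \<Sum>j<2 ^ n. f (2 ^ n + j))"
  by (induction M) (simp_all add: sum_split_double add.assoc)

lemma partial_path_basis: "partial_path M z t = (\<Sum>i<2 ^ M. z i * basis i t)"
proof -
  have "(\<Sum>i<2 ^ M. z i * basis i t) = z 0 * basis 0 t + (\<Sum>n<M. \<Sum>j<2 ^ n. z (2 ^ n + j) * basis (2 ^ n + j) t)"
    by (rule sum_dyadic)
  also have "\<dots> = partial_path M z t"
    by (simp add: partial_path_def level_sum_def basis_dyadic sum_divide_distrib basis_def[of 0])
  finally show ?thesis by simp
qed

text \<open>Parseval's identity for the indicators of \<open>[0, s]\<close> and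
  \<open>[0, t]\<close>, whose inner product is \<open>min s t\<close>; here it follows from the
  explicit bound on the remainder.\<close>

lemma basis_covariance:
  assumes "0 \<le> s" "s \<le> 1" "0 \<le> t" "t \<le> 1"
  shows "(\<lambda>M. \<Sum>i<2 ^ M. basis i s * basis i t) \<longlonglongrightarrow> min s t"
proof -
  have eq: "(\<Sum>i<2 ^ M. basis i s * basis i t) = s * t + (\<Sum>n<M. tent_cov n s t)" for M
  proof -
    have "(\<Sum>i<2 ^ M. basis i s * basis i t)
        = basis 0 s * basis 0 t + (\<Sum>n<M. \<Sum>j<2 ^ n. basis (2 ^ n + j) s * basis (2 ^ n + j) t)"
      by (rule sum_dyadic)
    also have "\<dots> = s * t + (\<Sum>n<M. tent_cov n s t)"
      by (simp add: tent_cov_def basis_dyadic sum_divide_distrib basis_def[of 0])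
    finally show ?thesis .
  qed
  have "(\<lambda>M. (1 / 2 :: real) ^ M) \<longlonglongrightarrow> 0" by (rule LIMSEQ_realpow_zero) auto
  then have "(\<lambda>M. min s t - s * t - (\<Sum>n<M. tent_cov n s t)) \<longlonglongrightarrow> 0"
    by (rule tendsto_sandwich[OF _ _ tendsto_const, rotated 2])
       (use covariance_remainder[OF assms] in \<open>auto simp: power_divide\<close>)
  from tendsto_diff[OF tendsto_const[of "min s t"] this] show ?thesis by (simp add: eq)
qed

section \<open>The Wiener property\<close>

text \<open>Expanding the square reduces the sum to the covariances \<open>min\<close>. Their double
  difference over two intervals of the partition is the length of the common part, so distinct
  increments contribute \<open>0\<close>.\<close>

lemma increment_covariance:
  fixes t :: "nat \<Rightarrow> real"
  assumes t: "0 \<le> t 0" "\<And>i. i < n \<Longrightarrow> t i < t (Suc i)" "t n \<le> 1"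
  shows "(\<lambda>M. \<Sum>i<2 ^ M. (\<Sum>k<n. a k * (basis i (t (Suc k)) - basis i (t k)))\<^sup>2)
     \<longlonglongrightarrow> (\<Sum>k<n. (t (Suc k) - t k) * (a k)\<^sup>2)"
proof -
  have mono: "t i \<le> t j" if "i \<le> j" "j \<le> n" for i j
    using that
  proof (induction j rule: dec_induct)
    case (step j)
    then show ?case using t(2)[of j] by simp
  qed simp
  have t01: "0 \<le> t i" "t i \<le> 1" if "i \<le> n" for i
    using mono[of 0 i] mono[of i n] t that by auto
  let ?b = "\<lambda>i k. basis i (t (Suc k)) - basis i (t k)"
  have expand: "(\<Sum>i<2 ^ M. (\<Sum>k<n. a k * ?b i k)\<^sup>2) = (\<Sum>k<n. \<Sum>l<n. a k * a l *
      ((\<Sum>i<2 ^ M. basis i (t (Suc k)) * basis i (t (Suc l))) - (\<Sum>i<2 ^ M. basis i (t (Suc k)) * basis i (t l))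
      - (\<Sum>i<2 ^ M. basis i (t k) * basis i (t (Suc l))) + (\<Sum>i<2 ^ M. basis i (t k) * basis i (t l))))" for M
  proof -
    have "(\<Sum>i<2 ^ M. (\<Sum>k<n. a k * ?b i k)\<^sup>2) = (\<Sum>i<2 ^ M. \<Sum>k<n. \<Sum>l<n. (a k * ?b i k) * (a l * ?b i l))"
      by (simp add: power2_eq_square sum_product)
    also have "\<dots> = (\<Sum>k<n. \<Sum>i<2 ^ M. \<Sum>l<n. (a k * ?b i k) * (a l * ?b i l))" by (rule sum.swap)
    also have "\<dots> = (\<Sum>k<n. \<Sum>l<n. \<Sum>i<2 ^ M. (a k * ?b i k) * (a l * ?b i l))"
      by (rule sum.cong[OF refl sum.swap])
    also have "\<dots> = (\<Sum>k<n. \<Sum>l<n. a k * a l * (\<Sum>i<2 ^ M. ?b i k * ?b i l))"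
      by (simp add: sum_distrib_left mult_ac)
    finally have eq: "(\<Sum>i<2 ^ M. (\<Sum>k<n. a k * ?b i k)\<^sup>2) = (\<Sum>k<n. \<Sum>l<n. a k * a l * (\<Sum>i<2 ^ M. ?b i k * ?b i l))" .
    have "(\<Sum>i<2 ^ M. ?b i k * ?b i l) = (\<Sum>i<2 ^ M. basis i (t (Suc k)) * basis i (t (Suc l)))
        - (\<Sum>i<2 ^ M. basis i (t (Suc k)) * basis i (t l))
        - (\<Sum>i<2 ^ M. basis i (t k) * basis i (t (Suc l))) + (\<Sum>i<2 ^ M. basis i (t k) * basis i (t l))" for k l
      by (simp add: sum.distrib sum_subtractf algebra_simps)
    then show ?thesis unfolding eq by (simp only:)
  qed
  have "(\<lambda>M. \<Sum>i<2 ^ M. (\<Sum>k<n. a k * ?b i k)\<^sup>2) \<longlonglongrightarrow> (\<Sum>k<n. \<Sum>l<n. a k * a l *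
      (min (t (Suc k)) (t (Suc l)) - min (t (Suc k)) (t l) - min (t k) (t (Suc l)) + min (t k) (t l)))"
    unfolding expand by (intro tendsto_intros basis_covariance t01) auto
  also have "(\<Sum>k<n. \<Sum>l<n. a k * a l *
      (min (t (Suc k)) (t (Suc l)) - min (t (Suc k)) (t l) - min (t k) (t (Suc l)) + min (t k) (t l)))
    = (\<Sum>k<n. \<Sum>l<n. if l = k then (t (Suc k) - t k) * (a k)\<^sup>2 else 0)"
  proof (intro sum.cong refl)
    fix k l assume kl: "k \<in> {..<n}" "l \<in> {..<n}"
    consider "l = k" | "l < k" | "k < l" by linarith
    then show "a k * a l * (min (t (Suc k)) (t (Suc l)) - min (t (Suc k)) (t l) - min (t k) (t (Suc l)) + min (t k) (t l))
        = (if l = k then (t (Suc k) - t k) * (a k)\<^sup>2 else 0)"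
    proof cases
      case 1
      then show ?thesis using mono[of k "Suc k"] kl by (simp add: power2_eq_square min_absorb1 min_absorb2)
    next
      case 2
      then show ?thesis
        using kl mono[of "Suc l" k] mono[of l k] mono[of "Suc l" "Suc k"] mono[of l "Suc k"]
        by (simp add: min_absorb2)
    next
      case 3
      then show ?thesis
        using kl mono[of "Suc k" l] mono[of k l] mono[of "Suc k" "Suc l"] mono[of k "Suc l"]
        by (simp add: min_absorb1)
    qed
  qed
  also have "\<dots> = (\<Sum>k<n. (t (Suc k) - t k) * (a k)\<^sup>2)" by simp
  finally show ?thesis .
qed

text \<open>For a partial sum the exponent is a finite combination of coefficients, to which
  \<open>zeta_joint_char\<close> applies; dominated convergence passes to the limit. The limiting
  quadratic form is diagonal, so its exponential factorises over the increments.\<close>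

lemma increment_joint_char:
  fixes t :: "nat \<Rightarrow> real"
  assumes t: "0 \<le> t 0" "\<And>i. i < n \<Longrightarrow> t i < t (Suc i)" "t n \<le> 1"
  shows "(CLINT \<omega>|coin_space. iexp (\<Sum>k<n. a k * (bm_path (zeta \<omega>) (t (Suc k)) - bm_path (zeta \<omega>) (t k))))
    = (\<Prod>k<n. complex_of_real (exp (- ((t (Suc k) - t k) * (a k)\<^sup>2) / 2)))"
proof -
  define c where "c i = (\<Sum>k<n. a k * (basis i (t (Suc k)) - basis i (t k)))" for i
  define Y where "Y M \<omega> = (\<Sum>k<n. a k * (partial_path M (zeta \<omega>) (t (Suc k)) - partial_path M (zeta \<omega>) (t k)))" for M \<omega>
  have Y: "Y M \<omega> = (\<Sum>i<2 ^ M. c i * zeta \<omega> i)" for M \<omega>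
  proof -
    have "Y M \<omega> = (\<Sum>k<n. \<Sum>i<2 ^ M. a k * (basis i (t (Suc k)) - basis i (t k)) * zeta \<omega> i)"
      unfolding Y_def partial_path_basis
      by (simp add: sum_subtractf[symmetric] sum_distrib_left algebra_simps)
    also have "\<dots> = (\<Sum>i<2 ^ M. c i * zeta \<omega> i)"
      unfolding c_def by (subst sum.swap) (simp add: sum_distrib_right)
    finally show ?thesis .
  qed
  have "(CLINT \<omega>|coin_space. iexp (Y M \<omega>)) = complex_of_real (exp (- (\<Sum>i<2 ^ M. (c i)\<^sup>2) / 2))" for M
    unfolding Y zeta_joint_char
    by (simp only: of_real_prod[symmetric] exp_sum[OF finite_lessThan, symmetric] sum_negf sum_divide_distrib[symmetric])
  moreover have "(\<lambda>M. complex_of_real (exp (- (\<Sum>i<2 ^ M. (c i)\<^sup>2) / 2))) \<longlonglongrightarrow>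
      complex_of_real (exp (- (\<Sum>k<n. (t (Suc k) - t k) * (a k)\<^sup>2) / 2))"
    unfolding c_def by (intro tendsto_intros increment_covariance t) auto
  moreover have "(\<lambda>M. CLINT \<omega>|coin_space. iexp (Y M \<omega>)) \<longlonglongrightarrow>
     (CLINT \<omega>|coin_space. iexp (\<Sum>k<n. a k * (bm_path (zeta \<omega>) (t (Suc k)) - bm_path (zeta \<omega>) (t k))))"
  proof (rule integral_dominated_convergence[where w = "\<lambda>_. 1"])
    have [measurable]: "(\<lambda>\<omega>. Y M \<omega>) \<in> borel_measurable coin_space" for M
      unfolding Y_def by (intro borel_measurable_sum borel_measurable_times borel_measurable_diff borel_measurable_const partial_path_measurable)
    show "(\<lambda>\<omega>. iexp (Y M \<omega>)) \<in> borel_measurable coin_space" for M by measurable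
    have [measurable]: "(\<lambda>\<omega>. \<Sum>k<n. a k * (bm_path (zeta \<omega>) (t (Suc k)) - bm_path (zeta \<omega>) (t k))) \<in> borel_measurable coin_space"
      by (intro borel_measurable_sum borel_measurable_times borel_measurable_diff borel_measurable_const bm_path_measurable)
    show "(\<lambda>\<omega>. iexp (\<Sum>k<n. a k * (bm_path (zeta \<omega>) (t (Suc k)) - bm_path (zeta \<omega>) (t k)))) \<in> borel_measurable coin_space"
      by measurable
    show "AE \<omega> in coin_space. (\<lambda>M. iexp (Y M \<omega>)) \<longlonglongrightarrow>
        iexp (\<Sum>k<n. a k * (bm_path (zeta \<omega>) (t (Suc k)) - bm_path (zeta \<omega>) (t k)))"
      unfolding Y_def by (intro always_eventually allI tendsto_intros partial_path_tendsto)
  qed (auto simp del: of_real_sum of_real_mult of_real_diff)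
  ultimately have "(CLINT \<omega>|coin_space. iexp (\<Sum>k<n. a k * (bm_path (zeta \<omega>) (t (Suc k)) - bm_path (zeta \<omega>) (t k))))
      = complex_of_real (exp (- (\<Sum>k<n. (t (Suc k) - t k) * (a k)\<^sup>2) / 2))"
    using LIMSEQ_unique by simp blast
  then show ?thesis
    by (simp only: of_real_prod[symmetric] exp_sum[OF finite_lessThan, symmetric] sum_negf sum_divide_distrib[symmetric])
qed

definition wiener :: "(nat \<Rightarrow> bool) \<rightharpoonup> (real \<Rightarrow> real)" where
  "wiener \<omega> = (if \<omega> \<in> gauss_dom then Some (restrict (bm_path (zeta \<omega>)) {0..1}) else None)"

lemma dom_wiener: "dom wiener = gauss_dom"
  by (auto simp: wiener_def dom_def)

lemma ran_wiener: "ran wiener \<subseteq> C01"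
proof -
  have "continuous_on {0..1} (restrict (bm_path (zeta \<omega>)) {0..1})" for \<omega>
    using continuous_path[of "{0..1}" \<omega>] by (rule continuous_on_cong[THEN iffD1, rotated 2]) auto
  then show ?thesis by (auto simp: ran_def wiener_def C01_def split: if_splits)
qed

lemma wiener_process_wiener: "wiener_process01 (restrict_space coin_space gauss_dom) (\<lambda>t \<omega>. the (wiener \<omega>) t)"
proof -
  let ?M = "restrict_space coin_space gauss_dom"
  let ?X = "\<lambda>t \<omega>. the (wiener \<omega>) t"
  have sp: "space ?M = gauss_dom" by (simp add: space_restrict_space)
  interpret M: prob_space ?M
  proof
    have "emeasure coin_space gauss_dom = 1" using prob_gauss_dom by (simp add: coin.emeasure_eq_measure)
    then show "emeasure ?M (space ?M) = 1" by (simp add: sp emeasure_restrict_space)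
  qed
  have X: "?X t \<omega> = bm_path (zeta \<omega>) t" if "\<omega> \<in> gauss_dom" "t \<in> {0..1}" for t \<omega>
    using that by (simp add: wiener_def)
  have X_meas: "?X t \<in> borel_measurable ?M" if "t \<in> {0..1}" for t
  proof -
    have "(\<lambda>\<omega>. bm_path (zeta \<omega>) t) \<in> borel_measurable ?M" by (rule measurable_restrict_space1[OF bm_path_measurable])
    then show ?thesis by (rule measurable_cong[THEN iffD1, rotated]) (use X that in \<open>auto simp: sp\<close>)
  qed
  \<comment> \<open>The domain has full measure, so integrals over the restricted space can be
    computed on the coin space.\<close>
  have int: "(CLINT \<omega>|?M. g \<omega>) = (CLINT \<omega>|coin_space. f \<omega>)"
    if "\<And>\<omega>. \<omega> \<in> gauss_dom \<Longrightarrow> g \<omega> = f \<omega>" "f \<in> borel_measurable coin_space" for f g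
  proof -
    have "(CLINT \<omega>|?M. g \<omega>) = (CLINT \<omega>|?M. f \<omega>)" by (intro Bochner_Integration.integral_cong refl) (simp add: sp that)
    also have "\<dots> = (CLINT \<omega>|coin_space. indicator gauss_dom \<omega> *\<^sub>R f \<omega>)"
      by (rule integral_restrict_space) simp
    also have "\<dots> = (CLINT \<omega>|coin_space. f \<omega>)"
      using AE_gauss_dom that(2) by (intro integral_cong_AE) (auto elim!: eventually_mono)
    finally show ?thesis .
  qed
  have law: "M.indep_vars (\<lambda>_. borel) (\<lambda>i \<omega>. ?X (t (Suc i)) \<omega> - ?X (t i) \<omega>) {..<n}
      \<and> (\<forall>i<n. distributed ?M lborel (\<lambda>\<omega>. ?X (t (Suc i)) \<omega> - ?X (t i) \<omega>) (normal_density 0 (sqrt (t (Suc i) - t i))))"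
    if t: "0 \<le> t 0" "\<And>i. i < n \<Longrightarrow> t i < t (Suc i)" "t n \<le> 1" for n and t :: "nat \<Rightarrow> real"
  proof -
    have mono: "t i \<le> t j" if "i \<le> j" "j \<le> n" for i j
      using that
    proof (induction j rule: dec_induct)
      case (step j)
      then show ?case using t(2)[of j] by simp
    qed simp
    have t01: "t i \<in> {0..1}" if "i \<le> n" for i using mono[of 0 i] mono[of i n] t that by auto
    define \<phi> where "\<phi> i a = complex_of_real (exp (- ((t (Suc i) - t i) * a\<^sup>2) / 2))" for i a
    have meas: "(\<lambda>\<omega>. ?X (t (Suc i)) \<omega> - ?X (t i) \<omega>) \<in> borel_measurable ?M" if "i < n" for i
      using that by (intro borel_measurable_diff X_meas t01) auto
    have joint: "(CLINT \<omega>|?M. iexp (\<Sum>i<n. a i * (?X (t (Suc i)) \<omega> - ?X (t i) \<omega>))) = (\<Prod>i<n. \<phi> i (a i))" for a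
    proof -
      have meas': "(\<lambda>\<omega>. \<Sum>i<n. a i * (bm_path (zeta \<omega>) (t (Suc i)) - bm_path (zeta \<omega>) (t i))) \<in> borel_measurable coin_space"
        by (intro borel_measurable_sum borel_measurable_times borel_measurable_diff borel_measurable_const bm_path_measurable)
      have eq: "(CLINT \<omega>|?M. iexp (\<Sum>i<n. a i * (?X (t (Suc i)) \<omega> - ?X (t i) \<omega>)))
          = (CLINT \<omega>|coin_space. iexp (\<Sum>i<n. a i * (bm_path (zeta \<omega>) (t (Suc i)) - bm_path (zeta \<omega>) (t i))))"
      proof (rule int)
        show "iexp (\<Sum>i<n. a i * (?X (t (Suc i)) \<omega> - ?X (t i) \<omega>))
            = iexp (\<Sum>i<n. a i * (bm_path (zeta \<omega>) (t (Suc i)) - bm_path (zeta \<omega>) (t i)))" if "\<omega> \<in> gauss_dom" for \<omega>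
          by (rule arg_cong[where f = iexp], rule sum.cong[OF refl]) (use X[OF that] t01 in auto)
        show "(\<lambda>\<omega>. iexp (\<Sum>i<n. a i * (bm_path (zeta \<omega>) (t (Suc i)) - bm_path (zeta \<omega>) (t i)))) \<in> borel_measurable coin_space"
          using meas' by measurable
      qed
      show ?thesis unfolding \<phi>_def by (rule trans[OF eq increment_joint_char[OF t]])
    qed
    have one: "\<phi> i 0 = 1" for i by (simp add: \<phi>_def)
    have indep: "M.indep_vars (\<lambda>_. borel) (\<lambda>i \<omega>. ?X (t (Suc i)) \<omega> - ?X (t i) \<omega>) {..<n}"
      by (rule M.indep_vars_of_joint_char(1)[OF _ joint one]) (rule meas)
    have char: "char (distr ?M borel (\<lambda>\<omega>. ?X (t (Suc i)) \<omega> - ?X (t i) \<omega>)) = \<phi> i" if "i < n" for i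
      by (rule M.indep_vars_of_joint_char(2)[OF _ joint one that]) (rule meas)
    have "distributed ?M lborel (\<lambda>\<omega>. ?X (t (Suc i)) \<omega> - ?X (t i) \<omega>) (normal_density 0 (sqrt (t (Suc i) - t i)))" if "i < n" for i
      by (rule M.distributed_normal_of_char[OF meas[OF that]]) (use t(2)[OF that] char[OF that] in \<open>auto simp: \<phi>_def\<close>)
    with indep show ?thesis by blast
  qed
  show ?thesis
    unfolding wiener_process01_def independent_increments_def
  proof (intro conjI allI ballI impI)
    show "prob_space ?M" by (rule M.prob_space_axioms)
    show "?X t \<in> borel_measurable ?M" if "t \<in> {0..1}" for t by (rule X_meas[OF that])
    show "?X 0 \<omega> = 0" if "\<omega> \<in> space ?M" for \<omega> using that X[of \<omega> 0] by (simp add: sp bm_path_0)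
    show "M.indep_vars (\<lambda>_. borel) (\<lambda>i \<omega>. ?X (t (Suc i)) \<omega> - ?X (t i) \<omega>) {..<n}"
      if "0 \<le> t 0 \<and> (\<forall>i<n. t i < t (Suc i)) \<and> t n \<le> 1" for n and t :: "nat \<Rightarrow> real"
      using law[of t n] that by blast
    show "distributed ?M lborel (\<lambda>\<omega>. ?X t \<omega> - ?X s \<omega>) (normal_density 0 (sqrt (t - s)))"
      if "0 \<le> s \<and> s < t \<and> t \<le> 1" for s t
      \<comment> \<open>A single increment is the case of a partition with two points.\<close>
      using law[of "\<lambda>i. if i = 0 then s else t" 1] that by simp
  qed
qed

section \<open>Rational bounds for the folded normal distribution\<close>

text \<open>Integrating the Taylor polynomial of \<open>exp (- s\<^sup>2 / 2)\<close> over
  \<open>[0, z]\<close> and dividing by \<open>z\<close> gives this polynomial in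
  \<open>y = z\<^sup>2\<close>.\<close>

definition gauss_ser :: "nat \<Rightarrow> real \<Rightarrow> real" where
  "gauss_ser s y = (\<Sum>k<s. (- y / 2) ^ k / real (fact k * (2 * k + 1)))"

definition gauss_err :: "nat \<Rightarrow> real \<Rightarrow> real" where
  "gauss_err s y = (y / 2) ^ s / real (fact s)"

definition upper_cdf2 :: "nat \<Rightarrow> real \<Rightarrow> real" where
  "upper_cdf2 s y = 2 * y * (gauss_ser s y + gauss_err s y) ^ 2"

text \<open>Truncation at \<open>0\<close> keeps the lower bound valid after squaring.\<close>

definition lower_cdf2 :: "nat \<Rightarrow> real \<Rightarrow> real" where
  "lower_cdf2 s y = 2 * y * (max 0 (gauss_ser s y - gauss_err s y)) ^ 2"

definition lower_pi :: "nat \<Rightarrow> real" where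
  "lower_pi s = 4 * (\<Sum>k<2 * s. (- 1) ^ k / real (2 * k + 1))"

definition upper_pi :: "nat \<Rightarrow> real" where
  "upper_pi s = 4 * (\<Sum>k<2 * s + 1. (- 1) ^ k / real (2 * k + 1))"

text \<open>Lagrange's remainder: the intermediate point is negative, so the exponential there is at
  most \<open>1\<close>.\<close>

lemma exp_minus_taylor:
  fixes w :: real
  assumes "0 \<le> w"
  shows "\<bar>exp (- w) - (\<Sum>k<n. (- w) ^ k / fact k)\<bar> \<le> w ^ n / fact n"
proof (cases "w = 0 \<or> n = 0")
  case True
  then show ?thesis
  proof
    assume "w = 0"
    then show ?thesis by (cases n) (auto simp: sum.lessThan_Suc_shift simp del: sum.lessThan_Suc)
  qed (use assms in simp)
next
  case False
  then have "\<exists>t>- w. t < 0 \<and> exp (- w) = (\<Sum>k<n. exp 0 / fact k * (- w) ^ k) + exp t / fact n * (- w) ^ n"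
    using assms by (intro Maclaurin_minus[where diff = "\<lambda>_. exp"]) auto
  then obtain t where t: "t < 0" "exp (- w) = (\<Sum>k<n. exp 0 / fact k * (- w) ^ k) + exp t / fact n * (- w) ^ n"
    by blast
  then have "\<bar>exp (- w) - (\<Sum>k<n. (- w) ^ k / fact k)\<bar> = exp t * (w ^ n / fact n)"
    using assms by (simp add: abs_mult power_abs)
  also have "\<dots> \<le> 1 * (w ^ n / fact n)" using t(1) assms by (intro mult_right_mono) auto
  finally show ?thesis by simp
qed

text \<open>The Taylor estimate for the density is integrated over \<open>[-x, x]\<close>, its
  remainder being largest at the endpoints. The primitive \<open>F\<close> of the Taylor polynomial
  is odd, which produces the factor \<open>2\<close>.\<close>

lemma folded_cdf_series:
  assumes "0 \<le> x"
  shows "\<bar>folded_cdf x * sqrt (2 * pi) - 2 * x * gauss_ser n (x\<^sup>2)\<bar> \<le> 2 * x * gauss_err n (x\<^sup>2)"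
proof -
  let ?I = "\<lambda>f. LINT s|lborel. indicator {-x..x} s *\<^sub>R f s :: real"
  define T where "T s = (\<Sum>k<n. (- (s\<^sup>2 / 2)) ^ k / fact k)" for s :: real
  define F where "F s = (\<Sum>k<n. (- 1 / 2) ^ k / (fact k * real (2 * k + 1)) * s ^ (2 * k + 1))" for s :: real
  have contT: "continuous_on {-x..x} T" unfolding T_def by (intro continuous_intros) auto
  have intT: "integrable lborel (\<lambda>s. indicator {-x..x} s *\<^sub>R T s)"
    by (rule borel_integrable_compact[OF compact_Icc contT])
  have intE: "integrable lborel (\<lambda>s. indicator {-x..x} s *\<^sub>R exp (- (s\<^sup>2 / 2)) :: real)"
    by (rule borel_integrable_compact) (auto intro!: continuous_intros)
  have "?I T = F x - F (- x)"
  proof (rule integral_FTC_atLeastAtMost)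
    show "(F has_vector_derivative T s) (at s within {-x..x})" for s
    proof -
      have dterm: "((\<lambda>s. (- 1 / 2) ^ k / (fact k * real (2 * k + 1)) * s ^ (2 * k + 1)) has_real_derivative
          (- (s\<^sup>2 / 2)) ^ k / fact k) (at s within {-x..x})" for k
      proof -
        have "(- (s\<^sup>2 / 2)) ^ k / fact k = (- 1 / 2) ^ k / (fact k * real (2 * k + 1)) * (real (2 * k + 1) * s ^ (2 * k))"
        proof -
          have "(- (s\<^sup>2 / 2)) ^ k = ((- 1 / 2) * s\<^sup>2) ^ k" by simp
          also have "\<dots> = (- 1 / 2) ^ k * s ^ (2 * k)" by (simp only: power_mult_distrib power_mult)
          finally have "(- (s\<^sup>2 / 2)) ^ k = (- 1 / 2) ^ k * s ^ (2 * k)" .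
          moreover have "real (2 * k + 1) \<noteq> 0" by linarith
          ultimately show ?thesis by simp
        qed
        moreover have "((\<lambda>s. s ^ (2 * k + 1)) has_real_derivative real (2 * k + 1) * s ^ (2 * k)) (at s within {-x..x})"
          using DERIV_pow[of "2 * k + 1" s] by simp
        ultimately show ?thesis using DERIV_cmult[of "\<lambda>s. s ^ (2 * k + 1)"] by metis
      qed
      have "(F has_real_derivative T s) (at s within {-x..x})"
        unfolding F_def T_def by (rule DERIV_sum) (rule dterm)
      then show ?thesis by (simp add: has_real_derivative_iff_has_vector_derivative)
    qed
  qed (use assms contT in auto)
  also have "\<dots> = 2 * F x"
  proof -
    have "F (- x) = - F x" by (simp add: F_def sum_negf[symmetric])
    then show ?thesis by simp
  qed
  also have "F x = x * gauss_ser n (x\<^sup>2)"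
  proof -
    have "(- 1 / 2) ^ k / (fact k * real (2 * k + 1)) * x ^ (2 * k + 1) = x * ((- (x\<^sup>2) / 2) ^ k / real (fact k * (2 * k + 1)))" for k
    proof -
      have "(- (x\<^sup>2) / 2) ^ k = ((- 1 / 2) * x\<^sup>2) ^ k" by simp
      also have "\<dots> = (- 1 / 2) ^ k * x ^ (2 * k)" by (simp only: power_mult_distrib power_mult)
      finally have p: "(- (x\<^sup>2) / 2) ^ k = (- 1 / 2) ^ k * x ^ (2 * k)" .
      have g: "a / D * x ^ (2 * k + 1) = x * (a * x ^ (2 * k) / D)" for a D :: real by simp
      show ?thesis unfolding p of_nat_mult of_nat_fact by (rule g)
    qed
    then show ?thesis unfolding F_def gauss_ser_def sum_distrib_left by (intro sum.cong refl)
  qed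
  finally have IT: "?I T = 2 * x * gauss_ser n (x\<^sup>2)" by simp
  have IE: "?I (\<lambda>s. exp (- (s\<^sup>2 / 2))) = folded_cdf x * sqrt (2 * pi)"
  proof -
    have "folded_cdf x = (LINT s|lborel. indicator {-x..x} s * std_normal_density s)"
      unfolding folded_cdf_def by (rule measure_gauss) simp
    also have "\<dots> = (LINT s|lborel. (indicator {-x..x} s *\<^sub>R exp (- (s\<^sup>2 / 2))) / sqrt (2 * pi))"
      by (intro Bochner_Integration.integral_cong) (auto simp: std_normal_density_def)
    also have "\<dots> = ?I (\<lambda>s. exp (- (s\<^sup>2 / 2))) / sqrt (2 * pi)" by (rule integral_divide_zero)
    finally show ?thesis by simp
  qed
  have "?I (\<lambda>s. exp (- (s\<^sup>2 / 2))) - ?I T = (LINT s|lborel. indicator {-x..x} s *\<^sub>R exp (- (s\<^sup>2 / 2)) - indicator {-x..x} s *\<^sub>R T s)"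
    by (rule Bochner_Integration.integral_diff[symmetric, OF intE intT])
  then have "\<bar>?I (\<lambda>s. exp (- (s\<^sup>2 / 2))) - ?I T\<bar> \<le> (LINT s|lborel. \<bar>indicator {-x..x} s *\<^sub>R exp (- (s\<^sup>2 / 2)) - indicator {-x..x} s *\<^sub>R T s\<bar>)"
    by (simp only:) (rule integral_abs_bound)
  also have "\<dots> \<le> (LINT s|lborel. indicator {-x..x} s *\<^sub>R gauss_err n (x\<^sup>2))"
  proof (rule integral_mono)
    show "integrable lborel (\<lambda>s. \<bar>indicator {-x..x} s *\<^sub>R exp (- (s\<^sup>2 / 2)) - indicator {-x..x} s *\<^sub>R T s\<bar>)"
      using intE intT by (intro integrable_abs Bochner_Integration.integrable_diff)
    show "integrable lborel (\<lambda>s. indicator {-x..x} s *\<^sub>R gauss_err n (x\<^sup>2))"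
      using assms by (intro integrable_scaleR_left integrable_real_indicator) auto
    show "\<bar>indicator {-x..x} s *\<^sub>R exp (- (s\<^sup>2 / 2)) - indicator {-x..x} s *\<^sub>R T s\<bar> \<le> indicator {-x..x} s *\<^sub>R gauss_err n (x\<^sup>2)" for s
    proof (cases "s \<in> {-x..x}")
      case True
      then have "\<bar>s\<bar> \<le> x" by auto
      then have "s\<^sup>2 \<le> x\<^sup>2" by (metis abs_le_square_iff abs_of_nonneg assms)
      then have "(s\<^sup>2 / 2) ^ n / fact n \<le> (x\<^sup>2 / 2) ^ n / fact n" by (intro divide_right_mono power_mono[of "s\<^sup>2 / 2"]) auto
      moreover have "\<bar>exp (- (s\<^sup>2 / 2)) - T s\<bar> \<le> (s\<^sup>2 / 2) ^ n / fact n"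
        unfolding T_def by (rule exp_minus_taylor) simp
      moreover have "indicator {-x..x} s = (1::real)" using True by simp
      ultimately show ?thesis by (simp add: gauss_err_def)
    qed auto
  qed
  also have "\<dots> = 2 * x * gauss_err n (x\<^sup>2)" using assms by simp
  finally show ?thesis by (simp only: IT IE)
qed

lemma gauss_err_tendsto: "(\<lambda>n. gauss_err n y) \<longlonglongrightarrow> 0"
proof -
  have "(\<lambda>n. inverse (fact n) * (y / 2) ^ n) \<longlonglongrightarrow> 0"
    by (rule summable_LIMSEQ_zero[OF summable_exp])
  moreover have "gauss_err n y = inverse (fact n) * (y / 2) ^ n" for n
    by (simp only: gauss_err_def divide_inverse[of "(y / 2) ^ n"] of_nat_fact mult.commute[of "(y / 2) ^ n"])
  ultimately show ?thesis by simp
qed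

context
  fixes z y :: real
  assumes z: "0 < z" and y: "y = z\<^sup>2"
begin

lemma gauss_ser_bound: "\<bar>folded_cdf z * sqrt (2 * pi) / (2 * z) - gauss_ser n y\<bar> \<le> gauss_err n y"
proof -
  have "\<bar>folded_cdf z * sqrt (2 * pi) - 2 * z * gauss_ser n y\<bar> \<le> 2 * z * gauss_err n y"
    unfolding y using folded_cdf_series[of z n] z by simp
  moreover have "folded_cdf z * sqrt (2 * pi) - 2 * z * gauss_ser n y
      = 2 * z * (folded_cdf z * sqrt (2 * pi) / (2 * z) - gauss_ser n y)"
    using z by (simp add: right_diff_distrib)
  ultimately show ?thesis using z by (simp add: abs_mult)
qed

text \<open>Squaring removes both irrationalities: \<open>pi\<close> occurs linearly, and
  \<open>z\<close> enters the left factor only through \<open>y\<close>.\<close>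

lemma folded_cdf2: "2 * y * (folded_cdf z * sqrt (2 * pi) / (2 * z)) ^ 2 = (folded_cdf z)\<^sup>2 * pi"
  using z unfolding y by (simp add: power_mult_distrib power_divide)

lemma folded_cdf2_bounds: "lower_cdf2 n y \<le> (folded_cdf z)\<^sup>2 * pi" "(folded_cdf z)\<^sup>2 * pi \<le> upper_cdf2 n y"
proof -
  let ?S = "folded_cdf z * sqrt (2 * pi) / (2 * z)"
  have S: "0 \<le> ?S" using z folded_cdf_nonneg[of z] by simp
  have "gauss_ser n y - gauss_err n y \<le> ?S" "?S \<le> gauss_ser n y + gauss_err n y"
    using gauss_ser_bound[of n] by linarith+
  then have "(max 0 (gauss_ser n y - gauss_err n y)) ^ 2 \<le> ?S ^ 2" "?S ^ 2 \<le> (gauss_ser n y + gauss_err n y) ^ 2"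
    using S by (auto intro!: power_mono)
  then have "2 * y * (max 0 (gauss_ser n y - gauss_err n y)) ^ 2 \<le> 2 * y * ?S ^ 2"
    "2 * y * ?S ^ 2 \<le> 2 * y * (gauss_ser n y + gauss_err n y) ^ 2"
    using y by (auto intro!: mult_left_mono)
  then show "lower_cdf2 n y \<le> (folded_cdf z)\<^sup>2 * pi" "(folded_cdf z)\<^sup>2 * pi \<le> upper_cdf2 n y"
    by (simp_all only: folded_cdf2 lower_cdf2_def upper_cdf2_def)
qed

lemma folded_cdf2_tendsto:
  "(\<lambda>n. lower_cdf2 n y) \<longlonglongrightarrow> (folded_cdf z)\<^sup>2 * pi" "(\<lambda>n. upper_cdf2 n y) \<longlonglongrightarrow> (folded_cdf z)\<^sup>2 * pi"
proof -
  let ?S = "folded_cdf z * sqrt (2 * pi) / (2 * z)"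
  have S: "0 \<le> ?S" using z folded_cdf_nonneg[of z] by simp
  have "(\<lambda>n. ?S - gauss_ser n y) \<longlonglongrightarrow> 0"
    by (rule Lim_null_comparison[OF _ gauss_err_tendsto[of y]]) (use gauss_ser_bound in auto)
  from tendsto_diff[OF tendsto_const[of ?S] this] have lim: "(\<lambda>n. gauss_ser n y) \<longlonglongrightarrow> ?S" by simp
  have "(\<lambda>n. 2 * y * (max 0 (gauss_ser n y - gauss_err n y)) ^ 2) \<longlonglongrightarrow> 2 * y * (max 0 (?S - 0)) ^ 2"
    by (intro tendsto_intros lim gauss_err_tendsto)
  then show "(\<lambda>n. lower_cdf2 n y) \<longlonglongrightarrow> (folded_cdf z)\<^sup>2 * pi"
    using S folded_cdf2 unfolding lower_cdf2_def by simp
  have "(\<lambda>n. 2 * y * (gauss_ser n y + gauss_err n y) ^ 2) \<longlonglongrightarrow> 2 * y * (?S + 0) ^ 2"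
    by (intro tendsto_intros lim gauss_err_tendsto)
  then show "(\<lambda>n. upper_cdf2 n y) \<longlonglongrightarrow> (folded_cdf z)\<^sup>2 * pi"
    using folded_cdf2 unfolding upper_cdf2_def by simp
qed

end

lemma pi_bounds: "lower_pi s \<le> pi" "pi \<le> upper_pi s" "lower_pi \<longlonglongrightarrow> pi" "upper_pi \<longlonglongrightarrow> pi"
proof -
  define a where "a k = 1 / real (2 * k + 1)" for k
  have a0: "a \<longlonglongrightarrow> 0" unfolding a_def by real_asymp
  have pos: "0 \<le> a k" and mono: "a (Suc k) \<le> a k" for k by (auto simp: a_def field_simps)
  note L = summable_Leibniz'[OF a0 pos mono]
  have val: "4 * (\<Sum>k. (- 1) ^ k * a k) = pi"
    using pi_series by (simp add: a_def mult.commute add.commute)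
  have eq: "lower_pi = (\<lambda>s. 4 * (\<Sum>k<2 * s. (- 1) ^ k * a k))" "upper_pi = (\<lambda>s. 4 * (\<Sum>k<2 * s + 1. (- 1) ^ k * a k))"
    by (simp_all add: lower_pi_def upper_pi_def a_def fun_eq_iff)
  have "(\<lambda>s. 4 * (\<Sum>k<2 * s. (- 1) ^ k * a k)) \<longlonglongrightarrow> 4 * (\<Sum>k. (- 1) ^ k * a k)"
    "(\<lambda>s. 4 * (\<Sum>k<2 * s + 1. (- 1) ^ k * a k)) \<longlonglongrightarrow> 4 * (\<Sum>k. (- 1) ^ k * a k)"
    by (intro tendsto_intros L)+
  then show "lower_pi \<longlonglongrightarrow> pi" "upper_pi \<longlonglongrightarrow> pi" unfolding eq val .
  have "4 * (\<Sum>k<2 * s. (- 1) ^ k * a k) \<le> 4 * (\<Sum>k. (- 1) ^ k * a k)"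
    "4 * (\<Sum>k. (- 1) ^ k * a k) \<le> 4 * (\<Sum>k<2 * s + 1. (- 1) ^ k * a k)"
    by (intro mult_left_mono L, simp)+
  then show "lower_pi s \<le> pi" "pi \<le> upper_pi s" unfolding eq val .
qed

lemma upper_cdf2_0: "upper_cdf2 s 0 = 0"
  by (simp add: upper_cdf2_def)

text \<open>A rational test that implies \<open>folded_cdf z \<le> v\<close> when
  \<open>y = z\<^sup>2\<close>: both sides are squared and multiplied by \<open>pi\<close>, and each
  is replaced by its bound on the unfavourable side.\<close>

definition below_quantile :: "nat \<Rightarrow> real \<Rightarrow> real \<Rightarrow> bool" where
  "below_quantile s v y \<longleftrightarrow> upper_cdf2 s y \<le> v\<^sup>2 * lower_pi s"

definition above_quantile :: "nat \<Rightarrow> real \<Rightarrow> real \<Rightarrow> bool" where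
  "above_quantile s v y \<longleftrightarrow> v\<^sup>2 * upper_pi s \<le> lower_cdf2 s y"

lemma below_quantile_sound:
  assumes "below_quantile s v (z\<^sup>2)" "0 \<le> z" "0 \<le> v" "v \<le> V" "V < 1"
  shows "z \<le> quantile V"
proof (cases "z = 0")
  case False
  then have "(folded_cdf z)\<^sup>2 * pi \<le> upper_cdf2 s (z\<^sup>2)" using assms by (intro folded_cdf2_bounds) auto
  also have "\<dots> \<le> v\<^sup>2 * lower_pi s" using assms by (simp add: below_quantile_def)
  also have "\<dots> \<le> v\<^sup>2 * pi" by (intro mult_left_mono pi_bounds) auto
  finally have "(folded_cdf z)\<^sup>2 \<le> v\<^sup>2" by simp
  then have "folded_cdf z \<le> v" using assms(3) by (rule power2_le_imp_le)
  then show ?thesis using le_quantile_iff[of V z] assms by simp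
qed (simp add: quantile_nonneg)

text \<open>The test also certifies \<open>V < 1\<close>, because \<open>folded_cdf\<close> stays
  below \<open>1\<close>; this is where \<open>coef_sound\<close> obtains that fact.\<close>

lemma above_quantile_sound:
  assumes "above_quantile s v (z\<^sup>2)" "0 < z" "0 \<le> V" "V \<le> v"
  shows "V < 1 \<and> quantile V \<le> z"
proof -
  have "v\<^sup>2 * pi \<le> v\<^sup>2 * upper_pi s" by (intro mult_left_mono pi_bounds) auto
  also have "\<dots> \<le> lower_cdf2 s (z\<^sup>2)" using assms by (simp add: above_quantile_def)
  also have "\<dots> \<le> (folded_cdf z)\<^sup>2 * pi" using assms by (intro folded_cdf2_bounds) auto
  finally have "v\<^sup>2 \<le> (folded_cdf z)\<^sup>2" by simp
  then have "v \<le> folded_cdf z" using folded_cdf_nonneg by (rule power2_le_imp_le)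
  with assms have "V \<le> folded_cdf z" by simp
  then show ?thesis using quantile_le_iff[of V z] folded_cdf_less_1[of z] assms by linarith
qed

text \<open>A strict inequality between the limits is recognised at some accuracy. At
  \<open>z = 0\<close> the bound \<open>upper_cdf2\<close> is exactly \<open>0\<close>, so the test
  succeeds as soon as \<open>lower_pi\<close> is positive; coefficients below the first grid step
  depend on this case.\<close>

lemma below_quantile_complete:
  assumes "z = 0 \<or> z < quantile V" "0 \<le> z" "0 \<le> V" "V < 1" "v \<longlonglongrightarrow> V"
  shows "\<forall>\<^sub>F s in sequentially. below_quantile s (v s) (z\<^sup>2)"
proof (cases "z = 0")
  case True
  have "\<forall>\<^sub>F s in sequentially. 0 < lower_pi s" by (rule order_tendstoD(1)[OF pi_bounds(3)]) simp
  then show ?thesis by eventually_elim (simp add: below_quantile_def True upper_cdf2_0)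
next
  case False
  then have "z < quantile V" using assms by simp
  then have "folded_cdf z < V"
    using quantile[of V] assms folded_cdf_strict_mono[of z "quantile V"] by simp
  then have "(folded_cdf z)\<^sup>2 < V\<^sup>2" using folded_cdf_nonneg by (intro power_strict_mono) auto
  then have lt: "(folded_cdf z)\<^sup>2 * pi < V\<^sup>2 * pi" by simp
  then obtain c where c: "(folded_cdf z)\<^sup>2 * pi < c" "c < V\<^sup>2 * pi" using dense by blast
  have "\<forall>\<^sub>F s in sequentially. upper_cdf2 s (z\<^sup>2) < c"
    using False assms c by (intro order_tendstoD(2)[OF folded_cdf2_tendsto(2)]) auto
  moreover have "(\<lambda>s. (v s)\<^sup>2 * lower_pi s) \<longlonglongrightarrow> V\<^sup>2 * pi" by (intro tendsto_intros assms pi_bounds)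
  then have "\<forall>\<^sub>F s in sequentially. c < (v s)\<^sup>2 * lower_pi s" using c by (intro order_tendstoD) auto
  ultimately show ?thesis by eventually_elim (simp add: below_quantile_def)
qed

lemma above_quantile_complete:
  assumes "quantile V < z" "0 \<le> V" "V < 1" "v \<longlonglongrightarrow> V"
  shows "\<forall>\<^sub>F s in sequentially. above_quantile s (v s) (z\<^sup>2)"
proof -
  have q: "0 \<le> quantile V" by (rule quantile_nonneg)
  have "V < folded_cdf z"
    using quantile[of V] assms folded_cdf_strict_mono[of "quantile V" z] q by simp
  then have "V\<^sup>2 < (folded_cdf z)\<^sup>2" using assms by (intro power_strict_mono) auto
  then have lt: "V\<^sup>2 * pi < (folded_cdf z)\<^sup>2 * pi" by simp
  then obtain c where c: "V\<^sup>2 * pi < c" "c < (folded_cdf z)\<^sup>2 * pi" using dense by blast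
  have "\<forall>\<^sub>F s in sequentially. c < lower_cdf2 s (z\<^sup>2)"
    using assms q c by (intro order_tendstoD(1)[OF folded_cdf2_tendsto(1)]) auto
  moreover have "(\<lambda>s. (v s)\<^sup>2 * upper_pi s) \<longlonglongrightarrow> V\<^sup>2 * pi" by (intro tendsto_intros assms pi_bounds)
  then have "\<forall>\<^sub>F s in sequentially. (v s)\<^sup>2 * upper_pi s < c" using c by (intro order_tendstoD) auto
  ultimately show ?thesis by eventually_elim (simp add: above_quantile_def)
qed

section \<open>Approximating the sample path from a finite prefix\<close>

text \<open>The bits read so far are kept as one number; a further bit adds a multiple of
  \<open>2 ^ n\<close> and leaves the earlier digits in place.\<close>

definition prefix_code :: "(nat \<Rightarrow> bool) \<Rightarrow> nat \<Rightarrow> nat" where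
  "prefix_code \<omega> n = (\<Sum>x<n. of_bool (\<omega> x) * 2 ^ x)"

definition code_bit :: "nat \<Rightarrow> nat \<Rightarrow> bool" where
  "code_bit p x \<longleftrightarrow> (p div 2 ^ x) mod 2 = 1"

lemma code_bit_prefix: "x < n \<Longrightarrow> code_bit (prefix_code \<omega> n) x = \<omega> x"
proof -
  assume "x < n"
  have "prefix_code \<omega> n = horner_sum of_bool 2 (map \<omega> [0..<n])"
    by (simp add: prefix_code_def horner_sum_eq_sum atLeast0LessThan)
  then have "bit (prefix_code \<omega> n) x \<longleftrightarrow> \<omega> x"
    using \<open>x < n\<close> by (simp add: bit_horner_sum_bit_iff)
  then show ?thesis by (simp add: code_bit_def bit_iff_odd odd_iff_mod_2_eq_one)
qed

definition selector_part :: "nat \<Rightarrow> nat \<Rightarrow> real" where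
  "selector_part p s = (\<Sum>j<s. real (of_bool (code_bit p (row 0 j))) / real (2 ^ Suc j))"

definition seed_part :: "nat \<Rightarrow> nat \<Rightarrow> nat \<Rightarrow> real" where
  "seed_part p i s = (\<Sum>j<s. real (of_bool (code_bit p (row (Suc i) (2 * j + 1)))) / real (2 ^ Suc j))"

text \<open>Exceeds the Cantor numbers of all positions with row at most \<open>s\<close> and column
  below \<open>2 * s\<close>; the factor \<open>2\<close> is due to the seeds, which use odd
  columns.\<close>

definition bits_needed :: "nat \<Rightarrow> nat" where
  "bits_needed s = (3 * s + 1) ^ 2"

lemma row_less: 
  assumes "r \<le> s" "j < 2 * s" shows "row r j < bits_needed s"
proof -
  have "(r + j) * Suc (r + j) \<le> (3 * s) * (3 * s)" using assms by (intro mult_le_mono) auto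
  then have "row r j \<le> 9 * s * s + s"
    using assms by (simp add: row_def prod_encode_def triangle_def)
  then show ?thesis by (simp add: bits_needed_def power2_eq_square algebra_simps)
qed

lemma selector_part_prefix:
  assumes "bits_needed s \<le> n"
  shows "selector_part (prefix_code \<omega> n) s = ureal_part (subseq_by (row 0) \<omega>) s"
  unfolding selector_part_def ureal_part_def
proof (intro sum.cong refl)
  fix j assume "j \<in> {..<s}"
  then have "row 0 j < n" using row_less[of 0 s j] assms by simp
  then show "real (of_bool (code_bit (prefix_code \<omega> n) (row 0 j))) / real (2 ^ Suc j) = of_bool (subseq_by (row 0) \<omega> j) / 2 ^ Suc j"
    by (simp add: code_bit_prefix subseq_by_def)
qed

lemma seed_part_prefix:
  assumes "bits_needed s \<le> n" "i < s"
  shows "seed_part (prefix_code \<omega> n) i s = ureal_part (subseq_by (\<lambda>j. 2 * j + 1) (subseq_by (row (Suc i)) \<omega>)) s"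
  unfolding seed_part_def ureal_part_def
proof (intro sum.cong refl)
  fix j assume "j \<in> {..<s}"
  then have "row (Suc i) (2 * j + 1) < n" using row_less[of "Suc i" s "2 * j + 1"] assms by simp
  then show "real (of_bool (code_bit (prefix_code \<omega> n) (row (Suc i) (2 * j + 1)))) / real (2 ^ Suc j)
      = of_bool (subseq_by (\<lambda>j. 2 * j + 1) (subseq_by (row (Suc i)) \<omega>) j) / 2 ^ Suc j"
    by (simp add: code_bit_prefix subseq_by_def)
qed

lemma selector_part_bounds:
  assumes "bits_needed s \<le> n"
  shows "selector_part (prefix_code \<omega> n) s \<le> selector \<omega>" "selector \<omega> \<le> selector_part (prefix_code \<omega> n) s + 1 / real (2 ^ s)"
  using ureal_part_le[of "subseq_by (row 0) \<omega>" s] ureal_le_part[of "subseq_by (row 0) \<omega>" s]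
  by (simp_all add: selector_part_prefix[OF assms] selector_def)

lemma seed_part_bounds:
  assumes "bits_needed s \<le> n" "i < s"
  shows "seed_part (prefix_code \<omega> n) i s \<le> seed \<omega> i" "seed \<omega> i \<le> seed_part (prefix_code \<omega> n) i s + 1 / real (2 ^ s)"
  using ureal_part_le[of "subseq_by (\<lambda>j. 2 * j + 1) (subseq_by (row (Suc i)) \<omega>)" s]
    ureal_le_part[of "subseq_by (\<lambda>j. 2 * j + 1) (subseq_by (row (Suc i)) \<omega>)" s]
  by (simp_all add: seed_part_prefix[OF assms] seed_def row_seed_def)

definition level_ok :: "nat \<Rightarrow> nat \<Rightarrow> nat \<Rightarrow> bool" where
  "level_ok s p m \<longleftrightarrow> real m / real (m + 1) < selector_part p s \<and>
     selector_part p s + 1 / real (2 ^ s) < real (m + 1) / real (m + 2)"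

definition find_level :: "nat \<Rightarrow> nat \<Rightarrow> nat" where
  "find_level s p = search s (level_ok s p)"

text \<open>By \<open>rho ^ 4 = 1 / 2\<close> the truncation error \<open>10 * rho ^ M\<close> is at
  most \<open>10 / 2 ^ (k + 5)\<close>, less than half of \<open>1 / 2 ^ k\<close>. The summand
  \<open>m\<close> makes the depth at least the level, as \<open>bm_path_tail\<close>
  requires.\<close>

definition depth :: "nat \<Rightarrow> nat \<Rightarrow> nat" where
  "depth k m = 4 * (k + 5) + m"

text \<open>With \<open>M\<close> the depth, a vertex combines \<open>M + 1\<close> coefficients
  with weights at most \<open>1\<close>. An error \<open>1 / 2 ^ T\<close> in each gives
  \<open>(M + 1) / 2 ^ T\<close>, and \<open>M + 1 \<le> 2 ^ M\<close> leaves
  \<open>1 / 2 ^ (k + 1)\<close>.\<close>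

definition precision :: "nat \<Rightarrow> nat \<Rightarrow> nat" where
  "precision k m = k + 1 + depth k m"

text \<open>Certifies that the scaled modulus lies in the window from \<open>j / 2 ^ T\<close> to
  \<open>(j + 2) / 2 ^ T\<close>. Consecutive windows overlap, so no value is confined to
  boundaries, where no finite prefix could decide. The factor \<open>2 ^ n\<close> is the scaling by
  \<open>sqrt (2 ^ n)\<close> in squared form.\<close>

definition grid_ok :: "nat \<Rightarrow> nat \<Rightarrow> nat \<Rightarrow> nat \<Rightarrow> nat \<Rightarrow> nat \<Rightarrow> nat \<Rightarrow> bool" where
  "grid_ok T m s p n i j \<longleftrightarrow>
     below_quantile s (cond_seed m i (seed_part p i s)) (real (2 ^ n) * (real j / real (2 ^ T)) ^ 2) \<and>
     above_quantile s (cond_seed m i (seed_part p i s + 1 / real (2 ^ s))) (real (2 ^ n) * (real (j + 2) / real (2 ^ T)) ^ 2)"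

definition find_grid :: "nat \<Rightarrow> nat \<Rightarrow> nat \<Rightarrow> nat \<Rightarrow> nat \<Rightarrow> nat \<Rightarrow> nat" where
  "find_grid T m s p n i = search s (grid_ok T m s p n i)"

definition coef :: "nat \<Rightarrow> nat \<Rightarrow> nat \<Rightarrow> nat \<Rightarrow> nat \<Rightarrow> nat \<Rightarrow> real" where
  "coef T m s p n i = (if code_bit p (row (Suc i) 0) then 1 else - 1) * (real (find_grid T m s p n i + 1) / real (2 ^ T))"

text \<open>The conditions \<open>find_grid ... < s\<close> say that the searches succeeded;
  \<open>2 ^ M \<le> s\<close> puts the seeds of all coefficients up to depth \<open>M\<close>
  within the part of the input that accuracy \<open>s\<close> reads.\<close>

definition stage_ok :: "nat \<Rightarrow> nat \<Rightarrow> nat \<Rightarrow> nat \<Rightarrow> nat \<Rightarrow> bool" where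
  "stage_ok T M m s p \<longleftrightarrow> m < s \<and> 2 ^ M \<le> s \<and> find_grid T m s p 0 0 < s \<and>
     (\<forall>n<M. \<forall>j<2 ^ n. find_grid T m s p n (2 ^ n + j) < s)"

definition ready :: "nat \<Rightarrow> nat \<Rightarrow> nat \<Rightarrow> bool" where
  "ready k s p \<longleftrightarrow> stage_ok (precision k (find_level s p)) (depth k (find_level s p)) (find_level s p) s p"

text \<open>At a dyadic point at most one tent per level is nonzero; quotient and remainder of
  \<open>l * 2 ^ n\<close> by \<open>2 ^ M\<close> give its index and argument. At
  \<open>l = 2 ^ M\<close> the quotient is one too large, but the remainder \<open>0\<close> makes
  the term vanish.\<close>

definition vertex :: "nat \<Rightarrow> nat \<Rightarrow> nat \<Rightarrow> nat \<Rightarrow> nat \<Rightarrow> nat \<Rightarrow> real" where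
  "vertex T M m s p l = coef T m s p 0 0 * (real l / real (2 ^ M)) +
     (\<Sum>n<M. coef T m s p n (2 ^ n + (l * 2 ^ n) div 2 ^ M) *
        (real (min ((l * 2 ^ n) mod 2 ^ M) (2 ^ M - (l * 2 ^ n) mod 2 ^ M)) / real (2 ^ M)))"

section \<open>Soundness of the searches, and their success on the domain\<close>

lemma find_level_sound:
  assumes "bits_needed s \<le> n" "find_level s (prefix_code \<omega> n) < s"
  shows "find_level s (prefix_code \<omega> n) = level \<omega>"
proof -
  let ?m = "find_level s (prefix_code \<omega> n)"
  have "level_ok s (prefix_code \<omega> n) ?m"
    using search_cases[of "level_ok s (prefix_code \<omega> n)" s] assms(2) by (auto simp: find_level_def)
  then have "at_level ?m (selector \<omega>)"
    using selector_part_bounds[OF assms(1), of \<omega>] by (auto simp: level_ok_def at_level_def add.commute)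
  then show ?thesis by (simp add: level_eq)
qed

lemma cond_seed_mono: "u \<le> v \<Longrightarrow> cond_seed m i u \<le> cond_seed m i v"
  using eps_bounds[of i] by (auto simp: cond_seed_def intro: mult_left_mono)

lemma cond_seed_nonneg: "0 \<le> u \<Longrightarrow> 0 \<le> cond_seed m i u"
  using eps_bounds[of i] by (auto simp: cond_seed_def)

lemma seed_part_nonneg: "0 \<le> seed_part p i s"
  unfolding seed_part_def by (intro sum_nonneg) auto

lemma coef_sound:
  assumes "bits_needed s \<le> len" "i < s" "find_grid T (level \<omega>) s (prefix_code \<omega> len) n i < s"
  shows "\<bar>zeta \<omega> i / sqrt (2 ^ n) - coef T (level \<omega>) s (prefix_code \<omega> len) n i\<bar> \<le> 1 / 2 ^ T"
proof -
  let ?p = "prefix_code \<omega> len" and ?m = "level \<omega>"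
  define j where "j = find_grid T ?m s ?p n i"
  define V where "V = cond_seed ?m i (seed \<omega> i)"
  have ok: "grid_ok T ?m s ?p n i j"
    using search_cases[of "grid_ok T ?m s ?p n i" s] assms(3) by (auto simp: find_grid_def j_def)
  have sq: "real (2 ^ n) * (x / real (2 ^ T)) ^ 2 = (sqrt (2 ^ n) * x / 2 ^ T)\<^sup>2" for x
    by (simp add: power_mult_distrib power_divide)
  have V0: "0 \<le> V" unfolding V_def by (intro cond_seed_nonneg seed_bounds)
  have 1: "V < 1 \<and> quantile V \<le> sqrt (2 ^ n) * real (j + 2) / 2 ^ T"
    using ok V0 seed_part_bounds(2)[OF assms(1,2), of \<omega>] unfolding grid_ok_def sq V_def
    by (intro above_quantile_sound[where s = s]) (auto intro: cond_seed_mono)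
  have 2: "sqrt (2 ^ n) * real j / 2 ^ T \<le> quantile V"
    using ok V0 1 seed_part_bounds(1)[OF assms(1,2), of \<omega>] unfolding grid_ok_def sq V_def
    by (intro below_quantile_sound[where s = s and v = "cond_seed ?m i (seed_part ?p i s)"])
       (auto intro: cond_seed_mono cond_seed_nonneg seed_part_nonneg)
  have q: "real j / 2 ^ T \<le> quantile V / sqrt (2 ^ n)" "quantile V / sqrt (2 ^ n) \<le> real (j + 2) / 2 ^ T"
    using 1 2 by (auto simp: field_simps)
  \<comment> \<open>The value taken by \<open>coef\<close> is the midpoint of the window, hence
    within half its width.\<close>
  define a e :: real where "a = real j / 2 ^ T" and "e = 1 / 2 ^ T"
  have "real (j + 1) / 2 ^ T = a + e" "real (j + 2) / 2 ^ T = a + 2 * e"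
    by (simp_all add: a_def e_def add_divide_distrib)
  with q have "\<bar>quantile V / sqrt (2 ^ n) - real (j + 1) / 2 ^ T\<bar> \<le> e"
    unfolding a_def[symmetric] by (simp only:)
  then have q': "\<bar>quantile V / sqrt (2 ^ n) - real (j + 1) / 2 ^ T\<bar> \<le> 1 / 2 ^ T" by (simp only: e_def)
  have bit: "code_bit ?p (row (Suc i) 0) = \<omega> (row (Suc i) 0)"
    using row_less[of "Suc i" s 0] assms by (intro code_bit_prefix) auto
  have z: "zeta \<omega> i = (if \<omega> (row (Suc i) 0) then 1 else - 1) * quantile V"
    by (simp add: zeta_def row_gauss_def V_def seed_def subseq_by_def)
  have sign: "\<bar>(if b then 1 else - 1) * x / c - (if b then 1 else - 1) * y\<bar> = \<bar>x / c - y\<bar>" for b and x y c :: real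
    by (cases b) (simp_all add: abs_minus_commute)
  show ?thesis
    using q' unfolding z coef_def bit j_def[symmetric] sign by simp
qed

text \<open>On the domain the conditioned seed is below \<open>1\<close>, so its quantile is a
  genuine value, and the tests for a suitable window compare distinct numbers (or the grid point
  \<open>0\<close>). The search may stop at an earlier window, which \<open>coef_sound\<close>
  allows.\<close>

lemma grid_complete:
  assumes "\<omega> \<in> gauss_dom"
  shows "\<forall>\<^sub>F s in sequentially. \<forall>len\<ge>bits_needed s. find_grid T (level \<omega>) s (prefix_code \<omega> len) n i < s"
proof -
  let ?m = "level \<omega>"
  define b where "b = subseq_by (\<lambda>j. 2 * j + 1) (subseq_by (row (Suc i)) \<omega>)"
  define V where "V = cond_seed ?m i (seed \<omega> i)"
  have ub: "seed \<omega> i = ureal b" by (simp add: seed_def row_seed_def b_def)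
  have V0: "0 \<le> V" unfolding V_def by (intro cond_seed_nonneg seed_bounds)
  have V1: "V < 1"
  proof (cases "i < ?m")
    case True
    then have u: "seed \<omega> i < 1" using gauss_domD(2)[OF assms] by blast
    then have "eps i * seed \<omega> i < eps i * 1" using eps_bounds[of i] by (intro mult_strict_left_mono) auto
    with u True show ?thesis by (auto simp: V_def cond_seed_def)
  next
    case False
    have "(1 - eps i) * seed \<omega> i \<le> (1 - eps i) * 1" using eps_bounds[of i] seed_bounds[of \<omega> i] by (intro mult_left_mono) auto
    moreover have "V = (1 - eps i) * seed \<omega> i" using False by (simp add: V_def cond_seed_def)
    ultimately have "V \<le> 1 - eps i" by simp
    then show ?thesis using eps_bounds(1)[of i] by linarith
  qed
  have cont: "(\<lambda>s. cond_seed ?m i (f s)) \<longlonglongrightarrow> V" if "f \<longlonglongrightarrow> seed \<omega> i" for f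
    using that unfolding V_def cond_seed_def by (auto intro!: tendsto_intros)
  have l1: "(\<lambda>s. cond_seed ?m i (ureal_part b s)) \<longlonglongrightarrow> V"
    unfolding ub[symmetric] by (rule cont) (simp add: ub ureal_part_tendsto)
  have "(\<lambda>s. ureal_part b s + (1 / 2) ^ s) \<longlonglongrightarrow> ureal b + 0"
    by (intro tendsto_intros ureal_part_tendsto LIMSEQ_realpow_zero) auto
  then have l2: "(\<lambda>s. cond_seed ?m i (ureal_part b s + 1 / real (2 ^ s))) \<longlonglongrightarrow> V"
    by (intro cont) (simp add: ub power_divide)
  define q where "q = quantile V / sqrt (2 ^ n)"
  \<comment> \<open>The largest grid index strictly below \<open>q * 2 ^ T\<close>, cut off at
    \<open>0\<close>; then \<open>j + 2\<close> lies strictly above.\<close>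
  define j where "j = nat (\<lceil>q * 2 ^ T\<rceil> - 1)"
  have q0: "0 \<le> q" by (simp add: q_def quantile_nonneg)
  have j: "j = 0 \<or> real j < q * 2 ^ T" "q * 2 ^ T < real (j + 2)"
    unfolding j_def by linarith+
  have sq: "real (2 ^ n) * (x / real (2 ^ T)) ^ 2 = (sqrt (2 ^ n) * x / 2 ^ T)\<^sup>2" for x
    by (simp add: power_mult_distrib power_divide)
  have z: "sqrt (2 ^ n) * real j / 2 ^ T = 0 \<or> sqrt (2 ^ n) * real j / 2 ^ T < quantile V"
    "quantile V < sqrt (2 ^ n) * real (j + 2) / 2 ^ T"
    using j by (auto simp: q_def field_simps)
  have "\<forall>\<^sub>F s in sequentially. below_quantile s (cond_seed ?m i (ureal_part b s)) ((sqrt (2 ^ n) * real j / 2 ^ T)\<^sup>2)"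
    by (rule below_quantile_complete[OF z(1) _ V0 V1 l1]) simp
  moreover have "\<forall>\<^sub>F s in sequentially. above_quantile s (cond_seed ?m i (ureal_part b s + 1 / real (2 ^ s))) ((sqrt (2 ^ n) * real (j + 2) / 2 ^ T)\<^sup>2)"
    by (rule above_quantile_complete[OF z(2) V0 V1 l2])
  ultimately show ?thesis
    using eventually_gt_at_top[of i] eventually_gt_at_top[of j]
  proof eventually_elim
    case (elim s)
    show ?case
    proof (intro allI impI)
      fix len assume "bits_needed s \<le> len"
      then have sp: "seed_part (prefix_code \<omega> len) i s = ureal_part b s"
        using seed_part_prefix[of s len i \<omega>] elim(3) by (simp only: b_def)
      have "grid_ok T ?m s (prefix_code \<omega> len) n i j"
        unfolding grid_ok_def sq sp using elim by blast
      then show "find_grid T ?m s (prefix_code \<omega> len) n i < s"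
        unfolding find_grid_def using search_found[of j s "grid_ok T ?m s (prefix_code \<omega> len) n i"] elim by blast
    qed
  qed
qed

lemma level_complete:
  assumes "\<omega> \<in> gauss_dom"
  shows "\<forall>\<^sub>F s in sequentially. \<forall>len\<ge>bits_needed s. find_level s (prefix_code \<omega> len) < s"
proof -
  let ?m = "level \<omega>"
  define b where "b = subseq_by (row 0) \<omega>"
  have sel: "selector \<omega> = ureal b" by (simp add: selector_def b_def)
  have lv: "real ?m / real (?m + 1) < ureal b" "ureal b < real (?m + 1) / real (?m + 2)"
    using gauss_domD(1)[OF assms] by (auto simp: at_level_def sel add.commute)
  have "(\<lambda>s. ureal_part b s + (1 / 2) ^ s) \<longlonglongrightarrow> ureal b + 0"
    by (intro tendsto_intros ureal_part_tendsto LIMSEQ_realpow_zero) auto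
  then have "\<forall>\<^sub>F s in sequentially. ureal_part b s + (1 / 2) ^ s < real (?m + 1) / real (?m + 2)"
    using lv by (intro order_tendstoD) auto
  moreover have "\<forall>\<^sub>F s in sequentially. real ?m / real (?m + 1) < ureal_part b s"
    using lv by (intro order_tendstoD(1)[OF ureal_part_tendsto])
  ultimately show ?thesis using eventually_gt_at_top[of ?m]
  proof eventually_elim
    case (elim s)
    show ?case
    proof (intro allI impI)
      fix len assume "bits_needed s \<le> len"
      then have "level_ok s (prefix_code \<omega> len) ?m"
        using elim selector_part_prefix[of s len \<omega>] by (simp add: level_ok_def b_def power_divide)
      then show "find_level s (prefix_code \<omega> len) < s"
        unfolding find_level_def using search_found[of ?m s "level_ok s (prefix_code \<omega> len)"] elim by blast
    qed
  qed
qed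

text \<open>Finitely many searches each succeed eventually, hence together. The quantifier over
  \<open>len\<close> lets the invariant of the machine record only that enough bits have been
  read.\<close>

lemma ready_complete:
  assumes "\<omega> \<in> gauss_dom"
  shows "\<exists>s0. \<forall>s\<ge>s0. \<forall>len\<ge>bits_needed s. ready k s (prefix_code \<omega> len)"
proof -
  let ?m = "level \<omega>"
  let ?M = "depth k ?m" and ?T = "precision k ?m"
  have "\<forall>\<^sub>F s in sequentially. \<forall>n\<in>{..<?M}. \<forall>j\<in>{..<2 ^ n}. \<forall>len\<ge>bits_needed s.
      find_grid ?T ?m s (prefix_code \<omega> len) n (2 ^ n + j) < s"
    by (intro eventually_ball_finite finite_lessThan ballI grid_complete assms)
  then have "\<forall>\<^sub>F s in sequentially. \<forall>len\<ge>bits_needed s. ready k s (prefix_code \<omega> len)"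
    using level_complete[OF assms] grid_complete[OF assms, of ?T 0 0] eventually_ge_at_top[of "2 ^ ?M"]
  proof eventually_elim
    case (elim s)
    show ?case
    proof (intro allI impI)
      fix len assume len: "bits_needed s \<le> len"
      then have lt: "find_level s (prefix_code \<omega> len) < s" using elim by blast
      then have "find_level s (prefix_code \<omega> len) = ?m" using find_level_sound[OF len] by blast
      then show "ready k s (prefix_code \<omega> len)"
        using elim len lt by (auto simp: ready_def stage_ok_def)
    qed
  qed
  then show ?thesis by (simp add: eventually_sequentially)
qed

lemma tent_dyadic:
  assumes "n \<le> M"
  shows "2 ^ n * (real l / 2 ^ M) = real ((l * 2 ^ n) div 2 ^ M) + real ((l * 2 ^ n) mod 2 ^ M) / 2 ^ M"
    and "tent (real r / 2 ^ M) = real (min r (2 ^ M - r)) / 2 ^ M"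
proof -
  have "real (l * 2 ^ n) = real ((l * 2 ^ n) div 2 ^ M * 2 ^ M + (l * 2 ^ n) mod 2 ^ M)" by (simp only: div_mult_mod_eq)
  also have "\<dots> = real ((l * 2 ^ n) div 2 ^ M) * 2 ^ M + real ((l * 2 ^ n) mod 2 ^ M)" by (simp only: of_nat_add of_nat_mult of_nat_power of_nat_numeral)
  finally have a: "real (l * 2 ^ n) = real ((l * 2 ^ n) div 2 ^ M) * 2 ^ M + real ((l * 2 ^ n) mod 2 ^ M)" .
  have "real l * 2 ^ n = real ((l * 2 ^ n) div 2 ^ M) * 2 ^ M + real ((l * 2 ^ n) mod 2 ^ M)"
    by (rule trans[OF _ a]) simp
  then have "real l * 2 ^ n / 2 ^ M = (real ((l * 2 ^ n) div 2 ^ M) * 2 ^ M + real ((l * 2 ^ n) mod 2 ^ M)) / 2 ^ M" by simp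
  then show "2 ^ n * (real l / 2 ^ M) = real ((l * 2 ^ n) div 2 ^ M) + real ((l * 2 ^ n) mod 2 ^ M) / 2 ^ M"
    by (simp add: add_divide_distrib mult.commute)
  show "tent (real r / 2 ^ M) = real (min r (2 ^ M - r)) / 2 ^ M"
  proof (cases "r \<le> 2 ^ M")
    case True
    then have "real (2 ^ M - r) = 2 ^ M - real r" by (simp add: of_nat_diff)
    moreover have "1 - real r / 2 ^ M = (2 ^ M - real r) / 2 ^ M" by (simp add: diff_divide_distrib)
    moreover have "min (real r / 2 ^ M) ((2 ^ M - real r) / 2 ^ M) = min (real r) (2 ^ M - real r) / 2 ^ M"
      by (auto simp: min_def divide_le_cancel)
    moreover have "0 \<le> min (real r) (2 ^ M - real r)" using of_nat_mono[OF True, where 'a = real] by simp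
    ultimately show ?thesis by (simp add: tent_def of_nat_min max_def)
  next
    case False
    then have "2 ^ M \<le> real r" by (metis linear of_nat_le_iff of_nat_numeral of_nat_power)
    then show ?thesis using False by (subst tent_eq_0) (auto simp: le_divide_eq)
  qed
qed

lemma level_sum_dyadic:
  assumes "n \<le> M" "l \<le> 2 ^ M"
  shows "level_sum n z (real l / 2 ^ M) = z (2 ^ n + (l * 2 ^ n) div 2 ^ M) / sqrt (2 ^ n) *
     (real (min ((l * 2 ^ n) mod 2 ^ M) (2 ^ M - (l * 2 ^ n) mod 2 ^ M)) / 2 ^ M)"
proof -
  define d where "d = (l * 2 ^ n) div 2 ^ M"
  define r where "r = (l * 2 ^ n) mod 2 ^ M"
  have x: "2 ^ n * (real l / 2 ^ M) = real d + real r / 2 ^ M" unfolding d_def r_def by (rule tent_dyadic(1)[OF assms(1)])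
  have r: "real r / 2 ^ M < 1" unfolding r_def
    by (simp add: divide_less_eq)
  have eq: "z (2 ^ n + j) * tent (2 ^ n * (real l / 2 ^ M) - real j) = (if j = d then z (2 ^ n + d) * tent (real r / 2 ^ M) else 0)" for j
  proof (cases "j = d")
    case False
    then have "real j + 1 \<le> real d \<or> real d + 1 \<le> real j" by linarith
    moreover have "0 \<le> real r / 2 ^ M" by simp
    ultimately have "real d + real r / 2 ^ M - real j \<le> 0 \<or> 1 \<le> real d + real r / 2 ^ M - real j"
      using r by linarith
    then have "tent (2 ^ n * (real l / 2 ^ M) - real j) = 0" unfolding x by (rule tent_eq_0)
    then show ?thesis using False by simp
  next
    case True
    then show ?thesis unfolding x by simp
  qed
  have "(\<Sum>j<2 ^ n. z (2 ^ n + j) * tent (2 ^ n * (real l / 2 ^ M) - real j)) = z (2 ^ n + d) * tent (real r / 2 ^ M)"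
  proof (cases "d < 2 ^ n")
    case False
    \<comment> \<open>This is the right end \<open>l = 2 ^ M\<close>, where no tent of the level has
      index \<open>d\<close>; the formula stays correct because the remainder is
      \<open>0\<close>.\<close>
    have "r = 0"
    proof -
      have "l * 2 ^ n \<le> 2 ^ M * 2 ^ n" using assms(2) by simp
      moreover have "l * 2 ^ n = d * 2 ^ M + r" by (simp only: d_def r_def div_mult_mod_eq)
      moreover have "2 ^ M * 2 ^ n \<le> d * 2 ^ M" using False by (subst mult.commute) simp
      ultimately show ?thesis by linarith
    qed
    then have "tent (real r / 2 ^ M) = 0" by (simp add: tent_eq_0)
    then show ?thesis unfolding eq by simp
  next
    case True
    then show ?thesis unfolding eq by simp
  qed
  then show ?thesis unfolding level_sum_def d_def[symmetric] r_def[symmetric] tent_dyadic(2)[OF assms(1)] by simp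
qed

lemma vertex_sound:
  assumes "bits_needed s \<le> len" "stage_ok T M (level \<omega>) s (prefix_code \<omega> len)" "l \<le> 2 ^ M" "T = k + 1 + M"
  shows "\<bar>vertex T M (level \<omega>) s (prefix_code \<omega> len) l - partial_path M (zeta \<omega>) (real l / 2 ^ M)\<bar> \<le> 1 / 2 ^ (k + 1)"
proof -
  let ?c = "coef T (level \<omega>) s (prefix_code \<omega> len)"
  define d where "d n = (l * 2 ^ n) div 2 ^ M" for n
  define h where "h n = real (min ((l * 2 ^ n) mod 2 ^ M) (2 ^ M - (l * 2 ^ n) mod 2 ^ M)) / 2 ^ M" for n
  have h: "0 \<le> h n" "h n \<le> 1 / 2" for n
  proof -
    have e: "h n = tent (real ((l * 2 ^ n) mod 2 ^ M) / 2 ^ M)" unfolding h_def by (rule tent_dyadic(2)[symmetric, of 0]) simp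
    show "0 \<le> h n" "h n \<le> 1 / 2" unfolding e by (rule tent_nonneg tent_le)+
  qed
  have s: "2 ^ M \<le> s" using assms(2) by (simp add: stage_ok_def)
  have s0: "0 < s" using s by (metis gr0I le_zero_eq power_not_zero zero_neq_numeral)
  have "\<bar>zeta \<omega> 0 / sqrt (2 ^ 0) - ?c 0 0\<bar> \<le> 1 / 2 ^ T"
    using assms s0 by (intro coef_sound) (auto simp: stage_ok_def)
  then have first: "\<bar>?c 0 0 * (real l / 2 ^ M) - zeta \<omega> 0 * (real l / 2 ^ M)\<bar> \<le> 1 / 2 ^ T * 1"
  proof -
    assume *: "\<bar>zeta \<omega> 0 / sqrt (2 ^ 0) - ?c 0 0\<bar> \<le> 1 / 2 ^ T"
    have "real l / 2 ^ M \<le> 1" using of_nat_mono[OF assms(3), where 'a = real] by (simp add: divide_le_eq)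
    then have "\<bar>?c 0 0 - zeta \<omega> 0\<bar> * (real l / 2 ^ M) \<le> 1 / 2 ^ T * 1"
      using * by (intro mult_mono) (auto simp: abs_minus_commute)
    moreover have nn: "0 \<le> real l / 2 ^ M" by simp
    ultimately show ?thesis
      by (simp only: left_diff_distrib[symmetric] abs_mult abs_of_nonneg[OF nn] of_nat_power of_nat_numeral)
  qed
  have rest: "\<bar>?c n (2 ^ n + d n) * h n - level_sum n (zeta \<omega>) (real l / 2 ^ M)\<bar> \<le> 1 / 2 ^ T" if "n < M" for n
  proof -
    have ls: "level_sum n (zeta \<omega>) (real l / 2 ^ M) = zeta \<omega> (2 ^ n + d n) / sqrt (2 ^ n) * h n"
      unfolding d_def h_def by (rule level_sum_dyadic) (use that assms in auto)
    show ?thesis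
    proof (cases "d n < 2 ^ n")
      case True
      have "2 ^ n + d n < 2 ^ Suc n" using True by simp
      also have "(2::nat) ^ Suc n \<le> 2 ^ M" using that by (intro power_increasing) auto
      finally have "2 ^ n + d n < s" using s by simp
      then have "\<bar>zeta \<omega> (2 ^ n + d n) / sqrt (2 ^ n) - ?c n (2 ^ n + d n)\<bar> \<le> 1 / 2 ^ T"
        using assms True that by (intro coef_sound) (auto simp: stage_ok_def)
      then have "\<bar>?c n (2 ^ n + d n) - zeta \<omega> (2 ^ n + d n) / sqrt (2 ^ n)\<bar> * h n \<le> 1 / 2 ^ T * 1"
        using h[of n] by (intro mult_mono) (auto simp: abs_minus_commute)
      then show ?thesis unfolding ls using h[of n] by (simp only: left_diff_distrib[symmetric] abs_mult abs_of_nonneg mult_1_right)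
    next
      case False
      \<comment> \<open>Again the right end: the coefficient used there is not covered by
        \<open>stage_ok\<close>, but its weight is \<open>0\<close>.\<close>
      have "(l * 2 ^ n) mod 2 ^ M = 0"
      proof -
        have "l * 2 ^ n \<le> 2 ^ M * 2 ^ n" using assms(3) by simp
        moreover have "l * 2 ^ n = d n * 2 ^ M + (l * 2 ^ n) mod 2 ^ M" by (simp only: d_def div_mult_mod_eq)
        moreover have "2 ^ M * 2 ^ n \<le> d n * 2 ^ M" using False by (subst mult.commute) simp
        ultimately show ?thesis by linarith
      qed
      then have "h n = 0" by (simp add: h_def)
      then show ?thesis unfolding ls by simp
    qed
  qed
  define A where "A = ?c 0 0 * (real l / 2 ^ M) - zeta \<omega> 0 * (real l / 2 ^ M)"
  define B where "B n = ?c n (2 ^ n + d n) * h n - level_sum n (zeta \<omega>) (real l / 2 ^ M)" for n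
  have eq: "vertex T M (level \<omega>) s (prefix_code \<omega> len) l - partial_path M (zeta \<omega>) (real l / 2 ^ M) = A + (\<Sum>n<M. B n)"
    by (simp add: vertex_def partial_path_def d_def h_def A_def B_def sum_subtractf)
  have "\<bar>\<Sum>n<M. B n\<bar> \<le> (\<Sum>n<M. 1 / 2 ^ T)"
    by (rule order_trans[OF sum_abs sum_mono]) (use rest in \<open>simp add: B_def\<close>)
  moreover have "\<bar>A\<bar> \<le> 1 / 2 ^ T" using first by (simp only: A_def mult_1_right)
  ultimately have "\<bar>A + (\<Sum>n<M. B n)\<bar> \<le> 1 / 2 ^ T + real M / 2 ^ T" by simp
  also have "1 / 2 ^ T + real M / 2 ^ T = (1 + real M) / 2 ^ T" by (simp only: add_divide_distrib)
  also have "(1 + real M) / 2 ^ T \<le> 2 ^ M / 2 ^ T"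
  proof (rule divide_right_mono)
    have "real (Suc M) \<le> real (2 ^ M)" by (intro of_nat_mono Suc_leI less_exp)
    then show "1 + real M \<le> 2 ^ M" by simp
  qed simp
  also have "2 ^ M / 2 ^ T = (1 / 2 ^ (k + 1) :: real)" unfolding assms(4) by (simp add: power_add)
  finally show ?thesis by (simp only: eq)
qed

section \<open>Polygons on dyadic grids\<close>

lemma tent_low: "0 \<le> y \<Longrightarrow> y \<le> 1 / 2 \<Longrightarrow> tent y = y"
  and tent_high: "1 / 2 \<le> y \<Longrightarrow> y \<le> 1 \<Longrightarrow> tent y = 1 - y"
  by (auto simp: tent_def)

text \<open>The breakpoints \<open>0\<close>, \<open>1 / 2\<close> and \<open>1\<close> of
  \<open>tent\<close> are multiples of \<open>1 / 2 ^ Suc r\<close>, so no cell of this grid has one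
  in its interior. The exponent is a successor for the sake of the peak.\<close>

lemma tent_affine:
  fixes a :: int
  assumes "0 \<le> \<theta>" "\<theta> \<le> 1"
  shows "tent ((real_of_int a + \<theta>) / 2 ^ Suc r) = (1 - \<theta>) * tent (real_of_int a / 2 ^ Suc r) + \<theta> * tent ((real_of_int a + 1) / 2 ^ Suc r)"
proof -
  let ?N = "2 ^ Suc r :: real"
  have N: "?N > 0" by simp
  consider "a + 1 \<le> 0" | "0 \<le> a" "a + 1 \<le> 2 ^ r" | "2 ^ r \<le> a" "a + 1 \<le> 2 ^ Suc r" | "2 ^ Suc r \<le> a"
    by (cases "0 \<le> a"; cases "a < 2 ^ r"; cases "a < 2 ^ Suc r"; linarith)
  then show ?thesis
  proof cases
    case 1
    then have "real_of_int a + 1 \<le> 0" by linarith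
    then have "tent ((real_of_int a + x) / ?N) = 0" if "x \<le> 1" for x
      using that by (intro tent_eq_0) (auto simp: divide_le_0_iff)
    from this[of 0] this[of 1] this[of \<theta>] assms show ?thesis by simp
  next
    case 2
    have "real_of_int (a + 1) \<le> real_of_int (2 ^ r)" using 2(2) by (simp only: of_int_le_iff)
    then have "real_of_int a + 1 \<le> 2 ^ r" by simp
    moreover have "0 \<le> real_of_int a" using 2 by simp
    ultimately have "tent ((real_of_int a + x) / ?N) = (real_of_int a + x) / ?N" if "0 \<le> x" "x \<le> 1" for x
      using that by (intro tent_low) (auto simp: divide_le_eq)
    from this[of 0] this[of 1] this[of \<theta>] assms
    have e: "tent (real_of_int a / ?N) = real_of_int a / ?N" "tent ((real_of_int a + 1) / ?N) = (real_of_int a + 1) / ?N"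
      "tent ((real_of_int a + \<theta>) / ?N) = (real_of_int a + \<theta>) / ?N" by simp_all
    show ?thesis unfolding e by (simp add: field_simps)
  next
    case 3
    define b where "b = real_of_int a"
    have "real_of_int (a + 1) \<le> real_of_int (2 ^ Suc r)" using 3(2) by (simp only: of_int_le_iff)
    then have b1: "b + 1 \<le> 2 * 2 ^ r" by (simp add: b_def)
    have "real_of_int (2 ^ r) \<le> real_of_int a" using 3(1) by (simp only: of_int_le_iff)
    then have b2: "2 ^ r \<le> b" by (simp add: b_def)
    have "tent ((b + x) / ?N) = 1 - (b + x) / ?N" if "0 \<le> x" "x \<le> 1" for x
      using that b1 b2 by (intro tent_high) (auto simp: divide_le_eq le_divide_eq)
    note this[unfolded b_def]
    from this[of 0] this[of 1] this[of \<theta>] assms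
    have e: "tent (real_of_int a / ?N) = 1 - real_of_int a / ?N" "tent ((real_of_int a + 1) / ?N) = 1 - (real_of_int a + 1) / ?N"
      "tent ((real_of_int a + \<theta>) / ?N) = 1 - (real_of_int a + \<theta>) / ?N" by simp_all
    show ?thesis unfolding e by (simp add: field_simps)
  next
    case 4
    have "real_of_int (2 ^ Suc r) \<le> real_of_int a" using 4 by (simp only: of_int_le_iff)
    then have "?N \<le> real_of_int a" by simp
    then have "tent ((real_of_int a + x) / ?N) = 0" if "0 \<le> x" for x
      using that N by (intro tent_eq_0) (auto simp: le_divide_eq)
    from this[of 0] this[of 1] this[of \<theta>] assms show ?thesis by simp
  qed
qed

lemma level_sum_affine:
  assumes "n < M" "0 \<le> \<theta>" "\<theta> \<le> 1"
  shows "level_sum n z ((real l + \<theta>) / 2 ^ M) = (1 - \<theta>) * level_sum n z (real l / 2 ^ M) + \<theta> * level_sum n z ((real l + 1) / 2 ^ M)"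
proof -
  obtain r where r: "M = n + Suc r" using assms(1) less_imp_Suc_add[of n M] by auto
  have arg: "2 ^ n * ((real l + x) / 2 ^ M) - real j = (real_of_int (int l - int j * 2 ^ Suc r) + x) / 2 ^ Suc r" for x j
    unfolding r power_add by (simp add: field_simps)
  have "tent (2 ^ n * ((real l + \<theta>) / 2 ^ M) - real j) = (1 - \<theta>) * tent (2 ^ n * ((real l + 0) / 2 ^ M) - real j)
      + \<theta> * tent (2 ^ n * ((real l + 1) / 2 ^ M) - real j)" for j
    unfolding arg using tent_affine[OF assms(2,3), of "int l - int j * 2 ^ Suc r" r] by simp
  then have "(\<Sum>j<2 ^ n. z (2 ^ n + j) * tent (2 ^ n * ((real l + \<theta>) / 2 ^ M) - real j))
      = (1 - \<theta>) * (\<Sum>j<2 ^ n. z (2 ^ n + j) * tent (2 ^ n * ((real l + 0) / 2 ^ M) - real j))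
        + \<theta> * (\<Sum>j<2 ^ n. z (2 ^ n + j) * tent (2 ^ n * ((real l + 1) / 2 ^ M) - real j))"
    by (simp only: sum_distrib_left sum.distrib[symmetric]) (intro sum.cong refl, simp add: algebra_simps)
  then show ?thesis by (simp add: level_sum_def add_divide_distrib)
qed

lemma partial_path_affine:
  assumes "0 \<le> \<theta>" "\<theta> \<le> 1"
  shows "partial_path M z ((real l + \<theta>) / 2 ^ M) = (1 - \<theta>) * partial_path M z (real l / 2 ^ M) + \<theta> * partial_path M z ((real l + 1) / 2 ^ M)"
proof -
  have "(\<Sum>n<M. level_sum n z ((real l + \<theta>) / 2 ^ M)) = (1 - \<theta>) * (\<Sum>n<M. level_sum n z (real l / 2 ^ M)) + \<theta> * (\<Sum>n<M. level_sum n z ((real l + 1) / 2 ^ M))"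
    unfolding sum_distrib_left sum.distrib[symmetric] by (intro sum.cong refl level_sum_affine assms) auto
  moreover have "z 0 * ((real l + \<theta>) / 2 ^ M) = (1 - \<theta>) * (z 0 * (real l / 2 ^ M)) + \<theta> * (z 0 * ((real l + 1) / 2 ^ M))"
    by (simp add: field_simps)
  ultimately show ?thesis unfolding partial_path_def by (simp add: algebra_simps)
qed

text \<open>Denominators appear as \<open>N - 1\<close> because a fraction \<open>(a, b)\<close>
  stands for \<open>a / (b + 1)\<close>.\<close>

definition grid_polygon :: "nat \<Rightarrow> (nat \<Rightarrow> fraction) \<Rightarrow> (fraction \<times> fraction) list" where
  "grid_polygon N f = map (\<lambda>l. ((int l, N - 1), f l)) [0..<Suc N]"

lemma frac_val_grid: "0 < N \<Longrightarrow> frac_val (int l, N - Suc 0) = real l / real N"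
  by (simp add: frac_val_def)

lemma frac_val_0: "frac_val (0, n) = 0"
  by (simp add: frac_val_def)

lemma polygon_code_grid:
  assumes "0 < N" shows "polygon_code (grid_polygon N f)"
  using assms
  by (auto simp: polygon_code_def grid_polygon_def sorted_wrt_iff_nth_less comp_def frac_val_grid frac_val_0 hd_map last_map
      divide_strict_right_mono simp del: upt_Suc)

text \<open>\<open>polygon\<close> drops vertices from the front, so the claim concerns all suffixes
  of the vertex list. On a cell both functions are the same convex combination of their values at
  its ends, and so is the error.\<close>

lemma polygon_grid_close:
  assumes N: "0 < N" and close: "\<And>l. l \<le> N \<Longrightarrow> \<bar>frac_val (f l) - g (real l / real N)\<bar> \<le> e"
    and affine: "\<And>l \<theta>. l < N \<Longrightarrow> 0 \<le> \<theta> \<Longrightarrow> \<theta> \<le> 1 \<Longrightarrow>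
      g ((real l + \<theta>) / real N) = (1 - \<theta>) * g (real l / real N) + \<theta> * g ((real l + 1) / real N)"
    and t: "t \<le> 1" and l: "l \<le> N" "real l / real N \<le> t"
  shows "\<bar>polygon (map (\<lambda>l. ((int l, N - 1), f l)) [l..<Suc N]) t - g t\<bar> \<le> e"
  using l
proof (induction "N - l" arbitrary: l)
  case 0
  then have "l = N" by simp
  with 0 t N have "t = real N / real N" by simp
  then show ?case using close[of N] \<open>l = N\<close> by simp
next
  case (Suc d)
  then have lN: "l < N" by simp
  then have upt: "[l..<Suc N] = l # Suc l # [Suc (Suc l)..<Suc N]" by (simp add: upt_conv_Cons)
  show ?case
  proof (cases "t \<le> real (Suc l) / real N")
    case True
    define \<theta> where "\<theta> = t * real N - real l"
    have \<theta>: "0 \<le> \<theta>" "\<theta> \<le> 1" "t = (real l + \<theta>) / real N"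
      using Suc(4) True N by (auto simp: \<theta>_def field_simps)
    have "(t - real l / real N) / (real (Suc l) / real N - real l / real N) = \<theta>"
      using N by (simp add: \<theta>_def diff_divide_distrib[symmetric]) (simp add: field_simps)
    then have "polygon (map (\<lambda>l. ((int l, N - 1), f l)) [l..<Suc N]) t
        = frac_val (f l) + (frac_val (f (Suc l)) - frac_val (f l)) * \<theta>"
      using True by (simp add: upt frac_val_grid[OF N] del: upt_Suc of_nat_Suc flip: times_divide_eq_right)
    then have eq: "polygon (map (\<lambda>l. ((int l, N - 1), f l)) [l..<Suc N]) t - g t
        = (1 - \<theta>) * (frac_val (f l) - g (real l / real N)) + \<theta> * (frac_val (f (Suc l)) - g (real (Suc l) / real N))"
      using affine[OF lN \<theta>(1,2)] by (simp add: \<theta>(3) algebra_simps)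
    have "\<bar>(1 - \<theta>) * (frac_val (f l) - g (real l / real N)) + \<theta> * (frac_val (f (Suc l)) - g (real (Suc l) / real N))\<bar>
        \<le> (1 - \<theta>) * e + \<theta> * e"
      using close[of l] close[of "Suc l"] lN \<theta>
      by (intro order_trans[OF abs_triangle_ineq] add_mono) (auto simp: abs_mult intro!: mult_left_mono)
    then show ?thesis unfolding eq by (simp add: algebra_simps)
  next
    case False
    then have "polygon (map (\<lambda>l. ((int l, N - 1), f l)) [l..<Suc N]) t
        = polygon (map (\<lambda>l. ((int l, N - 1), f l)) [Suc l..<Suc N]) t"
      using lN by (simp add: upt frac_val_grid[OF N] upt_conv_Cons[of "Suc l"] del: upt_Suc of_nat_Suc)
    then show ?thesis using Suc(1)[of "Suc l"] Suc(2) False lN by simp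
  qed
qed

text \<open>Half of the tolerance goes to the vertices, half to the truncation of the series;
  between vertices the partial sum is itself affine.\<close>

theorem grid_polygon_close_wiener:
  assumes \<omega>: "wiener \<omega> = Some W" and M: "M = depth k (level \<omega>)"
    and close: "\<And>l. l \<le> 2 ^ M \<Longrightarrow> \<bar>frac_val (f l) - partial_path M (zeta \<omega>) (real l / 2 ^ M)\<bar> \<le> 1 / 2 ^ (k + 1)"
  shows "uniform_dist (polygon (grid_polygon (2 ^ M) f)) W \<le> 1 / 2 ^ k"
  unfolding uniform_dist_def
proof (rule cSUP_least)
  fix t :: real assume t: "t \<in> {0..1}"
  have W: "W t = bm_path (zeta \<omega>) t" using \<omega> t by (auto simp: wiener_def split: if_splits)
  have 1: "\<bar>polygon (grid_polygon (2 ^ M) f) t - partial_path M (zeta \<omega>) t\<bar> \<le> 1 / 2 ^ (k + 1)"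
    unfolding grid_polygon_def
  proof (rule polygon_grid_close)
    show "\<bar>frac_val (f l) - partial_path M (zeta \<omega>) (real l / real (2 ^ M))\<bar> \<le> 1 / 2 ^ (k + 1)" if "l \<le> 2 ^ M" for l
      using close[OF that] by simp
    show "partial_path M (zeta \<omega>) ((real l + \<theta>) / real (2 ^ M)) = (1 - \<theta>) * partial_path M (zeta \<omega>) (real l / real (2 ^ M))
        + \<theta> * partial_path M (zeta \<omega>) ((real l + 1) / real (2 ^ M))" if "0 \<le> \<theta>" "\<theta> \<le> 1" for l \<theta>
      using partial_path_affine[OF that, of M "zeta \<omega>" l] by (simp only: of_nat_power of_nat_numeral)
  qed (use t in auto)
  have 2: "\<bar>bm_path (zeta \<omega>) t - partial_path M (zeta \<omega>) t\<bar> \<le> 10 * rho ^ M"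
    by (rule bm_path_tail) (simp add: M depth_def)
  have "rho ^ M \<le> rho ^ (4 * (k + 5))" using rho by (intro power_decreasing) (auto simp: M depth_def)
  also have "\<dots> = (1 / 2) ^ (k + 5)" by (simp only: power_mult rho(2))
  also have "\<dots> = 1 / 2 ^ (k + 1) / 16" by (simp add: power_add power_divide)
  finally have "rho ^ M \<le> 1 / 2 ^ (k + 1) / 16" .
  moreover have "0 \<le> (1 / 2 ^ (k + 1) :: real)" by simp
  moreover have "x \<le> y / 16 \<Longrightarrow> 0 \<le> y \<Longrightarrow> 10 * x \<le> y" for x y :: real by simp
  ultimately have 3: "10 * rho ^ M \<le> 1 / 2 ^ (k + 1)" by blast
  have "(1 / 2 ^ k :: real) = 1 / 2 ^ (k + 1) + 1 / 2 ^ (k + 1)" by simp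
  then show "\<bar>polygon (grid_polygon (2 ^ M) f) t - W t\<bar> \<le> 1 / 2 ^ k"
    unfolding W using 1 2 3 by linarith
qed simp

section \<open>Computability of the approximations\<close>

lemma crat_comp: "crat f \<Longrightarrow> cmp g \<Longrightarrow> crat (\<lambda>x. f (g x))"
  unfolding crat_def using cmp_comp by metis

lemma crat_divide_numeral [cmp_intros]: "crat f \<Longrightarrow> crat (\<lambda>x. f x / numeral w)"
  using crat_divide_nat[OF _ cmp_const, of f "numeral w"] by simp

lemma cmp_code_bit [cmp_intros]: "cmp p \<Longrightarrow> cmp x \<Longrightarrow> cmp (\<lambda>z. code_bit (p z) (x z))"
  unfolding code_bit_def by (intro cmp_intros)

lemma cmp_row [cmp_intros]: "cmp r \<Longrightarrow> cmp j \<Longrightarrow> cmp (\<lambda>z. row (r z) (j z))"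
  unfolding row_def prod_encode_def triangle_def prod.case by (intro cmp_intros)

lemma cmp_bits_needed [cmp_intros]: "cmp s \<Longrightarrow> cmp (\<lambda>z. bits_needed (s z))"
  unfolding bits_needed_def by (intro cmp_intros)

lemma cmp_depth [cmp_intros]: "cmp k \<Longrightarrow> cmp m \<Longrightarrow> cmp (\<lambda>z. depth (k z) (m z))"
  unfolding depth_def by (intro cmp_intros)

lemma cmp_precision [cmp_intros]: "cmp k \<Longrightarrow> cmp m \<Longrightarrow> cmp (\<lambda>z. precision (k z) (m z))"
  unfolding precision_def by (intro cmp_intros)

text \<open>Under the binder of the sum the parameters would be composed with a projection. Proving
  the claim for projections of a tuple and composing afterwards keeps the goals within reach of
  \<open>cmp_intros\<close>; the pattern recurs.\<close>

lemma crat_selector_part [cmp_intros]: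
  assumes "cmp p" "cmp s" shows "crat (\<lambda>x. selector_part (p x) (s x))"
proof -
  have "crat (\<lambda>z::nat \<times> nat. selector_part (fst z) (snd z))"
    unfolding selector_part_def by (intro cmp_intros)
  from crat_comp[OF this cmp_Pair[OF assms]] show ?thesis by simp
qed

lemma crat_seed_part [cmp_intros]:
  assumes "cmp p" "cmp i" "cmp s" shows "crat (\<lambda>x. seed_part (p x) (i x) (s x))"
proof -
  have "crat (\<lambda>z::nat \<times> nat \<times> nat. seed_part (fst z) (fst (snd z)) (snd (snd z)))"
    unfolding seed_part_def by (intro cmp_intros)
  from crat_comp[OF this cmp_Pair[OF assms(1) cmp_Pair[OF assms(2,3)]]] show ?thesis by simp
qed

lemma crat_eps [cmp_intros]: "cmp i \<Longrightarrow> crat (\<lambda>x. eps (i x))"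
proof -
  assume "cmp i"
  then have "crat (\<lambda>x. 1 / real ((i x + 2) ^ 2))" by (intro cmp_intros)
  moreover have "eps j = 1 / real ((j + 2) ^ 2)" for j by (simp add: eps_def add.commute)
  ultimately show ?thesis by simp
qed

lemma crat_cond_seed [cmp_intros]: "cmp m \<Longrightarrow> cmp i \<Longrightarrow> crat u \<Longrightarrow> crat (\<lambda>x. cond_seed (m x) (i x) (u x))"
  unfolding cond_seed_def by (intro cmp_intros)

lemma crat_gauss_ser [cmp_intros]:
  assumes "cmp s" "crat y" shows "crat (\<lambda>x. gauss_ser (s x) (y x))"
  unfolding gauss_ser_def by (intro cmp_intros crat_comp[OF assms(2) cmp_fst] assms)

lemma crat_gauss_err [cmp_intros]: "cmp s \<Longrightarrow> crat y \<Longrightarrow> crat (\<lambda>x. gauss_err (s x) (y x))"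
  unfolding gauss_err_def by (intro cmp_intros)

lemma crat_upper_cdf2 [cmp_intros]: "cmp s \<Longrightarrow> crat y \<Longrightarrow> crat (\<lambda>x. upper_cdf2 (s x) (y x))"
  unfolding upper_cdf2_def by (intro cmp_intros)

lemma crat_lower_cdf2 [cmp_intros]: "cmp s \<Longrightarrow> crat y \<Longrightarrow> crat (\<lambda>x. lower_cdf2 (s x) (y x))"
  unfolding lower_cdf2_def by (intro cmp_intros)

lemma crat_lower_pi [cmp_intros]: "cmp s \<Longrightarrow> crat (\<lambda>x. lower_pi (s x))"
  unfolding lower_pi_def by (intro cmp_intros)

lemma crat_upper_pi [cmp_intros]: "cmp s \<Longrightarrow> crat (\<lambda>x. upper_pi (s x))"
  unfolding upper_pi_def by (intro cmp_intros)

lemma cmp_below_quantile [cmp_intros]: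
  "cmp s \<Longrightarrow> crat v \<Longrightarrow> crat y \<Longrightarrow> cmp (\<lambda>x. below_quantile (s x) (v x) (y x))"
  unfolding below_quantile_def by (intro cmp_intros)

lemma cmp_above_quantile [cmp_intros]:
  "cmp s \<Longrightarrow> crat v \<Longrightarrow> crat y \<Longrightarrow> cmp (\<lambda>x. above_quantile (s x) (v x) (y x))"
  unfolding above_quantile_def by (intro cmp_intros)

lemma cmp_level_ok [cmp_intros]:
  "cmp s \<Longrightarrow> cmp p \<Longrightarrow> cmp m \<Longrightarrow> cmp (\<lambda>x. level_ok (s x) (p x) (m x))"
  unfolding level_ok_def by (intro cmp_intros)

lemma cmp_find_level [cmp_intros]:
  assumes "cmp s" "cmp p" shows "cmp (\<lambda>x. find_level (s x) (p x))"
proof -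
  have "cmp (\<lambda>z::nat \<times> nat. find_level (fst z) (snd z))"
    unfolding find_level_def by (intro cmp_intros)
  from cmp_comp[OF this cmp_Pair[OF assms]] show ?thesis by simp
qed

lemma cmp_grid_ok [cmp_intros]:
  "cmp T \<Longrightarrow> cmp m \<Longrightarrow> cmp s \<Longrightarrow> cmp p \<Longrightarrow> cmp n \<Longrightarrow> cmp i \<Longrightarrow> cmp j \<Longrightarrow>
    cmp (\<lambda>x. grid_ok (T x) (m x) (s x) (p x) (n x) (i x) (j x))"
  unfolding grid_ok_def by (intro cmp_intros)

lemma cmp_find_grid [cmp_intros]:
  assumes "cmp T" "cmp m" "cmp s" "cmp p" "cmp n" "cmp i"
  shows "cmp (\<lambda>x. find_grid (T x) (m x) (s x) (p x) (n x) (i x))"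
proof -
  have "cmp (\<lambda>z::nat \<times> nat \<times> nat \<times> nat \<times> nat \<times> nat. find_grid (fst z) (fst (snd z)) (fst (snd (snd z)))
      (fst (snd (snd (snd z)))) (fst (snd (snd (snd (snd z))))) (snd (snd (snd (snd (snd z))))))"
    unfolding find_grid_def by (intro cmp_intros)
  from cmp_comp[OF this, of "\<lambda>x. (T x, m x, s x, p x, n x, i x)"] show ?thesis
    using assms by (simp add: cmp_Pair)
qed

lemma crat_coef [cmp_intros]:
  "cmp T \<Longrightarrow> cmp m \<Longrightarrow> cmp s \<Longrightarrow> cmp p \<Longrightarrow> cmp n \<Longrightarrow> cmp i \<Longrightarrow>
    crat (\<lambda>x. coef (T x) (m x) (s x) (p x) (n x) (i x))"
  unfolding coef_def by (intro cmp_intros)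

lemma cmp_stage_ok [cmp_intros]:
  assumes "cmp T" "cmp M" "cmp m" "cmp s" "cmp p"
  shows "cmp (\<lambda>x. stage_ok (T x) (M x) (m x) (s x) (p x))"
proof -
  have "cmp (\<lambda>z::nat \<times> nat \<times> nat \<times> nat \<times> nat. stage_ok (fst z) (fst (snd z)) (fst (snd (snd z)))
      (fst (snd (snd (snd z)))) (snd (snd (snd (snd z)))))"
    unfolding stage_ok_def by (intro cmp_intros)
  from cmp_comp[OF this, of "\<lambda>x. (T x, M x, m x, s x, p x)"] show ?thesis
    using assms by (simp add: cmp_Pair)
qed

lemma cmp_ready [cmp_intros]: "cmp k \<Longrightarrow> cmp s \<Longrightarrow> cmp p \<Longrightarrow> cmp (\<lambda>x. ready (k x) (s x) (p x))"
  unfolding ready_def by (intro cmp_intros)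

lemma crat_vertex [cmp_intros]:
  assumes "cmp T" "cmp M" "cmp m" "cmp s" "cmp p" "cmp l"
  shows "crat (\<lambda>x. vertex (T x) (M x) (m x) (s x) (p x) (l x))"
proof -
  have "crat (\<lambda>z::nat \<times> nat \<times> nat \<times> nat \<times> nat \<times> nat. vertex (fst z) (fst (snd z)) (fst (snd (snd z)))
      (fst (snd (snd (snd z)))) (fst (snd (snd (snd (snd z))))) (snd (snd (snd (snd (snd z))))))"
    unfolding vertex_def by (intro cmp_intros)
  from crat_comp[OF this, of "\<lambda>x. (T x, M x, m x, s x, p x, l x)"] show ?thesis
    using assms by (simp add: cmp_Pair)
qed

section \<open>Emitting the names\<close>

text \<open>
  Pending output is stored as a number: its binary digits, least significant first, are the bits
  followed by an end marker \<open>1\<close>.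
\<close>

fun word_code :: "bool list \<Rightarrow> nat" where
  "word_code [] = 1"
| "word_code (b # w) = 2 * word_code w + of_bool b"

lemma word_code_pos: "1 \<le> word_code w"
  by (induction w) auto

text \<open>Prepending \<open>True\<close> maps a code \<open>c\<close> to \<open>2 * c + 1\<close>,
  that is, it doubles \<open>c + 1\<close>; hence the closed form for \<open>n\<close> repetitions
  in front of the delimiter.\<close>

definition push_nat :: "nat \<Rightarrow> nat \<Rightarrow> nat" where
  "push_nat n c = 2 ^ n * (2 * c + 1) - 1"

lemma word_code_enc_nat: "word_code (enc_nat n @ w) = push_nat n (word_code w)"
proof (induction n)
  case (Suc n)
  have "0 < 2 ^ n * (2 * word_code w + 1)" by (rule mult_pos_pos) simp_all
  then have "1 \<le> 2 ^ n * (2 * word_code w + 1)" by (simp only: Suc_le_eq One_nat_def)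
  with Suc show ?case by (simp add: enc_nat_def push_nat_def diff_mult_distrib2)
qed (simp add: enc_nat_def push_nat_def)

text \<open>The numerator is a difference of naturals: the two truncated subtractions add up to its
  modulus. The sign is pushed last because it comes first in the word.\<close>

definition push_frac :: "nat \<times> nat \<times> nat \<Rightarrow> nat \<Rightarrow> nat" where
  "push_frac t c = 2 * push_nat ((fst t - fst (snd t)) + (fst (snd t) - fst t)) (push_nat (snd (snd t)) c)
     + of_bool (fst t < fst (snd t))"

definition frac_of :: "nat \<times> nat \<times> nat \<Rightarrow> fraction" where
  "frac_of t = (int (fst t) - int (fst (snd t)), snd (snd t))"

lemma frac_val_frac_of: "frac_val (frac_of t) = rval t"
  by (simp add: frac_val_def frac_of_def rval_def)

lemma word_code_enc_fraction: "word_code (enc_fraction (frac_of t) @ w) = push_frac t (word_code w)"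
proof -
  have "nat \<bar>int a - int b\<bar> = (a - b) + (b - a)" for a b by linarith
  then show ?thesis by (simp add: enc_fraction_def frac_of_def push_frac_def word_code_enc_nat)
qed

text \<open>Words grow at the front, so the vertices are pushed from the last to the first, and the
  length after them.\<close>

definition push_polygon :: "nat \<Rightarrow> (nat \<Rightarrow> nat \<times> nat \<times> nat) \<Rightarrow> nat" where
  "push_polygon N t = push_nat (Suc N)
     (rec_nat 1 (\<lambda>i w. push_frac (N - i, 0, N - 1) (push_frac (t (N - i)) w)) (Suc N))"

lemma word_code_polygon: "word_code (enc_polygon (grid_polygon N (\<lambda>l. frac_of (t l)))) = push_polygon N t"
proof -
  let ?v = "\<lambda>l. enc_fraction (int l, N - 1) @ enc_fraction (frac_of (t l))"
  have v: "word_code (?v l @ w) = push_frac (l, 0, N - 1) (push_frac (t l) (word_code w))" for l w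
    using word_code_enc_fraction[of "(l, 0, N - 1)"] word_code_enc_fraction[of "t l" w] by (simp add: frac_of_def)
  have "word_code (concat (map ?v [Suc N - c..<Suc N]))
      = rec_nat 1 (\<lambda>i w. push_frac (N - i, 0, N - 1) (push_frac (t (N - i)) w)) c" if "c \<le> Suc N" for c
    using that
  proof (induction c)
    case (Suc c)
    then have "[Suc N - Suc c..<Suc N] = (N - c) # [Suc N - c..<Suc N]"
      by (subst upt_conv_Cons) (auto simp: Suc_diff_le simp del: upt_Suc)
    then have "word_code (concat (map ?v [Suc N - Suc c..<Suc N]))
        = word_code (?v (N - c) @ concat (map ?v [Suc N - c..<Suc N]))" by (simp del: upt_Suc)
    also have "\<dots> = push_frac (N - c, 0, N - 1) (push_frac (t (N - c)) (word_code (concat (map ?v [Suc N - c..<Suc N]))))"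
      by (rule v)
    finally show ?case using Suc by simp
  qed simp
  from this[of "Suc N"] have "word_code (concat (map ?v [0..<Suc N]))
      = rec_nat 1 (\<lambda>i w. push_frac (N - i, 0, N - 1) (push_frac (t (N - i)) w)) (Suc N)" by (simp del: upt_Suc)
  then show ?thesis
    unfolding enc_polygon_def grid_polygon_def push_polygon_def word_code_enc_nat
    by (simp add: comp_def del: upt_Suc nat.rec)
qed

lemma cmp_push_nat [cmp_intros]: "cmp n \<Longrightarrow> cmp c \<Longrightarrow> cmp (\<lambda>x. push_nat (n x) (c x))"
  unfolding push_nat_def by (intro cmp_intros)

lemma cmp_push_frac [cmp_intros]: "cmp t \<Longrightarrow> cmp c \<Longrightarrow> cmp (\<lambda>x. push_frac (t x) (c x))"
  unfolding push_frac_def by (intro cmp_intros)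

type_synonym tstate = "nat \<times> nat \<times> nat \<times> nat \<times> nat"

text \<open>The state holds the index \<open>k\<close> of the next polygon, the accuracy
  \<open>s\<close>, the bits read, their number and the pending output. Output is flushed first;
  then bits are read as \<open>s\<close> requires; then a polygon is scheduled or the accuracy
  raised, which is never lowered. Both \<open>0\<close> and \<open>1\<close> count as empty output,
  so that the initial state can consist of zeros.\<close>

definition transition :: "(nat \<times> nat \<times> nat \<Rightarrow> nat) \<Rightarrow> bool \<times> tstate \<Rightarrow> nat \<times> tstate" where
  "transition word = (\<lambda>(b, k, s, p, len, out).
     if 1 < out then (1 + out mod 2, k, s, p, len, out div 2)
     else if len < bits_needed s then (3, k, s, p + of_bool b * 2 ^ len, Suc len, out)
     else if ready k s p then (0, Suc k, s, p, len, word (k, s, p))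
     else (0, k, Suc s, p, len, out))"

lemma cmp_transition:
  assumes "cmp word" shows "cmp (transition word)"
  unfolding transition_def case_prod_beta by (intro cmp_intros cmp_comp[OF assms])

lemma fst_transition: "fst (transition word z) \<le> 3"
  by (auto simp: transition_def split: prod.splits)

locale emission =
  fixes \<omega> :: "nat \<Rightarrow> bool" and word :: "nat \<times> nat \<times> nat \<Rightarrow> nat"
  assumes in_dom: "\<omega> \<in> gauss_dom"
begin

definition leads_to where
  "leads_to c d \<longleftrightarrow> (\<exists>n. (tstep (transition word) \<omega> ^^ n) c = d)"

lemma leads_to_step: "leads_to (tstep (transition word) \<omega> c) d \<Longrightarrow> leads_to c d"
  unfolding leads_to_def by (metis funpow_swap1 funpow.simps(2) comp_apply)

lemma leads_to_refl: "leads_to c c"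
  unfolding leads_to_def by (intro exI[of _ 0]) simp

lemma leads_to_trans: "leads_to c d \<Longrightarrow> leads_to d e \<Longrightarrow> leads_to c e"
  unfolding leads_to_def by (metis comp_apply funpow_add)

lemma leads_to_pop: "leads_to ((k, s, p, len, word_code u), i, w) ((k, s, p, len, 1), i, w @ u)"
proof (induction u arbitrary: w)
  case (Cons b u)
  have "1 < word_code (b # u)" using word_code_pos[of u] by simp
  then have "tstep (transition word) \<omega> ((k, s, p, len, word_code (b # u)), i, w) = ((k, s, p, len, word_code u), i, w @ [b])"
    by (cases b) (simp_all add: tstep_def transition_def)
  then show ?case using leads_to_step Cons[of "w @ [b]"] by simp
qed (simp add: leads_to_refl)

definition reading :: "nat \<Rightarrow> nat \<Rightarrow> nat \<Rightarrow> nat \<Rightarrow> bool list \<Rightarrow> tstate \<times> nat \<times> bool list" where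
  "reading k s len out w = ((k, s, prefix_code \<omega> len, len, out), len, w)"

lemma leads_to_read:
  "out \<le> 1 \<Longrightarrow> \<exists>len'\<ge>bits_needed s. leads_to (reading k s len out w) (reading k s len' out w)"
proof (induction "bits_needed s - len" arbitrary: len)
  case 0
  then show ?case by (intro exI[of _ len]) (simp add: leads_to_refl)
next
  case (Suc d)
  then have "tstep (transition word) \<omega> (reading k s len out w) = reading k s (Suc len) out w"
    by (simp add: tstep_def transition_def reading_def prefix_code_def)
  moreover obtain len' where "bits_needed s \<le> len'" "leads_to (reading k s (Suc len) out w) (reading k s len' out w)"
    using Suc(1)[of "Suc len"] Suc(2,3) by force
  ultimately show ?case using leads_to_step by metis
qed

text \<open>Induction on the distance to an accuracy \<open>s0\<close> from which on readiness is
  guaranteed; success may come earlier.\<close>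

lemma leads_to_ready:
  assumes out: "out \<le> 1" and s0: "\<And>s len. s0 \<le> s \<Longrightarrow> bits_needed s \<le> len \<Longrightarrow> ready k s (prefix_code \<omega> len)"
  shows "\<exists>s' len'. bits_needed s' \<le> len' \<and> ready k s' (prefix_code \<omega> len') \<and>
    leads_to (reading k s len out w) (reading k s' len' out w)"
proof (induction "s0 - s" arbitrary: s len)
  case 0
  obtain len' where "bits_needed s \<le> len'" "leads_to (reading k s len out w) (reading k s len' out w)"
    using leads_to_read[OF out] by blast
  then show ?case using s0[of s len'] 0 by auto
next
  case (Suc d)
  obtain len' where len': "bits_needed s \<le> len'" "leads_to (reading k s len out w) (reading k s len' out w)"
    using leads_to_read[OF out] by blast
  show ?case
  proof (cases "ready k s (prefix_code \<omega> len')")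
    case False
    then have "tstep (transition word) \<omega> (reading k s len' out w) = reading k (Suc s) len' out w"
      using len' out by (simp add: tstep_def transition_def reading_def)
    then have "leads_to (reading k s len out w) (reading k (Suc s) len' out w)"
      using leads_to_trans[OF len'(2)] leads_to_step leads_to_refl by metis
    moreover obtain s' len'' where "bits_needed s' \<le> len''" "ready k s' (prefix_code \<omega> len'')"
      "leads_to (reading k (Suc s) len' out w) (reading k s' len'' out w)"
      using Suc(1)[of "Suc s" len'] Suc(2) by (metis Suc_diff_Suc Zero_not_Suc diff_Suc_1 zero_less_Suc zero_less_diff)
    ultimately show ?thesis using leads_to_trans by blast
  qed (use len' in blast)
qed

lemma leads_to_next:
  assumes "out \<le> 1"
  shows "\<exists>s' len'. bits_needed s' \<le> len' \<and> ready k s' (prefix_code \<omega> len') \<and>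
    (\<forall>u. word (k, s', prefix_code \<omega> len') = word_code u \<longrightarrow>
       leads_to (reading k s len out w) (reading (Suc k) s' len' 1 (w @ u)))"
proof -
  obtain s0 where "\<forall>s\<ge>s0. \<forall>len\<ge>bits_needed s. ready k s (prefix_code \<omega> len)"
    using ready_complete[OF in_dom] by blast
  then obtain s' len' where *: "bits_needed s' \<le> len'" "ready k s' (prefix_code \<omega> len')"
    "leads_to (reading k s len out w) (reading k s' len' out w)"
    using leads_to_ready[OF assms, of s0 k s len w] by blast
  have "leads_to (reading k s len out w) (reading (Suc k) s' len' 1 (w @ u))"
    if u: "word (k, s', prefix_code \<omega> len') = word_code u" for u
  proof -
    have "tstep (transition word) \<omega> (reading k s' len' out w) = ((Suc k, s', prefix_code \<omega> len', len', word_code u), len', w)"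
      using * assms u by (simp add: tstep_def transition_def reading_def)
    with leads_to_pop[of "Suc k" s' "prefix_code \<omega> len'" len' u len' w]
    have "leads_to (reading k s' len' out w) (reading (Suc k) s' len' 1 (w @ u))"
      using leads_to_step by (simp add: reading_def)
    with *(3) show ?thesis by (rule leads_to_trans)
  qed
  with * show ?thesis by blast
qed

end

lemma initial_segments_limit:
  fixes f :: "nat \<Rightarrow> 'a list"
  assumes mono: "\<And>m n. m \<le> n \<Longrightarrow> \<exists>u. f n = f m @ u" and unbounded: "\<And>l. \<exists>n. l < length (f n)"
  shows "\<exists>y. \<forall>n. initial_segment (f n) y"
proof -
  obtain h where h: "\<And>l. l < length (f (h l))" using unbounded by metis
  have nth: "f m ! l = f n ! l" if "l < length (f m)" "l < length (f n)" for l m n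
    using mono[of m n] mono[of n m] that by (cases "m \<le> n") (auto simp: nth_append)
  have "initial_segment (f n) (\<lambda>l. f (h l) ! l)" for n
    unfolding initial_segment_def by (intro nth_equalityI) (auto intro!: nth h)
  then show ?thesis by blast
qed

lemma wiener_computable: "type2_computable wiener"
proof -
  have "crat (\<lambda>z::nat \<times> nat \<times> nat \<times> nat. vertex (precision (fst z) (find_level (fst (snd z)) (fst (snd (snd z)))))
      (depth (fst z) (find_level (fst (snd z)) (fst (snd (snd z))))) (find_level (fst (snd z)) (fst (snd (snd z))))
      (fst (snd z)) (fst (snd (snd z))) (snd (snd (snd z))))"
    by (intro cmp_intros)
  then obtain t where t: "cmp t" "\<And>k s p l. vertex (precision k (find_level s p)) (depth k (find_level s p)) (find_level s p) s p l = rval (t (k, s, p, l))"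
    unfolding crat_def by (metis fst_conv snd_conv)
  define word where "word z = push_polygon (2 ^ depth (fst z) (find_level (fst (snd z)) (snd (snd z))))
      (\<lambda>l. t (fst z, fst (snd z), snd (snd z), l))" for z
  have "cmp word"
    unfolding word_def[abs_def] push_polygon_def by (intro cmp_intros cmp_comp[OF t(1)])
  then have "cmp (transition word)" by (rule cmp_transition)
  from transducer_machine[OF this fst_transition, of "(0, 0, 0, 0, 0)"]
  obtain M where M: "valid_machine M"
    "\<And>x n. \<exists>m. written (run M x m) = snd (snd ((tstep (transition word) x ^^ n) ((0, 0, 0, 0, 0), 0, [])))"
    by (auto simp: pair_code_def)
  have "\<exists>y. produces M \<omega> y \<and> names y W" if W: "wiener \<omega> = Some W" for \<omega> W
  proof -
    have dom: "\<omega> \<in> gauss_dom" using W dom_wiener by auto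
    interpret emission \<omega> word by unfold_locales (rule dom)
    define good where "good k vs \<longleftrightarrow> polygon_code vs \<and> uniform_dist (polygon vs) W \<le> 1 / 2 ^ k" for k vs
    define P where "P k c \<longleftrightarrow> (\<exists>s len out w. c = reading k s len out w \<and> out \<le> 1)" for k c
    define Q where "Q k c d \<longleftrightarrow> leads_to c d \<and> (\<exists>vs. good k vs \<and> snd (snd d) = snd (snd c) @ enc_polygon vs)" for k c d
    let ?c0 = "((0, 0, 0, 0, 0), 0, []) :: tstate \<times> nat \<times> bool list"
    have "\<exists>f. f 0 = ?c0 \<and> (\<forall>k. P k (f k) \<and> Q k (f k) (f (Suc k)))"
    proof -
      \<comment> \<open>The accuracy and the prefix length at which a polygon is emitted depend on
        the input and are known only to exist, so the configurations after successive emissions are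
        obtained by dependent choice.\<close>
      have "\<exists>f. \<forall>k. (P k (f k) \<and> (k = 0 \<longrightarrow> f k = ?c0)) \<and> Q k (f k) (f (Suc k))"
      proof (rule dependent_nat_choice)
        show "\<exists>c. P 0 c \<and> (0 = (0::nat) \<longrightarrow> c = ?c0)"
          unfolding P_def reading_def prefix_code_def by (intro exI[of _ ?c0]) auto
        fix c k assume "P k c \<and> (k = 0 \<longrightarrow> c = ?c0)"
        then obtain s len out w where c: "c = reading k s len out w" "out \<le> 1" by (auto simp: P_def)
        obtain s' len' where s': "bits_needed s' \<le> len'" "ready k s' (prefix_code \<omega> len')"
          "\<And>u. word (k, s', prefix_code \<omega> len') = word_code u \<Longrightarrow>
             leads_to (reading k s len out w) (reading (Suc k) s' len' 1 (w @ u))"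
          using leads_to_next[OF c(2)] by blast
        let ?p = "prefix_code \<omega> len'"
        have lv: "find_level s' ?p = level \<omega>"
          using s'(2) by (intro find_level_sound[OF s'(1)]) (simp add: ready_def stage_ok_def)
        let ?M = "depth k (level \<omega>)"
        define vs where "vs = grid_polygon (2 ^ ?M) (\<lambda>l. frac_of (t (k, s', ?p, l)))"
        have "word (k, s', ?p) = word_code (enc_polygon vs)"
          by (simp add: word_def lv vs_def word_code_polygon)
        then have 1: "leads_to c (reading (Suc k) s' len' 1 (w @ enc_polygon vs))" using s'(3) c by simp
        have "good k vs"
          unfolding good_def vs_def
        proof (intro conjI polygon_code_grid grid_polygon_close_wiener[OF W refl])
          fix l :: nat assume "l \<le> 2 ^ ?M"
          then have "\<bar>vertex (precision k (level \<omega>)) ?M (level \<omega>) s' ?p l - partial_path ?M (zeta \<omega>) (real l / 2 ^ ?M)\<bar> \<le> 1 / 2 ^ (k + 1)"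
            using s'(2) by (intro vertex_sound[OF s'(1)]) (simp_all add: ready_def lv precision_def)
          then show "\<bar>frac_val (frac_of (t (k, s', ?p, l))) - partial_path ?M (zeta \<omega>) (real l / 2 ^ ?M)\<bar> \<le> 1 / 2 ^ (k + 1)"
            using t(2)[of k s' ?p l] by (simp add: frac_val_frac_of lv)
        qed simp
        with 1 have "Q k c (reading (Suc k) s' len' 1 (w @ enc_polygon vs))"
          by (auto simp: Q_def c reading_def)
        moreover have "P (Suc k) (reading (Suc k) s' len' 1 (w @ enc_polygon vs))" by (auto simp: P_def)
        ultimately show "\<exists>d. (P (Suc k) d \<and> (Suc k = 0 \<longrightarrow> d = ?c0)) \<and> Q k c d" by blast
      qed
      then show ?thesis by blast
    qed
    then obtain f where f: "f 0 = ?c0" "\<And>k. Q k (f k) (f (Suc k))" by blast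
    then obtain vs where vs: "\<And>k. good k (vs k)" "\<And>k. snd (snd (f (Suc k))) = snd (snd (f k)) @ enc_polygon (vs k)"
      unfolding Q_def by metis
    let ?e = "\<lambda>n. concat (map (\<lambda>k. enc_polygon (vs k)) [0..<n])"
    have out: "snd (snd (f n)) = ?e n" for n by (induction n) (simp_all add: f(1) vs(2))
    have reach: "leads_to ?c0 (f n)" for n
    proof (induction n)
      case (Suc n)
      then show ?case using f(2)[of n] leads_to_trans by (auto simp: Q_def)
    qed (simp add: f(1) leads_to_refl)
    have tm: "\<exists>m. written (run M \<omega> m) = ?e n" for n
    proof -
      obtain j where "(tstep (transition word) \<omega> ^^ j) ?c0 = f n" using reach unfolding leads_to_def by blast
      then show ?thesis using M(2)[of \<omega> j] out[of n] by simp
    qed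
    \<comment> \<open>Every polygon code contains at least the delimiter of its length, so the
      output is infinite.\<close>
    have len: "n \<le> length (?e n)" for n
      by (induction n) (simp_all add: enc_polygon_def enc_nat_def)
    have unbounded: "\<exists>m. l < length (written (run M \<omega> m))" for l
      using tm[of "Suc l"] len[of "Suc l"] by (metis Suc_le_lessD)
    obtain y where y: "\<And>m. initial_segment (written (run M \<omega> m)) y"
      using initial_segments_limit[of "\<lambda>m. written (run M \<omega> m)"] written_mono unbounded by blast
    have "produces M \<omega> y" using y unbounded by (simp add: produces_def)
    moreover have "initial_segment (?e n) y" for n using tm[of n] y by metis
    then have "names y W" unfolding names_def using vs(1) by (auto simp: good_def)
    ultimately show ?thesis by blast
  qed
  then show ?thesis unfolding type2_computable_def using M(1) by blast
qed

theorem theorem58: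
  shows "\<exists>W :: (nat \<Rightarrow> bool) \<rightharpoonup> (real \<Rightarrow> real).
           ran W \<subseteq> C01 \<and>
           type2_computable W \<and>
           open (dom W) \<and>
           measure coin_space (dom W) = 1 \<and>
           wiener_process01 (restrict_space coin_space (dom W)) (\<lambda>t \<omega>. the (W \<omega>) t)"
proof (intro exI[of _ wiener] conjI)
  show "ran wiener \<subseteq> C01" by (rule ran_wiener)
  show "type2_computable wiener" by (rule wiener_computable)
  show "open (dom wiener)" unfolding dom_wiener by (rule open_gauss_dom)
  show "measure coin_space (dom wiener) = 1" unfolding dom_wiener by (rule prob_gauss_dom)
  show "wiener_process01 (restrict_space coin_space (dom wiener)) (\<lambda>t \<omega>. the (wiener \<omega>) t)"
    unfolding dom_wiener by (rule wiener_process_wiener)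
qed

end
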